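(* Let $p\in[0,1/2]$ satisfy $p\ge 100\log\log n/n$, let $G_0$ be any graph on $\{1,\dots,n\}$, and let $G_{\mathrm{rand}}\sim\mathbb G(n,p)$. Let $\sigma$ be the trivial colouring assigning each vertex the same colour. Then with high probability every connected component of $D(G_0\triangle G_{\mathrm{rand}},\mathcal R^*\sigma)$ has at most $\log n/\log\log n$ vertices.
   Context: $\mathbb G(n,p)$ is the random graph on $\{1,\dots,n\}$ with each edge independently present with probability $p$; "with high probability" means with probability tending to $1$ as $n\to\infty$; $\triangle$ is symmetric difference of edge sets. Colour refinement: for a graph $G$ and colouring $c$, $\mathcal R_Gc(v)=(c(v),(d_\omega(v))_\omega)$ with $d_\omega(v)$ the number of neighbours of $v$ of colour $\omega$; iterating until the vertex partition stabilises gives $\mathcal R^*c$ (here computed in $G=G_0\triangle G_{\mathrm{rand}}$). Disparity graph: for a colouring $c$, $M(G,c)$ contains, for each (possibly equal) pair of colours $\omega,\omega'$, all possible edges between colour $\omega$ and colour $\omega'$ if at least half of them are edges of $G$, and none otherwise; $D(G,c)=M(G,c)\triangle G$. *)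

theory Defs
  imports "HOL-Probability.Probability"
begin

text \<open>
  A graph on a vertex set \<open>V\<close> is given by its set of edges, a subset of \<open>all_edges V\<close>.
\<close>

definition all_edges :: "'v set \<Rightarrow> 'v set set" where
  "all_edges V = {{u, v} | u v. u \<in> V \<and> v \<in> V \<and> u \<noteq> v}"

definition neighbours :: "'v set set \<Rightarrow> 'v \<Rightarrow> 'v set" where
  "neighbours E v = {u. u \<noteq> v \<and> {u, v} \<in> E}"

definition graph_components :: "'v set \<Rightarrow> 'v set set \<Rightarrow> 'v set set" where
  "graph_components V E =
     V // {(u, v). u \<in> V \<and> v \<in> V \<and> (u, v) \<in> {(x, y). {x, y} \<in> E}\<^sup>*}"

definition random_graph :: "'v set \<Rightarrow> real \<Rightarrow> 'v set set pmf" where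
  "random_graph V p =
     map_pmf (\<lambda>f. {e \<in> all_edges V. f e}) (Pi_pmf (all_edges V) False (\<lambda>_. bernoulli_pmf p))"

text \<open>
  Colours used in colour refinement. A refinement step replaces the colour of \<open>v\<close> by the pair of
  its old colour and the family, indexed by the colours \<open>\<omega>\<close>, of the numbers of neighbours of \<open>v\<close> of
  colour \<open>\<omega>\<close>. This family is encoded as the multiset with these multiplicities (see
  \<open>refine_eq\<close> and \<open>refine_colour_eq_iff\<close> below), so that all iterates have the same type.
\<close>

datatype 'a colour = Initial 'a | Refined "'a colour" "'a colour multiset"

definition refine :: "'v set set \<Rightarrow> ('v \<Rightarrow> 'a colour) \<Rightarrow> 'v \<Rightarrow> 'a colour" where
  "refine E c v = Refined (c v) (image_mset c (mset_set (neighbours E v)))"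

definition colour_degree :: "'v set set \<Rightarrow> ('v \<Rightarrow> 'c) \<Rightarrow> 'c \<Rightarrow> 'v \<Rightarrow> nat" where
  "colour_degree E c \<omega> v = card {u \<in> neighbours E v. c u = \<omega>}"

definition same_partition :: "'v set \<Rightarrow> ('v \<Rightarrow> 'c) \<Rightarrow> ('v \<Rightarrow> 'd) \<Rightarrow> bool" where
  "same_partition V c c' \<longleftrightarrow> (\<forall>u\<in>V. \<forall>v\<in>V. c u = c v \<longleftrightarrow> c' u = c' v)"

text \<open>
  The first iterate whose partition of \<open>V\<close> is not changed by a further refinement step; it exists
  for finite \<open>V\<close>, see \<open>refinement_stabilises\<close> below.
\<close>

definition stable_refinement ::
  "'v set \<Rightarrow> 'v set set \<Rightarrow> ('v \<Rightarrow> 'a colour) \<Rightarrow> 'v \<Rightarrow> 'a colour" where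
  "stable_refinement V E c =
     (refine E ^^ (LEAST t. same_partition V ((refine E ^^ t) c) ((refine E ^^ Suc t) c))) c"

definition trivial_colouring :: "'v \<Rightarrow> unit colour" where
  "trivial_colouring v = Initial ()"

definition pairs_between :: "'v set \<Rightarrow> ('v \<Rightarrow> 'c) \<Rightarrow> 'c \<Rightarrow> 'c \<Rightarrow> 'v set set" where
  "pairs_between V c \<omega> \<omega>' = {{u, v} | u v. u \<in> V \<and> v \<in> V \<and> u \<noteq> v \<and> c u = \<omega> \<and> c v = \<omega>'}"

definition majority_graph :: "'v set \<Rightarrow> 'v set set \<Rightarrow> ('v \<Rightarrow> 'c) \<Rightarrow> 'v set set" where
  "majority_graph V E c =
     (\<Union>\<omega>\<in>c ` V. \<Union>\<omega>'\<in>c ` V.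
        if real (card (pairs_between V c \<omega> \<omega>' \<inter> E)) \<ge> real (card (pairs_between V c \<omega> \<omega>')) / 2
        then pairs_between V c \<omega> \<omega>' else {})"

definition disparity_graph :: "'v set \<Rightarrow> 'v set set \<Rightarrow> ('v \<Rightarrow> 'c) \<Rightarrow> 'v set set" where
  "disparity_graph V E c = sym_diff (majority_graph V E c) E"

lemma finite_neighbours:
  assumes "finite V" "E \<subseteq> all_edges V"
  shows "finite (neighbours E v)"
proof (rule finite_subset[OF _ assms(1)])
  show "neighbours E v \<subseteq> V"
    using assms(2) by (auto simp: neighbours_def all_edges_def doubleton_eq_iff dest!: subsetD)
qed

lemma refine_eq:
  assumes "finite V" "E \<subseteq> all_edges V"
  shows "\<exists>m. refine E c v = Refined (c v) m \<and> (\<forall>\<omega>. count m \<omega> = colour_degree E c \<omega> v)"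
proof -
  have "count (image_mset c (mset_set (neighbours E v))) \<omega> = colour_degree E c \<omega> v" for \<omega>
    using finite_neighbours[OF assms]
    by (simp add: count_image_mset colour_degree_def vimage_def Int_def conj_commute)
  then show ?thesis
    by (auto simp: refine_def)
qed

lemma refine_colour_eq_iff:
  assumes "finite V" "E \<subseteq> all_edges V"
  shows "refine E c u = refine E c v \<longleftrightarrow>
           c u = c v \<and> (\<forall>\<omega>. colour_degree E c \<omega> u = colour_degree E c \<omega> v)"
  using refine_eq[OF assms, of c u] refine_eq[OF assms, of c v]
  by (auto simp: multiset_eq_iff)

lemma refinement_stabilises:
  fixes c :: "'v \<Rightarrow> 'a colour"
  assumes "finite V"
  shows "\<exists>t. same_partition V ((refine E ^^ t) c) ((refine E ^^ Suc t) c)"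
proof (rule ccontr)
  assume *: "\<not> ?thesis"
  define C where "C t = (refine E ^^ t) c" for t
  define old :: "'a colour \<Rightarrow> 'a colour" where
    "old x = (case x of Refined y _ \<Rightarrow> y | Initial _ \<Rightarrow> x)" for x
  have old: "old (C (Suc t) v) = C t v" for t v
    by (simp add: C_def old_def refine_def)
  have step: "card (C t ` V) < card (C (Suc t) ` V)" for t
  proof (rule ccontr)
    assume "\<not> ?thesis"
    moreover have img: "old ` C (Suc t) ` V = C t ` V"
      by (simp add: image_image old)
    moreover have "card (old ` C (Suc t) ` V) \<le> card (C (Suc t) ` V)"
      using assms by (intro card_image_le) auto
    ultimately have "inj_on old (C (Suc t) ` V)"
      using assms by (intro eq_card_imp_inj_on) auto
    then have "same_partition V (C t) (C (Suc t))"
      unfolding same_partition_def by (metis (no_types, lifting) old imageI inj_onD)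
    with * show False
      by (auto simp: C_def)
  qed
  have "t \<le> card (C t ` V)" for t
    by (induction t) (use step in \<open>auto intro: Suc_leI le_less_trans\<close>)
  then have "Suc (card V) \<le> card (C (Suc (card V)) ` V)" .
  with card_image_le[OF assms, of "C (Suc (card V))"] show False
    by linarith
qed

end

theory Submission
  imports Defs "HOL-Real_Asymp.Real_Asymp"
begin

text \<open>
  Let \<open>c\<close> be the stable colouring of the perturbed graph. Call a set closed if it contains every vertex
  that distinguishes two of its vertices of the same colour. Since disparity graphs have density at
  most \<open>1/2\<close> between colour classes, every nontrivial component of the disparity graph lies in the
  closed hull of a single pair of equally coloured vertices. Such a hull is explored step by step,
  guessing the colours of newly found vertices: at most \<open>ln n\<close> choices each, whereas a newly found
  vertex fails to lead to further vertices with probability a large power of \<open>1 / ln n\<close>. Hence it is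
  unlikely that the hull of any of the \<open>n\<^sup>2\<close> pairs stops growing beyond \<open>ln n / ln (ln n)\<close> vertices.

  A larger exploration continues without guesses. A vector with sum zero over each colour class is
  mapped by the adjacency matrix to another such vector, and the support keeps growing until it has
  about \<open>\<surd>n\<close> vertices whose edges are mostly unrevealed. As vertices of the same colour have the same
  degree, the vector sums to zero over the vertices of any given degree. By Littlewood-Offord
  estimates for many degrees at once this has probability below any fixed power of \<open>1 / n\<close>.
\<close>

subsection \<open>Expectation over a random subset of a finite set\<close>

text \<open>The stable colouring depends on the whole random graph, so it cannot be fixed before
  edges are revealed, and there are far too many colourings for a union bound. Hence the events
  \<open>big_hull\<close> and \<open>balanceable\<close> quantify over all equitable colourings with
  prescribed behaviour on few vertices; they are events of the graph alone and pass from one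
  exploration round to the next. A guess costs a factor \<open>card (Q \<union> N)\<close> per new
  vertex. Against failure probabilities like \<open>(ln n) ^ (-5)\<close> this is affordable while
  the explored set has at most \<open>ln n\<close> vertices, but not for much larger sets; hence the
  second phase. The phases are linked by a vector built from powers of 3 whose neighbour sums vanish
  exactly where the closure rule adds nothing. Each round reveals the edges at the current frontier
  and absorbs them into the deterministic graph \<open>H\<close>. Probabilities are therefore finite
  sums over edge subsets, and conditioning on revealed edges means splitting such a sum.\<close>

definition subset_exp :: "real \<Rightarrow> 'e set \<Rightarrow> ('e set \<Rightarrow> real) \<Rightarrow> real" where
  "subset_exp p E f = (\<Sum>R\<in>Pow E. p ^ card R * (1 - p) ^ card (E - R) * f R)"

lemma subset_exp_empty [simp]: "subset_exp p {} f = f {}"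
  by (simp add: subset_exp_def)

lemma subset_exp_insert:
  assumes "finite E" "e \<notin> E"
  shows "subset_exp p (insert e E) f =
           (1 - p) * subset_exp p E f + p * subset_exp p E (\<lambda>R. f (insert e R))"
proof -
  let ?w = "\<lambda>A R. p ^ card R * (1 - p) ^ card (A - R)"
  have disj: "Pow E \<inter> insert e ` Pow E = {}"
    using assms(2) by auto
  have inj: "inj_on (insert e) (Pow E)"
    using assms(2) by (intro inj_onI) (auto simp: set_eq_iff)
  have 1: "?w (insert e E) R = (1 - p) * ?w E R" if "R \<in> Pow E" for R
  proof -
    have "insert e E - R = insert e (E - R)" "e \<notin> E - R" "finite (E - R)"
      using that assms by auto
    then show ?thesis by simp
  qed
  have 2: "?w (insert e E) (insert e R) = p * ?w E R" if "R \<in> Pow E" for R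
  proof -
    have "insert e E - insert e R = E - R" "e \<notin> R" "finite R"
      using that assms by (auto dest: finite_subset)
    then show ?thesis by simp
  qed
  have "subset_exp p (insert e E) f =
      (\<Sum>R\<in>Pow E. ?w (insert e E) R * f R) + (\<Sum>R\<in>insert e ` Pow E. ?w (insert e E) R * f R)"
    unfolding subset_exp_def Pow_insert
    by (rule sum.union_disjoint) (use assms disj in auto)
  also have "(\<Sum>R\<in>insert e ` Pow E. ?w (insert e E) R * f R) =
      (\<Sum>R\<in>Pow E. ?w (insert e E) (insert e R) * f (insert e R))"
    by (subst sum.reindex[OF inj]) simp
  also have "(\<Sum>R\<in>Pow E. ?w (insert e E) R * f R) = (1 - p) * subset_exp p E f"
    unfolding subset_exp_def sum_distrib_left by (intro sum.cong refl) (simp only: 1 mult.assoc)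
  also have "(\<Sum>R\<in>Pow E. ?w (insert e E) (insert e R) * f (insert e R)) =
      p * subset_exp p E (\<lambda>R. f (insert e R))"
    unfolding subset_exp_def sum_distrib_left by (intro sum.cong refl) (simp only: 2 mult.assoc)
  finally show ?thesis .
qed

lemma subset_exp_cong:
  assumes "\<And>R. R \<subseteq> E \<Longrightarrow> f R = g R"
  shows "subset_exp p E f = subset_exp p E g"
  unfolding subset_exp_def by (intro sum.cong) (auto simp: assms)

lemma subset_exp_add: "subset_exp p E (\<lambda>R. f R + g R) = subset_exp p E f + subset_exp p E g"
  by (simp add: subset_exp_def ring_distribs sum.distrib)

lemma subset_exp_cmult: "subset_exp p E (\<lambda>R. c * f R) = c * subset_exp p E f"
  unfolding subset_exp_def sum_distrib_left by (intro sum.cong) (auto simp: mult_ac)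

lemma subset_exp_multc: "subset_exp p E (\<lambda>R. f R * c) = subset_exp p E f * c"
  using subset_exp_cmult[of p E c f] by (simp add: mult.commute)

lemma subset_exp_sum: "subset_exp p E (\<lambda>R. \<Sum>i\<in>I. f i R) = (\<Sum>i\<in>I. subset_exp p E (f i))"
  unfolding subset_exp_def sum_distrib_left by (rule sum.swap)

lemma subset_exp_const [simp]: "finite E \<Longrightarrow> subset_exp p E (\<lambda>_. c) = c"
  by (induction E rule: finite_induct) (simp_all add: subset_exp_insert algebra_simps)

lemma subset_exp_mono:
  assumes "0 \<le> p" "p \<le> 1" "\<And>R. R \<subseteq> E \<Longrightarrow> f R \<le> g R"
  shows "subset_exp p E f \<le> subset_exp p E g"
  unfolding subset_exp_def by (intro sum_mono mult_left_mono) (use assms in auto)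

lemma subset_exp_nonneg:
  assumes "0 \<le> p" "p \<le> 1" "\<And>R. R \<subseteq> E \<Longrightarrow> 0 \<le> f R"
  shows "0 \<le> subset_exp p E f"
  unfolding subset_exp_def by (intro sum_nonneg mult_nonneg_nonneg) (use assms in auto)

lemma subset_exp_le_const:
  assumes "finite E" "0 \<le> p" "p \<le> 1" "\<And>R. R \<subseteq> E \<Longrightarrow> f R \<le> c"
  shows "subset_exp p E f \<le> c"
  using subset_exp_mono[OF assms(2,3), where E = E and f = f and g = "\<lambda>_. c"] assms(1,4) by simp

text \<open>Independence of disjoint edge sets in Fubini form. Conditioning on revealed edges is
  always an instance of this splitting.\<close>

lemma subset_exp_union:
  assumes "finite A" "finite B" "A \<inter> B = {}"
  shows "subset_exp p (A \<union> B) f = subset_exp p A (\<lambda>R. subset_exp p B (\<lambda>S. f (R \<union> S)))"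
  using assms
proof (induction A arbitrary: f rule: finite_induct)
  case (insert e A)
  have "subset_exp p (insert e (A \<union> B)) f =
      (1 - p) * subset_exp p (A \<union> B) f + p * subset_exp p (A \<union> B) (\<lambda>R. f (insert e R))"
    by (rule subset_exp_insert) (use insert in auto)
  also have "\<dots> = subset_exp p (insert e A) (\<lambda>R. subset_exp p B (\<lambda>S. f (R \<union> S)))"
    using insert by (simp add: subset_exp_insert)
  finally show ?case by simp
qed simp

lemma subset_exp_split:
  assumes "finite E" "A \<subseteq> E"
  shows "subset_exp p E f = subset_exp p (E - A) (\<lambda>R. subset_exp p A (\<lambda>S. f (R \<union> S)))"
proof -
  have "(E - A) \<union> A = E" using assms by auto
  then show ?thesis
    using subset_exp_union[of "E - A" A p f] assms by (auto dest: finite_subset)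
qed

lemma subset_exp_marginal:
  assumes "finite E" "A \<subseteq> E" "\<And>R. R \<subseteq> E \<Longrightarrow> f R = g (R \<inter> A)"
  shows "subset_exp p E f = subset_exp p A g"
proof -
  have "subset_exp p E f = subset_exp p (E - A) (\<lambda>R. subset_exp p A (\<lambda>S. f (R \<union> S)))"
    by (rule subset_exp_split[OF assms(1,2)])
  also have "\<dots> = subset_exp p (E - A) (\<lambda>R. subset_exp p A g)"
  proof (intro subset_exp_cong)
    fix R S assume "R \<subseteq> E - A" "S \<subseteq> A"
    then have "(R \<union> S) \<inter> A = S" "R \<union> S \<subseteq> E" using assms(2) by auto
    then show "f (R \<union> S) = g S" using assms(3) by auto
  qed
  also have "\<dots> = subset_exp p A g"
    using assms(1) by simp
  finally show ?thesis .
qed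

lemma subset_exp_prod:
  assumes "finite I" "\<And>i. i \<in> I \<Longrightarrow> finite (E i)" "disjoint_family_on E I"
  shows "subset_exp p (\<Union>i\<in>I. E i) (\<lambda>R. \<Prod>i\<in>I. f i (R \<inter> E i)) = (\<Prod>i\<in>I. subset_exp p (E i) (f i))"
  using assms
proof (induction I rule: finite_induct)
  case (insert j I)
  let ?U = "\<Union>i\<in>I. E i"
  have disj: "E j \<inter> ?U = {}"
    using insert.prems(2) insert.hyps(2) by (fastforce simp: disjoint_family_on_def)
  have "subset_exp p (\<Union>i\<in>insert j I. E i) (\<lambda>R. \<Prod>i\<in>insert j I. f i (R \<inter> E i)) =
      subset_exp p (E j) (\<lambda>R. subset_exp p ?U (\<lambda>S. \<Prod>i\<in>insert j I. f i ((R \<union> S) \<inter> E i)))"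
    using insert.hyps insert.prems disj by (simp add: subset_exp_union)
  also have "\<dots> = subset_exp p (E j) (\<lambda>R. subset_exp p ?U (\<lambda>S. f j R * (\<Prod>i\<in>I. f i (S \<inter> E i))))"
  proof (intro subset_exp_cong)
    fix R S assume RS: "R \<subseteq> E j" "S \<subseteq> ?U"
    have "(R \<union> S) \<inter> E j = R" using RS disj by auto
    moreover have "(R \<union> S) \<inter> E i = S \<inter> E i" if "i \<in> I" for i
      using RS disj that by auto
    ultimately show "(\<Prod>i\<in>insert j I. f i ((R \<union> S) \<inter> E i)) = f j R * (\<Prod>i\<in>I. f i (S \<inter> E i))"
      using insert.hyps by simp
  qed
  also have "\<dots> = subset_exp p (E j) (\<lambda>R. f j R * (\<Prod>i\<in>I. subset_exp p (E i) (f i)))"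
    using insert.IH insert.prems
    by (simp add: subset_exp_cmult disjoint_family_on_def)
  also have "\<dots> = (\<Prod>i\<in>insert j I. subset_exp p (E i) (f i))"
    using insert.hyps by (simp add: subset_exp_multc)
  finally show ?case .
qed simp

lemma subset_exp_reindex:
  assumes "bij_betw h (Pow E) (Pow E)" "finite E" "\<And>R. R \<subseteq> E \<Longrightarrow> card (h R) = card R"
  shows "subset_exp p E (\<lambda>R. f (h R)) = subset_exp p E f"
proof -
  have "card (E - h R) = card (E - R)" if "R \<subseteq> E" for R
  proof -
    have "h R \<subseteq> E" using assms(1) that by (auto simp: bij_betw_def)
    then show ?thesis
      using that assms(2,3) by (simp add: card_Diff_subset finite_subset)
  qed
  then have "subset_exp p E (\<lambda>R. f (h R)) =
      (\<Sum>R\<in>Pow E. p ^ card (h R) * (1 - p) ^ card (E - h R) * f (h R))"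
    unfolding subset_exp_def by (intro sum.cong refl) (simp add: assms(3))
  also have "\<dots> = subset_exp p E f"
    unfolding subset_exp_def by (rule sum.reindex_bij_betw[OF assms(1)])
  finally show ?thesis .
qed

text \<open>A coin of bias \<open>p \<le> 1/2\<close> is a coin of bias \<open>2p\<close> followed by a fair one.\<close>

lemma subset_exp_thinning:
  assumes "finite E"
  shows "subset_exp p E f = subset_exp (2 * p) E (\<lambda>S. (\<Sum>R\<in>Pow S. f R) / 2 ^ card S)"
  using assms
proof (induction E arbitrary: f rule: finite_induct)
  case (insert e E)
  have "(\<Sum>R\<in>Pow (insert e S). f R) / 2 ^ card (insert e S) =
        1/2 * ((\<Sum>R\<in>Pow S. f R) / 2 ^ card S) + 1/2 * ((\<Sum>R\<in>Pow S. f (insert e R)) / 2 ^ card S)"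
    if "S \<subseteq> E" for S
  proof -
    have S: "finite S" "e \<notin> S" using that insert.hyps by (auto dest: finite_subset)
    have inj: "inj_on (insert e) (Pow S)"
      using S(2) by (intro inj_onI) (auto simp: set_eq_iff)
    have "(\<Sum>R\<in>Pow (insert e S). f R) = (\<Sum>R\<in>Pow S. f R) + (\<Sum>R\<in>insert e ` Pow S. f R)"
      unfolding Pow_insert by (rule sum.union_disjoint) (use S in auto)
    also have "(\<Sum>R\<in>insert e ` Pow S. f R) = (\<Sum>R\<in>Pow S. f (insert e R))"
      by (subst sum.reindex[OF inj]) simp
    finally show ?thesis using S by (simp add: field_simps)
  qed
  then have "subset_exp (2 * p) E (\<lambda>S. (\<Sum>R\<in>Pow (insert e S). f R) / 2 ^ card (insert e S)) =
     1/2 * subset_exp p E f + 1/2 * subset_exp p E (\<lambda>R. f (insert e R))"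
    unfolding insert.IH subset_exp_cmult[symmetric] subset_exp_add[symmetric]
    by (intro subset_exp_cong) simp
  moreover have "subset_exp (2 * p) E (\<lambda>S. (\<Sum>R\<in>Pow S. f R) / 2 ^ card S) = subset_exp p E f"
    using insert.IH[of f] by simp
  ultimately show ?case
    unfolding subset_exp_insert[OF insert.hyps] by (simp only:) (simp add: algebra_simps)
qed simp

text \<open>The generating function of a binomial variable; at bias \<open>2 * p\<close> it is used
  with \<open>c = 0\<close> and \<open>c = 1/2\<close>.\<close>

lemma subset_exp_power_card:
  assumes "finite E"
  shows "subset_exp p E (\<lambda>R. c ^ card R) = (1 - p + p * c) ^ card E"
  using assms
proof (induction E rule: finite_induct)
  case (insert e E)
  have "subset_exp p E (\<lambda>R. c ^ card (insert e R)) = subset_exp p E (\<lambda>R. c * c ^ card R)"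
  proof (rule subset_exp_cong)
    fix R assume "R \<subseteq> E"
    then have "finite R" "e \<notin> R" using insert.hyps by (auto dest: finite_subset)
    then show "c ^ card (insert e R) = c * c ^ card R" by simp
  qed
  then show ?case
    using insert by (simp add: subset_exp_insert subset_exp_cmult algebra_simps)
qed simp

lemma prob_Pi_pmf_bernoulli:
  fixes p :: real
  assumes "finite E" "0 \<le> p" "p \<le> 1"
  shows "measure_pmf.prob (map_pmf (\<lambda>f. {e \<in> E. f e}) (Pi_pmf E False (\<lambda>_. bernoulli_pmf p))) X =
           subset_exp p E (\<lambda>R. of_bool (R \<in> X))"
  using assms(1)
proof (induction E arbitrary: X rule: finite_induct)
  case empty
  then show ?case by (simp add: indicator_def)
next
  case (insert e E)
  let ?P = "Pi_pmf E False (\<lambda>_. bernoulli_pmf p)"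
  let ?M = "map_pmf (\<lambda>f. {e \<in> E. f e}) ?P"
  have ins: "map_pmf (\<lambda>f. {e' \<in> insert e E. f e'}) (Pi_pmf (insert e E) False (\<lambda>_. bernoulli_pmf p)) =
        bernoulli_pmf p \<bind> (\<lambda>b. map_pmf (\<lambda>R. if b then insert e R else R) ?M)"
  proof -
    have "map_pmf (\<lambda>f. {e' \<in> insert e E. f e'}) (Pi_pmf (insert e E) False (\<lambda>_. bernoulli_pmf p)) =
       bernoulli_pmf p \<bind> (\<lambda>b. ?P \<bind> (\<lambda>f. return_pmf {e' \<in> insert e E. (f(e := b)) e'}))"
      unfolding Pi_pmf_insert'[OF insert.hyps] by (simp add: map_bind_pmf)
    also have "\<dots> = bernoulli_pmf p \<bind> (\<lambda>b. map_pmf (\<lambda>R. if b then insert e R else R) ?M)"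
    proof (intro bind_pmf_cong refl)
      fix b
      have "{e' \<in> insert e E. (f(e := b)) e'} = (if b then insert e {e \<in> E. f e} else {e \<in> E. f e})" for f
        using insert.hyps by (auto split: if_splits)
      then show "?P \<bind> (\<lambda>f. return_pmf {e' \<in> insert e E. (f(e := b)) e'}) =
           map_pmf (\<lambda>R. if b then insert e R else R) ?M"
        by (simp add: map_pmf_def bind_assoc_pmf bind_return_pmf)
    qed
    finally show ?thesis .
  qed
  have nn: "0 \<le> subset_exp p E (\<lambda>R. of_bool (R \<in> X))" for X
    by (rule subset_exp_nonneg) (use assms in auto)
  have "emeasure (measure_pmf (bernoulli_pmf p \<bind> (\<lambda>b. map_pmf (\<lambda>R. if b then insert e R else R) ?M))) X
      = ennreal (p * subset_exp p E (\<lambda>R. of_bool (insert e R \<in> X)) +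
                (1 - p) * subset_exp p E (\<lambda>R. of_bool (R \<in> X)))"
  proof -
    have em: "emeasure (measure_pmf ?M) Y = ennreal (subset_exp p E (\<lambda>R. of_bool (R \<in> Y)))" for Y
      by (simp only: measure_pmf.emeasure_eq_measure insert.IH)
    have em': "emeasure (measure_pmf (map_pmf (\<lambda>R. if b then insert e R else R) ?M)) X =
        ennreal (subset_exp p E (\<lambda>R. of_bool ((if b then insert e R else R) \<in> X)))" for b
      unfolding emeasure_map_pmf[of _ ?M] em by simp
    show ?thesis
      unfolding emeasure_bind_pmf em' using assms nn[of X] nn[of "insert e -` X"]
      by (subst nn_integral_bernoulli_pmf)
        (auto simp: ennreal_mult'[symmetric] ennreal_plus[symmetric] mult.commute simp del: ennreal_plus)
  qed
  then have "ennreal (measure_pmf.prob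
        (bernoulli_pmf p \<bind> (\<lambda>b. map_pmf (\<lambda>R. if b then insert e R else R) ?M)) X)
      = ennreal (p * subset_exp p E (\<lambda>R. of_bool (insert e R \<in> X)) +
                (1 - p) * subset_exp p E (\<lambda>R. of_bool (R \<in> X)))"
    by (simp only: measure_pmf.emeasure_eq_measure)
  then have "measure_pmf.prob
        (bernoulli_pmf p \<bind> (\<lambda>b. map_pmf (\<lambda>R. if b then insert e R else R) ?M)) X
      = p * subset_exp p E (\<lambda>R. of_bool (insert e R \<in> X)) +
                (1 - p) * subset_exp p E (\<lambda>R. of_bool (R \<in> X))"
    by (rule ennreal_inj[THEN iffD1, rotated 2])
      (use assms nn[of X] nn[of "insert e -` X"] in \<open>auto intro!: add_nonneg_nonneg mult_nonneg_nonneg\<close>)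
  then show ?case
    unfolding ins by (simp only: subset_exp_insert[OF insert.hyps] add.commute)
qed

subsection \<open>Littlewood-Offord bounds\<close>

lemma LYM_inequality:
  assumes "finite S" "\<F> \<subseteq> Pow S" "\<And>A B. A \<in> \<F> \<Longrightarrow> B \<in> \<F> \<Longrightarrow> A \<subseteq> B \<Longrightarrow> A = B"
  shows "(\<Sum>A\<in>\<F>. 1 / real (card S choose card A)) \<le> 1"
  using assms
proof (induction "card S" arbitrary: S \<F>)
  case 0
  then have "S = {}" by simp
  with 0 have "\<F> = {} \<or> \<F> = {{}}" by auto
  then show ?case by auto
next
  case (Suc N)
  show ?case
  proof (cases "S \<in> \<F>")
    case True
    then have "\<F> = {S}" using Suc.prems by blast
    then show ?thesis by simp
  next
    case False
    have fin: "finite \<F>" using Suc.prems by (auto intro: finite_subset)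
    \<comment> \<open>Each \<open>A\<close> is charged to the points it misses. By the absorption
      identity for binomial coefficients its weight is \<open>1 / card S\<close> times the sum of
      its weights in the ground sets \<open>S - {x}\<close>, where the members missing
      \<open>x\<close> again form an antichain.\<close>
    have summand: "1 / real (card S choose card A) =
        1 / real (card S) * (\<Sum>x | x \<in> S \<and> x \<notin> A. 1 / real (N choose card A))" if "A \<in> \<F>" for A
    proof -
      have A: "A \<subset> S" using that False Suc.prems by auto
      then have lt: "card A < card S" using Suc.prems by (intro psubset_card_mono) auto
      have "{x. x \<in> S \<and> x \<notin> A} = S - A" by auto
      then have c: "card {x. x \<in> S \<and> x \<notin> A} = card S - card A"
        using A Suc.prems(1) by (simp add: card_Diff_subset finite_subset[OF psubset_imp_subset])
      have "(card S - card A) * (card S choose card A) = card S * (N choose card A)"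
        using binomial_absorb_comp[of "card S" "card A"] Suc.hyps(2)[symmetric] by simp
      then have "real (card S - card A) * real (card S choose card A) = real (card S) * real (N choose card A)"
        by (simp flip: of_nat_mult)
      moreover have "real (card S choose card A) > 0" "real (N choose card A) > 0" "real (card S) > 0"
        using lt Suc.hyps(2) by (auto simp: zero_less_binomial_iff)
      ultimately show ?thesis using c by (simp add: field_simps)
    qed
    have "(\<Sum>A\<in>\<F>. 1 / real (card S choose card A)) =
        1 / real (card S) * (\<Sum>A\<in>\<F>. \<Sum>x | x \<in> S \<and> x \<notin> A. 1 / real (N choose card A))"
      unfolding sum_distrib_left by (rule sum.cong[OF refl]) (simp only: summand sum_distrib_left)
    moreover have "(\<Sum>A\<in>\<F>. \<Sum>x | x \<in> S \<and> x \<notin> A. 1 / real (N choose card A)) =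
        (\<Sum>x\<in>S. \<Sum>A | A \<in> \<F> \<and> x \<notin> A. 1 / real (N choose card A))"
      by (rule sum.swap_restrict) (use fin Suc.prems in auto)
    moreover have "(\<Sum>x\<in>S. \<Sum>A | A \<in> \<F> \<and> x \<notin> A. 1 / real (N choose card A)) \<le> (\<Sum>x\<in>S. 1)"
    proof (rule sum_mono)
      fix x assume x: "x \<in> S"
      have N: "N = card (S - {x})" using x Suc.hyps(2) Suc.prems by simp
      show "(\<Sum>A | A \<in> \<F> \<and> x \<notin> A. 1 / real (N choose card A)) \<le> 1"
        unfolding N by (rule Suc.hyps(1)[OF N]) (use Suc.prems in blast)+
    qed
    ultimately have "(\<Sum>A\<in>\<F>. 1 / real (card S choose card A)) \<le> 1 / real (card S) * real (card S)"
      by (auto intro!: mult_left_mono)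
    then show ?thesis
      using Suc.hyps(2)[symmetric] by simp
  qed
qed

lemma sperner:
  assumes "finite S" "\<F> \<subseteq> Pow S" "\<And>A B. A \<in> \<F> \<Longrightarrow> B \<in> \<F> \<Longrightarrow> A \<subseteq> B \<Longrightarrow> A = B"
  shows "card \<F> \<le> card S choose (card S div 2)"
proof -
  let ?C = "card S choose (card S div 2)"
  have pos: "real ?C > 0" by (simp add: zero_less_binomial_iff)
  have "real (card \<F>) / real ?C = (\<Sum>A\<in>\<F>. 1 / real ?C)" by simp
  also have "\<dots> \<le> (\<Sum>A\<in>\<F>. 1 / real (card S choose card A))"
  proof (rule sum_mono)
    fix A assume "A \<in> \<F>"
    then have "card A \<le> card S" using assms by (auto intro: card_mono)
    then have "card S choose card A > 0" by (simp add: zero_less_binomial_iff)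
    then show "1 / real ?C \<le> 1 / real (card S choose card A)"
      using binomial_maximum[of "card S" "card A"] by (intro divide_left_mono) auto
  qed
  also have "\<dots> \<le> 1" by (rule LYM_inequality[OF assms])
  finally show ?thesis using pos by (simp add: field_simps)
qed

text \<open>Erdos's argument: complementing the coordinates with negative coefficients shifts all
  sums by one constant and makes every coefficient positive. Such sums grow strictly under
  inclusion, so the solutions become an antichain and Sperner's theorem applies.\<close>

lemma littlewood_offord:
  fixes a :: "'i \<Rightarrow> real"
  assumes "finite I" "\<And>i. i \<in> I \<Longrightarrow> a i \<noteq> 0"
  shows "card {J. J \<subseteq> I \<and> (\<Sum>i\<in>J. a i) = c} \<le> card I choose (card I div 2)"
proof -
  define N where "N = {i \<in> I. a i < 0}"
  define \<phi> where "\<phi> J = sym_diff J N" for J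
  let ?\<A> = "{J. J \<subseteq> I \<and> (\<Sum>i\<in>J. a i) = c}"
  have inj: "inj_on \<phi> UNIV"
    by (intro inj_onI) (auto simp: \<phi>_def set_eq_iff)
  have sum_phi: "(\<Sum>i\<in>\<phi> J. \<bar>a i\<bar>) = (\<Sum>i\<in>J. a i) + (\<Sum>i\<in>N. \<bar>a i\<bar>)" if "J \<subseteq> I" for J
  proof -
    have sub: "\<phi> J \<subseteq> I" "N \<subseteq> I" using that by (auto simp: \<phi>_def N_def)
    have eq: "(\<Sum>i\<in>X. f i) = (\<Sum>i\<in>I. if i \<in> X then f i else 0)" if "X \<subseteq> I" for X and f :: "'i \<Rightarrow> real"
      using that assms(1) by (simp add: sum.If_cases Int_absorb1)
    show ?thesis
      unfolding eq[OF sub(1)] eq[OF sub(2)] eq[OF that] sum.distrib[symmetric]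
      by (intro sum.cong refl) (auto simp: \<phi>_def N_def)
  qed
  have "card ?\<A> = card (\<phi> ` ?\<A>)"
    by (rule card_image[symmetric]) (rule inj_on_subset[OF inj], simp)
  also have "\<dots> \<le> card I choose (card I div 2)"
  proof (rule sperner[OF assms(1)])
    show "\<phi> ` ?\<A> \<subseteq> Pow I" by (auto simp: \<phi>_def N_def)
    fix A B assume AB: "A \<in> \<phi> ` ?\<A>" "B \<in> \<phi> ` ?\<A>" "A \<subseteq> B"
    then have B: "B \<subseteq> I" "finite B"
      using assms(1) by (auto simp: \<phi>_def N_def intro: finite_subset)
    have "(\<Sum>i\<in>A. \<bar>a i\<bar>) = (\<Sum>i\<in>B. \<bar>a i\<bar>)"
      using AB(1,2) by (auto simp: sum_phi)
    moreover have "(\<Sum>i\<in>A. \<bar>a i\<bar>) < (\<Sum>i\<in>B. \<bar>a i\<bar>)" if "A \<noteq> B"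
    proof -
      from that AB(3) obtain b where b: "b \<in> B - A" by auto
      show ?thesis
        by (rule sum_strict_mono2[OF B(2) AB(3) b]) (use assms(2) b B in auto)
    qed
    ultimately show "A = B" by force
  qed
  finally show ?thesis .
qed

section \<open>Bounds on middle binomial coefficients\<close>

lemma central_binomial_sq_bound: "(real (2 * k choose k))\<^sup>2 * real (2 * k + 1) \<le> 16 ^ k"
proof (induction k)
  case (Suc k)
  have "Suc k * (2 * Suc k choose Suc k) = 2 * Suc k * (Suc (2 * k) choose k)"
    using Suc_times_binomial_eq[of "Suc (2 * k)" k] by simp
  moreover have "Suc k * (Suc (2 * k) choose k) = Suc (2 * k) * (2 * k choose k)"
    using binomial_absorb_comp[of "Suc (2 * k)" k] by simp
  ultimately have "Suc k * (Suc k * (2 * Suc k choose Suc k)) = Suc k * (2 * Suc (2 * k) * (2 * k choose k))"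
    by (metis mult.assoc mult.left_commute)
  then have "Suc k * (2 * Suc k choose Suc k) = 2 * Suc (2 * k) * (2 * k choose k)"
    by (simp only: mult_cancel1) simp
  then have rec: "real (k + 1) * real (2 * Suc k choose Suc k) = 2 * real (2 * k + 1) * real (2 * k choose k)"
    by (metis Suc_eq_plus1 of_nat_mult of_nat_numeral)
  have "(real (k + 1))\<^sup>2 * ((real (2 * Suc k choose Suc k))\<^sup>2 * real (2 * Suc k + 1)) =
      (real (k + 1) * real (2 * Suc k choose Suc k))\<^sup>2 * real (2 * k + 3)"
    by (simp add: power_mult_distrib)
  also have "\<dots> = ((real (2 * k choose k))\<^sup>2 * real (2 * k + 1)) * (4 * real (2 * k + 1) * real (2 * k + 3))"
    unfolding rec by (simp add: power_mult_distrib power2_eq_square algebra_simps)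
  also have "\<dots> \<le> 16 ^ k * (16 * (real (k + 1))\<^sup>2)"
  proof (rule mult_mono[OF Suc.IH])
    \<comment> \<open>The factor \<open>2k + 1\<close> in the squared bound reduces the induction
      step to \<open>(2k + 1)(2k + 3) \<le> 4 (k + 1)^2\<close>.\<close>
    show "4 * real (2 * k + 1) * real (2 * k + 3) \<le> 16 * (real (k + 1))\<^sup>2"
      by (simp add: power2_eq_square algebra_simps)
  qed auto
  finally have "(real (k + 1))\<^sup>2 * ((real (2 * Suc k choose Suc k))\<^sup>2 * real (2 * Suc k + 1))
       \<le> (real (k + 1))\<^sup>2 * 16 ^ Suc k"
    by simp
  then show ?case by (subst (asm) mult_le_cancel_left_pos) auto
qed simp

lemma middle_binomial_bound: "real (n choose (n div 2)) / 2 ^ n \<le> 1 / sqrt (real (n + 1))"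
proof -
  have "(real (n choose (n div 2)))\<^sup>2 * real (n + 1) \<le> (2 ^ n)\<^sup>2"
  proof (cases "even n")
    case True
    then obtain k where k: "n = 2 * k" by auto
    have "(16 :: real) ^ k = ((2 ^ n)\<^sup>2)" 
      unfolding k using power_mult[of "2::real" 4 k] power_mult[of "2::real" "2 * k" 2] by (simp add: mult.commute)
    then show ?thesis using central_binomial_sq_bound[of k] k by simp
  next
    case False
    then obtain k where k: "n = Suc (2 * k)" by (auto elim: oddE)
    have "2 * Suc k choose Suc k = 2 * (n choose (n div 2))"
    proof -
      have "Suc (2 * k) choose Suc k = Suc (2 * k) choose k"
        using binomial_symmetric[of "Suc k" "Suc (2 * k)"] by (simp del: binomial_Suc_Suc)
      moreover have "2 * Suc k choose Suc k = (Suc (2 * k) choose k) + (Suc (2 * k) choose Suc k)"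
        using binomial_Suc_Suc[of "Suc (2 * k)" k] by (simp del: binomial_Suc_Suc)
      ultimately show ?thesis using k by (simp del: binomial_Suc_Suc)
    qed
    then have "4 * ((real (n choose (n div 2)))\<^sup>2 * real (n + 1)) \<le>
        (real (2 * Suc k choose Suc k))\<^sup>2 * real (2 * Suc k + 1)"
      using k by (simp add: power_mult_distrib mult_left_mono)
    also have "\<dots> \<le> 16 ^ Suc k" by (rule central_binomial_sq_bound)
    also have "\<dots> = 4 * (2 ^ n)\<^sup>2" 
      unfolding k using power_mult[of "4::real" 2 k] by (simp add: power_even_eq power2_eq_square flip: power_mult_distrib)
    finally show ?thesis by simp
  qed
  then have "sqrt ((real (n choose (n div 2)))\<^sup>2 * real (n + 1)) \<le> sqrt ((2 ^ n)\<^sup>2)"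
    by (rule real_sqrt_le_mono)
  then have "real (n choose (n div 2)) * sqrt (real (n + 1)) \<le> 2 ^ n"
    by (simp add: real_sqrt_mult)
  then show ?thesis by (simp add: field_simps)
qed

lemma middle_binomial_le_half:
  assumes "n > 0"
  shows "real (n choose (n div 2)) / 2 ^ n \<le> 1 / 2"
proof (cases "n \<le> 2")
  case True
  then have "n = 1 \<or> n = 2" using assms by auto
  then show ?thesis by auto
next
  case False
  have "2 = sqrt 4" by simp
  also have "\<dots> \<le> sqrt (real (n + 1))" using False by (intro real_sqrt_le_mono) auto
  finally have "1 / sqrt (real (n + 1)) \<le> 1 / 2" by (intro divide_left_mono) auto
  then show ?thesis using middle_binomial_bound[of n] by linarith
qed

section \<open>Atoms of weighted sums of independent coins\<close>

lemma atom_le_middle_binomial: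
  fixes a :: "'e \<Rightarrow> real"
  assumes "finite E" "0 \<le> p" "p \<le> 1/2" "\<And>e. e \<in> E \<Longrightarrow> a e \<noteq> 0"
  shows "subset_exp p E (\<lambda>R. of_bool ((\<Sum>e\<in>R. a e) = c)) \<le>
           subset_exp (2 * p) E (\<lambda>S. real (card S choose (card S div 2)) / 2 ^ card S)"
  unfolding subset_exp_thinning[OF assms(1), of p]
proof (rule subset_exp_mono)
  \<comment> \<open>Given the set \<open>S\<close> chosen with bias \<open>2 * p\<close>, the set
    \<open>R\<close> is uniform on the subsets of \<open>S\<close>, as the Littlewood-Offord bound
    requires.\<close>
  fix S assume S: "S \<subseteq> E"
  have "(\<Sum>R\<in>Pow S. of_bool ((\<Sum>e\<in>R. a e) = c)) = real (card {R. R \<subseteq> S \<and> (\<Sum>e\<in>R. a e) = c})"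
    using S assms(1) by (subst sum_of_bool_eq) (auto intro: finite_subset simp: Int_def Pow_def)
  also have "\<dots> \<le> real (card S choose (card S div 2))"
    using littlewood_offord[of S a c] S assms by (auto intro: finite_subset)
  finally show "(\<Sum>R\<in>Pow S. of_bool ((\<Sum>e\<in>R. a e) = c)) / 2 ^ card S \<le>
      real (card S choose (card S div 2)) / 2 ^ card S"
    by (simp add: divide_right_mono)
qed (use assms in auto)

text \<open>Only an empty thinned set escapes the bound 1/2. In the proof \<open>0 ^ card S\<close>
  is the indicator of that event, with expectation \<open>(1 - 2 * p) ^ card E\<close>.\<close>

lemma atom_le_half:
  fixes a :: "'e \<Rightarrow> real"
  assumes "finite E" "0 \<le> p" "p \<le> 1/2" "\<And>e. e \<in> E \<Longrightarrow> a e \<noteq> 0"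
  shows "subset_exp p E (\<lambda>R. of_bool ((\<Sum>e\<in>R. a e) = c)) \<le> (1 + (1 - 2 * p) ^ card E) / 2"
proof -
  have "subset_exp p E (\<lambda>R. of_bool ((\<Sum>e\<in>R. a e) = c)) \<le>
      subset_exp (2 * p) E (\<lambda>S. 1/2 + 1/2 * 0 ^ card S)"
  proof (rule order.trans[OF atom_le_middle_binomial[OF assms] subset_exp_mono])
    fix S assume "S \<subseteq> E"
    show "real (card S choose (card S div 2)) / 2 ^ card S \<le> 1/2 + 1/2 * 0 ^ card S"
    proof (cases "card S = 0")
      case False
      then have "(0::real) ^ card S = 0" by simp
      then show ?thesis using middle_binomial_le_half[of "card S"] False by linarith
    qed simp
  qed (use assms in auto)
  also have "\<dots> = (1 + (1 - 2 * p) ^ card E) / 2"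
    unfolding subset_exp_add subset_exp_cmult subset_exp_power_card[OF assms(1)]
    using assms(1) by (simp add: add_divide_distrib)
  finally show ?thesis .
qed

text \<open>A thinned set with at least \<open>k\<close> coins gives \<open>1 / sqrt k\<close>. For
  a smaller one the trivial bound 1 is replaced by \<open>2 ^ (k - card S)\<close>, whose
  expectation is read off the generating function at 1/2.\<close>

lemma atom_le_sqrt:
  fixes a :: "'e \<Rightarrow> real"
  assumes "finite E" "0 \<le> p" "p \<le> 1/2" "\<And>e. e \<in> E \<Longrightarrow> a e \<noteq> 0" "k > 0"
  shows "subset_exp p E (\<lambda>R. of_bool ((\<Sum>e\<in>R. a e) = c)) \<le> 1 / sqrt (real k) + 2 ^ k * (1 - p) ^ card E"
proof -
  have "subset_exp p E (\<lambda>R. of_bool ((\<Sum>e\<in>R. a e) = c)) \<le>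
      subset_exp (2 * p) E (\<lambda>S. 1 / sqrt (real k) + 2 ^ k * (1/2) ^ card S)"
  proof (rule order.trans[OF atom_le_middle_binomial[OF assms(1-4)] subset_exp_mono])
    fix S assume "S \<subseteq> E"
    show "real (card S choose (card S div 2)) / 2 ^ card S \<le> 1 / sqrt (real k) + 2 ^ k * (1/2) ^ card S"
    proof (cases "k \<le> card S")
      case True
      then have "1 / sqrt (real (card S + 1)) \<le> 1 / sqrt (real k)"
        using assms(5) by (intro divide_left_mono) auto
      then show ?thesis using middle_binomial_bound[of "card S"] by (simp add: add_increasing2)
    next
      case False
      have "real (card S choose (card S div 2)) / 2 ^ card S \<le> 1"
        using order.trans[OF middle_binomial_le_half[of "card S"], of 1] by (cases "card S = 0") simp_all
      also have "1 \<le> (2::real) ^ (k - card S)" by simp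
      also have "\<dots> = 2 ^ k * (1/2) ^ card S"
        using False by (simp add: power_diff power_one_over)
      finally show ?thesis by (simp add: add_increasing)
    qed
  qed (use assms in auto)
  also have "\<dots> = 1 / sqrt (real k) + 2 ^ k * (1 - p) ^ card E"
    using assms(1) by (simp add: subset_exp_add subset_exp_cmult subset_exp_power_card)
  finally show ?thesis .
qed

text \<open>
  Each coin \<open>i\<close> influences the linear constraints of level at least \<open>lv i\<close> only, so the constraints
  can be imposed level by level, at every level with the new coins as fresh randomness.
\<close>

lemma triangular_littlewood_offord:
  fixes h :: "'i \<Rightarrow> nat \<Rightarrow> bool \<Rightarrow> real" and lv :: "'i \<Rightarrow> nat"
  assumes "finite I"
    and "\<And>i. i \<in> I \<Longrightarrow> h i (lv i) True \<noteq> h i (lv i) False"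
    and "\<And>i D. i \<in> I \<Longrightarrow> D < lv i \<Longrightarrow> h i D True = h i D False"
  shows "card {J. J \<subseteq> I \<and> (\<forall>D\<in>lv ` I. c D + (\<Sum>i\<in>I. h i D (i \<in> J)) = 0)} \<le>
           (\<Prod>D\<in>lv ` I. card {i \<in> I. lv i = D} choose (card {i \<in> I. lv i = D} div 2))"
  using assms
proof (induction I arbitrary: c rule: finite_psubset_induct)
  case (psubset I)
  show ?case
  proof (cases "I = {}")
    case False
    \<comment> \<open>The induction removes the top level. Constraints below \<open>m\<close> see
      its coins as constants, absorbed in \<open>c'\<close>. Once the other coins \<open>J'\<close>
      are fixed, the constraint of level \<open>m\<close> is one Littlewood-Offord problem for the
      coins in \<open>T\<close>, with solutions \<open>K J'\<close>.\<close>
    define m where "m = Max (lv ` I)"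
    define T where "T = {i \<in> I. lv i = m}"
    define I' where "I' = I - T"
    define c' where "c' D = c D + (\<Sum>i\<in>T. h i D False)" for D
    define b where "b J' = c' m + (\<Sum>i\<in>I'. h i m (i \<in> J'))" for J'
    define S where "S = {J. J \<subseteq> I \<and> (\<forall>D\<in>lv ` I. c D + (\<Sum>i\<in>I. h i D (i \<in> J)) = 0)}"
    define S' where "S' = {J. J \<subseteq> I' \<and> (\<forall>D\<in>lv ` I'. c' D + (\<Sum>i\<in>I'. h i D (i \<in> J)) = 0)}"
    define K where "K J' = {J. J \<subseteq> T \<and> (\<Sum>i\<in>J. h i m True - h i m False) = - b J'}" for J'
    let ?M = "\<lambda>I D. card {i \<in> I. lv i = D} choose (card {i \<in> I. lv i = D} div 2)"
    have fin: "finite I" by (rule psubset.hyps)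
    have m_in: "m \<in> lv ` I" unfolding m_def using False fin by (intro Max_in) auto
    have T: "T \<subseteq> I" "T \<noteq> {}" "finite T" using m_in fin by (auto simp: T_def)
    have I': "I' \<subset> I" "finite I'" "I = I' \<union> T" "I' \<inter> T = {}" using T fin by (auto simp: I'_def)
    have less: "lv i < m" if "i \<in> I'" for i
    proof -
      have "lv i \<le> m" unfolding m_def using that I' fin by (intro Max_ge) auto
      then show ?thesis using that by (auto simp: I'_def T_def)
    qed
    have img: "lv ` I = insert m (lv ` I')" "m \<notin> lv ` I'"
    proof -
      have "lv ` T = {m}" using T(2) by (auto simp: T_def)
      then show "lv ` I = insert m (lv ` I')" by (subst I'(3)) (simp add: image_Un)
      show "m \<notin> lv ` I'" using less by auto
    qed
    have split: "(\<Sum>i\<in>I. h i D (i \<in> J)) = (\<Sum>i\<in>I'. h i D (i \<in> J \<inter> I')) + (\<Sum>i\<in>T. h i D (i \<in> J))" for D J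
      unfolding I'(3) using I' T by (subst sum.union_disjoint) (auto intro: sum.cong)
    have IH: "card S' \<le> (\<Prod>D\<in>lv ` I'. ?M I' D)"
      unfolding S'_def by (rule psubset.IH) (use I' psubset.prems in auto)
    have cardK: "card (K J') \<le> ?M I m" for J'
      unfolding K_def T_def[symmetric]
      by (rule littlewood_offord[OF T(3)]) (use psubset.prems(1) in \<open>force simp: T_def\<close>)
    have finS': "finite S'" unfolding S'_def using I' by auto
    have finK: "finite (K J')" for J' unfolding K_def using T by auto
    have sub: "S \<subseteq> (\<lambda>(J', J). J' \<union> J) ` (SIGMA J':S'. K J')"
    proof
      fix J assume J: "J \<in> S"
      have JI: "J \<subseteq> I" using J by (simp add: S_def)
      have eq: "J = (J \<inter> I') \<union> (J \<inter> T)" using JI I' by auto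
      have "J \<inter> I' \<in> S'"
        unfolding S'_def
      proof (intro CollectI conjI ballI)
        fix D assume D: "D \<in> lv ` I'"
        then have "D < m" using less by auto
        then have eqD: "(\<Sum>i\<in>T. h i D (i \<in> J)) = (\<Sum>i\<in>T. h i D False)"
          using psubset.prems(2) T by (intro sum.cong refl) (smt (verit) T_def mem_Collect_eq)
        show "c' D + (\<Sum>i\<in>I'. h i D (i \<in> J \<inter> I')) = 0"
        proof -
          have "c D + (\<Sum>i\<in>I. h i D (i \<in> J)) = 0"
            using J D I'(1) by (auto simp: S_def)
          then show ?thesis
            using split[of D J] eqD unfolding c'_def by linarith
        qed
      qed auto
      moreover have "J \<inter> T \<in> K (J \<inter> I')"
      proof -
        have "(\<Sum>i\<in>T. h i m (i \<in> J)) = (\<Sum>i\<in>T. h i m False + (if i \<in> J then h i m True - h i m False else 0))"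
          by (intro sum.cong) auto
        also have "\<dots> = (\<Sum>i\<in>T. h i m False) + (\<Sum>i\<in>J \<inter> T. h i m True - h i m False)"
          using T by (simp add: sum.distrib sum.If_cases Int_commute)
        finally have eqT: "(\<Sum>i\<in>T. h i m (i \<in> J)) =
            (\<Sum>i\<in>T. h i m False) + (\<Sum>i\<in>J \<inter> T. h i m True - h i m False)" .
        show ?thesis
        proof -
          have "c m + (\<Sum>i\<in>I. h i m (i \<in> J)) = 0"
            using J m_in by (auto simp: S_def)
          with eqT have "(\<Sum>i\<in>J \<inter> T. h i m True - h i m False) = - b (J \<inter> I')"
            using split[of m J] unfolding b_def c'_def by linarith
          then show ?thesis by (simp add: K_def)
        qed
      qed
      ultimately show "J \<in> (\<lambda>(J', J). J' \<union> J) ` (SIGMA J':S'. K J')"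
        by (intro image_eqI[where x = "(J \<inter> I', J \<inter> T)"]) (simp_all flip: eq)
    qed
    have "card S \<le> card (SIGMA J':S'. K J')"
      using sub finS' finK by (rule_tac surj_card_le) auto
    also have "\<dots> = (\<Sum>J'\<in>S'. card (K J'))"
      using finS' finK by simp
    also have "\<dots> \<le> card S' * ?M I m"
      using sum_bounded_above[of S' "\<lambda>J'. card (K J')"] cardK by simp
    also have "\<dots> \<le> (\<Prod>D\<in>lv ` I'. ?M I' D) * ?M I m"
      using IH by simp
    also have "(\<Prod>D\<in>lv ` I'. ?M I' D) = (\<Prod>D\<in>lv ` I'. ?M I D)"
    proof (rule prod.cong[OF refl])
      fix D assume "D \<in> lv ` I'"
      then have "{i \<in> I'. lv i = D} = {i \<in> I. lv i = D}" using less by (fastforce simp: I'_def T_def)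
      then show "?M I' D = ?M I D" by simp
    qed
    also have "\<dots> * ?M I m = (\<Prod>D\<in>lv ` I. ?M I D)"
      unfolding img(1) using img(2) I'(2) by (simp add: mult.commute)
    finally show ?thesis unfolding S_def .
  qed auto
qed

subsection \<open>Equitable colourings and closed sets\<close>

definition equitable :: "'v set \<Rightarrow> 'v set set \<Rightarrow> ('v \<Rightarrow> 'c) \<Rightarrow> bool" where
  "equitable V G c \<longleftrightarrow>
     (\<forall>u\<in>V. \<forall>v\<in>V. c u = c v \<longrightarrow> (\<forall>\<omega>. colour_degree G c \<omega> u = colour_degree G c \<omega> v))"

lemma equitable_stable_refinement:
  assumes "finite V" "E \<subseteq> all_edges V"
  shows "equitable V E (stable_refinement V E c)"
proof -
  define t where "t = (LEAST t. same_partition V ((refine E ^^ t) c) ((refine E ^^ Suc t) c))"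
  have "same_partition V ((refine E ^^ t) c) ((refine E ^^ Suc t) c)"
    unfolding t_def using refinement_stabilises[OF assms(1)] by (rule LeastI_ex)
  moreover have "stable_refinement V E c = (refine E ^^ t) c"
    by (simp add: stable_refinement_def t_def)
  ultimately show ?thesis
    unfolding equitable_def same_partition_def
    by (simp add: refine_colour_eq_iff[OF assms]) blast
qed

text \<open>The relation \<open>d\<close> is arbitrary because the notion is applied both to a graph
  and to its disparity graph. Taking \<open>z\<close> equal to \<open>x\<close> or \<open>y\<close>
  is excluded, since adjacency between \<open>x\<close> and \<open>y\<close> themselves does not
  distinguish them.\<close>

definition closed_under :: "('v \<Rightarrow> 'v \<Rightarrow> bool) \<Rightarrow> 'v set \<Rightarrow> ('v \<Rightarrow> 'c) \<Rightarrow> 'v set \<Rightarrow> bool" where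
  "closed_under d V c Q \<longleftrightarrow> Q \<subseteq> V \<and>
     (\<forall>x\<in>Q. \<forall>y\<in>Q. c x = c y \<longrightarrow> (\<forall>z\<in>V. z \<noteq> x \<longrightarrow> z \<noteq> y \<longrightarrow> d x z \<noteq> d y z \<longrightarrow> z \<in> Q))"

definition hull_under :: "('v \<Rightarrow> 'v \<Rightarrow> bool) \<Rightarrow> 'v set \<Rightarrow> ('v \<Rightarrow> 'c) \<Rightarrow> 'v set \<Rightarrow> 'v set" where
  "hull_under d V c Q = \<Inter> {Q'. closed_under d V c Q' \<and> Q \<subseteq> Q'}"

lemma closed_underD:
  assumes "closed_under d V c Q" "x \<in> Q" "y \<in> Q" "c x = c y" "z \<in> V" "z \<noteq> x" "z \<noteq> y" "d x z \<noteq> d y z"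
  shows "z \<in> Q"
  using assms unfolding closed_under_def by blast

lemma closed_under_Int:
  "closed_under d V c A \<Longrightarrow> closed_under d V c B \<Longrightarrow> closed_under d V c (A \<inter> B)"
  unfolding closed_under_def by blast

lemma closed_under_hull:
  assumes "Q \<subseteq> V"
  shows "closed_under d V c (hull_under d V c Q)"
proof -
  let ?\<C> = "{Q'. closed_under d V c Q' \<and> Q \<subseteq> Q'}"
  have V: "V \<in> ?\<C>" using assms by (auto simp: closed_under_def)
  show ?thesis
    unfolding closed_under_def
  proof (intro conjI ballI impI)
    show "hull_under d V c Q \<subseteq> V" unfolding hull_under_def using V by blast
    fix x y z
    assume *: "x \<in> hull_under d V c Q" "y \<in> hull_under d V c Q" "c x = c y" "z \<in> V" "z \<noteq> x" "z \<noteq> y"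
      "d x z \<noteq> d y z"
    show "z \<in> hull_under d V c Q"
      unfolding hull_under_def
    proof (rule InterI)
      fix Q' assume Q': "Q' \<in> ?\<C>"
      have "x \<in> Q'" "y \<in> Q'" "closed_under d V c Q'"
        using *(1,2) Q' unfolding hull_under_def by blast+
      then show "z \<in> Q'" using closed_underD *(3-) by metis
    qed
  qed
qed

lemma hull_under_superset: "Q \<subseteq> hull_under d V c Q"
  by (auto simp: hull_under_def)

lemma hull_under_subset: "Q \<subseteq> V \<Longrightarrow> hull_under d V c Q \<subseteq> V"
  using closed_under_hull[of Q V d c] by (auto simp: closed_under_def)

lemma hull_under_minimal: "closed_under d V c Q' \<Longrightarrow> Q \<subseteq> Q' \<Longrightarrow> hull_under d V c Q \<subseteq> Q'"
  by (auto simp: hull_under_def)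

lemma hull_under_between:
  assumes "Q \<subseteq> V" "Q \<subseteq> Q'" "Q' \<subseteq> hull_under d V c Q"
  shows "hull_under d V c Q' = hull_under d V c Q"
proof
  have "Q' \<subseteq> V" using assms(1,3) hull_under_subset by blast
  show "hull_under d V c Q' \<subseteq> hull_under d V c Q"
    by (intro hull_under_minimal closed_under_hull assms)
  show "hull_under d V c Q \<subseteq> hull_under d V c Q'"
    using assms hull_under_superset[of Q' d V c] \<open>Q' \<subseteq> V\<close> by (intro hull_under_minimal closed_under_hull) auto
qed

text \<open>The properties of a disparity graph that drive the hull argument: colour degrees depend
  on colours only, and no vertex is joined to more than half of a colour class, the vertex itself
  not being counted.\<close>

locale sparse_equitable =
  fixes V :: "'v set" and c :: "'v \<Rightarrow> 'c" and d :: "'v \<Rightarrow> 'v \<Rightarrow> bool"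
  assumes fin: "finite V"
    and sym: "d x y \<Longrightarrow> d y x"
    and irrefl: "\<not> d x x"
    and in_V: "d x y \<Longrightarrow> x \<in> V"
    and deg: "x \<in> V \<Longrightarrow> y \<in> V \<Longrightarrow> c x = c y \<Longrightarrow>
        card {z \<in> V. d x z \<and> c z = \<omega>} = card {z \<in> V. d y z \<and> c z = \<omega>}"
    and half: "x \<in> V \<Longrightarrow> 2 * card {z \<in> V. d x z \<and> c z = \<omega>} \<le> card {z \<in> V. z \<noteq> x \<and> c z = \<omega>}"
begin

abbreviation "clsd \<equiv> closed_under d V c"
abbreviation "hl \<equiv> hull_under d V c"

lemma closed_homogeneous:
  assumes "clsd Q" "x \<in> Q" "y \<in> Q" "c x = c y" "z \<in> V" "z \<notin> Q"
  shows "d x z \<longleftrightarrow> d y z"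
  using closed_underD[OF assms(1-5)] assms by blast

text \<open>
  Let \<open>Q\<close> be the hull of a monochromatic pair and \<open>P \<subseteq> Q\<close> closed. The part of \<open>Q\<close> with colours
  fully contained in \<open>P\<close> and its complement in \<open>Q\<close> are joined homogeneously, so both are closed.
\<close>

lemma hull_pair_subset:
  assumes uv: "u \<in> V" "v \<in> V" "c u = c v"
    and K: "clsd K" and z: "z \<in> hl {u, v}" and sub: "{q \<in> hl {u, v}. c q = c z} \<subseteq> K"
  shows "hl {u, v} \<subseteq> K"
proof -
  define Q where "Q = hl {u, v}"
  have Q: "clsd Q" unfolding Q_def using uv by (intro closed_under_hull) auto
  have QV: "Q \<subseteq> V" using Q by (auto simp: closed_under_def)
  have uvQ: "u \<in> Q" "v \<in> Q" using hull_under_superset[of "{u, v}" d V c] by (auto simp: Q_def)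
  define P where "P = Q \<inter> K"
  have P: "clsd P" unfolding P_def by (intro closed_under_Int Q K)
  define I where "I = {\<omega>. {q \<in> Q. c q = \<omega>} \<subseteq> P}"
  \<comment> \<open>A vertex \<open>s\<close> of colour \<open>m\<close> outside \<open>P\<close>
    sees the whole \<open>l\<close>-class of \<open>Q\<close> alike. Any other \<open>q\<close> of
    colour \<open>m\<close> in \<open>Q\<close> has equally many \<open>l\<close>-neighbours, and
    the same ones outside \<open>Q\<close>, so inside \<open>Q\<close> it again has none or
    all.\<close>
  have homog: "\<exists>b. \<forall>q\<in>Q. c q = m \<longrightarrow> (\<forall>r\<in>Q. c r = l \<longrightarrow> (d q r \<longleftrightarrow> b))" if "m \<notin> I" "l \<in> I" for m l
  proof -
    from that(1) obtain s where s: "s \<in> Q" "c s = m" "s \<notin> P" by (auto simp: I_def)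
    have l: "r \<in> P" if "r \<in> Q" "c r = l" for r using that \<open>l \<in> I\<close> by (auto simp: I_def)
    have s_all: "d s r = d s r'" if "r \<in> Q" "c r = l" "r' \<in> Q" "c r' = l" for r r'
    proof -
      have "s \<in> V" using s QV by auto
      then have "d r s = d r' s"
        using closed_homogeneous[OF P l[OF that(1,2)] l[OF that(3,4)], of s] that(2,4) s(3) by simp
      then show ?thesis using sym by blast
    qed
    have "\<forall>r\<in>Q. c r = l \<longrightarrow> (d q r \<longleftrightarrow> d s r)" if q: "q \<in> Q" "c q = m" for q
    proof -
      let ?N = "\<lambda>x. {y \<in> V. d x y \<and> c y = l}"
      have fN: "finite (?N x)" for x using fin by auto
      have "card (?N q) = card (?N s)" using deg[of q s l] q s QV by auto
      moreover have "?N q - Q = ?N s - Q"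
      proof -
        have "d q y = d s y" if "y \<in> V" "y \<notin> Q" for y
          by (rule closed_homogeneous[OF Q q(1) s(1) _ that]) (simp add: q s)
        then show ?thesis by blast
      qed
      moreover have "card (?N x) = card (?N x \<inter> Q) + card (?N x - Q)" for x
        using card_Int_Diff[OF fN[of x], of Q] .
      ultimately have eq: "card (?N q \<inter> Q) = card (?N s \<inter> Q)"
        by (metis (no_types, lifting) add_right_cancel)
      show ?thesis
      proof (cases "\<exists>r\<in>Q. c r = l \<and> d s r")
        case True
        then have all: "d s r" if "r \<in> Q" "c r = l" for r using s_all that by blast
        then have "?N q \<inter> Q \<subseteq> ?N s \<inter> Q" by auto
        then have "?N q \<inter> Q = ?N s \<inter> Q"
          using eq fN by (intro card_subset_eq) auto
        then have "d q r" if "r \<in> Q" "c r = l" for r using that all QV by auto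
        then show ?thesis using all by auto
      next
        case False
        then have "?N s \<inter> Q = {}" by auto
        then have "card (?N q \<inter> Q) = 0" using eq by simp
        then have "?N q \<inter> Q = {}" using fN[of q] by simp
        then have "\<not> d q r" if "r \<in> Q" "c r = l" for r using that QV by auto
        then show ?thesis using False by auto
      qed
    qed
    then show ?thesis using s_all by (metis (full_types))
  qed
  have Qp: "clsd {q \<in> Q. c q \<in> I}"
    unfolding closed_under_def
  proof (intro conjI ballI impI)
    fix x y w assume *: "x \<in> {q \<in> Q. c q \<in> I}" "y \<in> {q \<in> Q. c q \<in> I}" "c x = c y" "w \<in> V"
      "w \<noteq> x" "w \<noteq> y" "d x w \<noteq> d y w"
    then have "w \<in> Q" using closed_underD[OF Q, of x y w] by auto
    moreover have "c w \<in> I"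
    proof (rule ccontr)
      assume "c w \<notin> I"
      then have "d w x = d w y" using homog[of "c w" "c x"] * \<open>w \<in> Q\<close> by auto
      then show False using *(7) sym by blast
    qed
    ultimately show "w \<in> {q \<in> Q. c q \<in> I}" by simp
  qed (use QV in auto)
  have Qm: "clsd {q \<in> Q. c q \<notin> I}"
    unfolding closed_under_def
  proof (intro conjI ballI impI)
    fix x y w assume *: "x \<in> {q \<in> Q. c q \<notin> I}" "y \<in> {q \<in> Q. c q \<notin> I}" "c x = c y" "w \<in> V"
      "w \<noteq> x" "w \<noteq> y" "d x w \<noteq> d y w"
    then have "w \<in> Q" using closed_underD[OF Q, of x y w] by auto
    moreover have "c w \<notin> I"
    proof
      assume "c w \<in> I"
      then have "d x w = d y w" using homog[of "c x" "c w"] * \<open>w \<in> Q\<close> by auto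
      then show False using *(7) by blast
    qed
    ultimately show "w \<in> {q \<in> Q. c q \<notin> I}" by simp
  qed (use QV in auto)
  \<comment> \<open>As \<open>u\<close> and \<open>v\<close> share a colour, one of the two closed
    parts contains both and hence, by minimality of the hull, all of \<open>Q\<close>. The vertex
    \<open>z\<close> decides which part it is.\<close>
  have zI: "c z \<in> I" using sub by (auto simp: I_def P_def Q_def)
  have "c u \<in> I"
  proof (rule ccontr)
    assume "c u \<notin> I"
    then have "Q \<subseteq> {q \<in> Q. c q \<notin> I}"
      unfolding Q_def using uv uvQ Qm by (intro hull_under_minimal) (auto simp: Q_def)
    then show False using z zI by (auto simp: Q_def)
  qed
  then have "Q \<subseteq> {q \<in> Q. c q \<in> I}"
    unfolding Q_def using uv uvQ Qp by (intro hull_under_minimal) (auto simp: Q_def)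
  then show ?thesis by (auto simp: I_def P_def Q_def)
qed

lemma exists_nonadjacent:
  assumes "d x z"
  shows "\<exists>w\<in>V. c w = c z \<and> w \<noteq> x \<and> \<not> d x w"
proof (rule ccontr)
  assume *: "\<not> ?thesis"
  let ?A = "{w \<in> V. d x w \<and> c w = c z}"
  have "card {w \<in> V. w \<noteq> x \<and> c w = c z} \<le> card ?A"
    using * fin by (intro card_mono) auto
  then have "card ?A = 0" using half[of x "c z"] in_V[OF assms] by linarith
  then show False using assms fin in_V[OF sym[OF assms]] by auto
qed

text \<open>
  The new hull contains the whole colour class of \<open>z\<close> in the old one as soon as the twin \<open>x'\<close> of
  \<open>x\<close> among the neighbours of \<open>w\<close> is adjacent to no other vertex of that class. If this failed for
  every choice of \<open>w\<close>, then density at most \<open>1/2\<close> would leave no room for a neighbour in that class.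
\<close>

lemma hull_pair_extend:
  assumes uv: "u \<in> V" "v \<in> V" "c u = c v"
    and z: "z \<in> hl {u, v}" and x: "x \<notin> hl {u, v}" and dzx: "d z x"
  shows "\<exists>w\<in>V. w \<noteq> z \<and> c w = c z \<and> insert x (hl {u, v}) \<subseteq> hl {z, w}"
proof -
  define Q where "Q = hl {u, v}"
  have Q: "clsd Q" unfolding Q_def using uv by (intro closed_under_hull) auto
  have QV: "Q \<subseteq> V" using Q by (auto simp: closed_under_def)
  have zx: "z \<in> V" "x \<in> V" "d x z" "z \<noteq> x" "z \<in> Q" "x \<notin> Q"
    using in_V[OF dzx] in_V[OF sym[OF dzx]] sym[OF dzx] irrefl dzx z x by (auto simp: Q_def)
  \<comment> \<open>Since \<open>x\<close> lies outside the closed set \<open>Q\<close>, it is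
    adjacent to the whole class of \<open>z\<close> in \<open>Q\<close>, which therefore lies in
    \<open>A\<close>. Density at most 1/2 gives \<open>card A \<le> card B\<close>.\<close>
  define A where "A = {w \<in> V. d x w \<and> c w = c z}"
  define B where "B = {w \<in> V. c w = c z \<and> w \<noteq> x \<and> \<not> d x w}"
  have finAB: "finite A" "finite B" using fin by (auto simp: A_def B_def)
  have QA: "q \<in> A" if "q \<in> Q" "c q = c z" for q
    using closed_homogeneous[OF Q that(1) \<open>z \<in> Q\<close> that(2) \<open>x \<in> V\<close> \<open>x \<notin> Q\<close>] dzx sym that QV
    by (auto simp: A_def)
  have "A \<union> B = {w \<in> V. w \<noteq> x \<and> c w = c z}" "A \<inter> B = {}"
    using irrefl by (auto simp: A_def B_def)
  then have "card A + card B = card {w \<in> V. w \<noteq> x \<and> c w = c z}"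
    using card_Un_disjoint[OF finAB] by simp
  then have AB: "card A \<le> card B"
    using half[OF \<open>x \<in> V\<close>, of "c z"] by (simp add: A_def)
  obtain w0 where w0: "w0 \<in> B" using exists_nonadjacent[OF \<open>d x z\<close>] by (auto simp: B_def)
  \<comment> \<open>\<open>z\<close> and \<open>w\<close> have equally many neighbours of colour
    \<open>c x\<close>, and \<open>x\<close> belongs to \<open>z\<close> only, so some
    \<open>x'\<close> belongs to \<open>w\<close> only. Removing \<open>w\<close> and
    \<open>z\<close> from the two neighbourhoods covers the case that they have colour
    \<open>c x\<close> themselves.\<close>
  have twin: "\<exists>x'\<in>V. c x' = c x \<and> x' \<noteq> z \<and> x' \<noteq> w \<and> d w x' \<and> \<not> d z x'" if "w \<in> B" for w
  proof -
    have w: "w \<in> V" "c w = c z" "w \<noteq> x" "\<not> d w x" using that sym by (auto simp: B_def)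
    let ?M = "\<lambda>a. {y \<in> V. d a y \<and> c y = c x}"
    have fM: "finite (?M a)" for a using fin by auto
    have eq: "card (?M z) = card (?M w)" using deg[of z w "c x"] w zx by auto
    have "card (?M z - {w}) = card (?M w - {z})"
    proof (cases "d z w \<and> c z = c x")
      case True
      then have "w \<in> ?M z" "z \<in> ?M w" using w zx sym by auto
      then show ?thesis using eq fM by simp
    next
      case False
      then have "w \<notin> ?M z" "z \<notin> ?M w" using w sym by auto
      then show ?thesis using eq by simp
    qed
    moreover have "x \<in> (?M z - {w}) - (?M w - {z})" using w zx dzx by auto
    ultimately have "\<not> (?M w - {z} \<subseteq> ?M z - {w})"
    proof -
      assume eq': "card (?M z - {w}) = card (?M w - {z})" and xin: "x \<in> (?M z - {w}) - (?M w - {z})"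
      have "?M w - {z} = ?M z - {w}" if "?M w - {z} \<subseteq> ?M z - {w}"
        by (rule card_subset_eq[OF _ that eq'[symmetric]]) (simp add: fM)
      then show ?thesis using xin by blast
    qed
    then obtain x' where "x' \<in> ?M w - {z}" "x' \<notin> ?M z - {w}" by blast
    then show ?thesis using irrefl by auto
  qed
  have "\<exists>w\<in>B. \<exists>x'\<in>V. c x' = c x \<and> x' \<noteq> z \<and> x' \<noteq> w \<and> d w x' \<and> \<not> d z x' \<and>
      (\<forall>q\<in>Q. c q = c z \<longrightarrow> \<not> d x' q)"
  proof (cases "\<exists>w\<in>B. \<exists>x'\<in>V. x' \<notin> Q \<and> c x' = c x \<and> x' \<noteq> z \<and> x' \<noteq> w \<and> d w x' \<and> \<not> d z x'")
    case True
    then obtain w x' where *: "w \<in> B" "x' \<in> V" "x' \<notin> Q" "c x' = c x" "x' \<noteq> z" "x' \<noteq> w" "d w x'" "\<not> d z x'"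
      by blast
    have "\<not> d x' q" if "q \<in> Q" "c q = c z" for q
      using closed_homogeneous[OF Q that(1) \<open>z \<in> Q\<close> that(2) *(2,3)] *(8) sym by blast
    then show ?thesis using * by blast
  next
    \<comment> \<open>All twins lie in \<open>Q\<close>. By closedness the twin \<open>y\<close> of
      \<open>w0\<close> is then adjacent to every \<open>w \<in> B\<close>. It has only
      \<open>card A \<le> card B\<close> neighbours in the class of \<open>z\<close>, so these are
      exactly \<open>B\<close>, which is disjoint from \<open>Q\<close>.\<close>
    case False
    obtain y where y: "y \<in> V" "c y = c x" "y \<noteq> z" "y \<noteq> w0" "d w0 y" "\<not> d z y" "y \<in> Q"
      using twin[OF w0] False w0 by blast
    have "B \<subseteq> {w \<in> V. d y w \<and> c w = c z}"
    proof
      fix w assume w: "w \<in> B"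
      then have wQ: "w \<notin> Q" "w \<in> V" "c w = c z" using QA by (auto simp: A_def B_def)
      obtain x' where x': "x' \<in> V" "c x' = c x" "d w x'" "x' \<in> Q"
        using twin[OF w] False w by blast
      have "d y w" using closed_homogeneous[OF Q x'(4) y(7) _ wQ(2,1)] x' y sym by auto
      then show "w \<in> {w \<in> V. d y w \<and> c w = c z}" using wQ by simp
    qed
    moreover have "card {w \<in> V. d y w \<and> c w = c z} \<le> card B"
      using deg[of y x "c z"] y zx AB by (simp add: A_def)
    ultimately have "B = {w \<in> V. d y w \<and> c w = c z}"
      using fin by (intro card_seteq) auto
    then have "\<not> d y q" if "q \<in> Q" "c q = c z" for q
      using QA[OF that] that QV by (auto simp: A_def B_def)
    then show ?thesis using w0 y by blast
  qed
  then obtain w x' where w: "w \<in> B" and x': "x' \<in> V" "c x' = c x" "x' \<noteq> z" "x' \<noteq> w" "d w x'" "\<not> d z x'"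
      "\<And>q. q \<in> Q \<Longrightarrow> c q = c z \<Longrightarrow> \<not> d x' q"
    by blast
  have wV: "w \<in> V" "c w = c z" "w \<noteq> x" "\<not> d w x" "w \<noteq> z"
    using w sym zx by (auto simp: B_def)
  define K where "K = hl {z, w}"
  have K: "clsd K" unfolding K_def using zx wV by (intro closed_under_hull) auto
  have zwK: "z \<in> K" "w \<in> K" using hull_under_superset[of "{z, w}" d V c] by (auto simp: K_def)
  have xK: "x \<in> K" using closed_underD[OF K zwK] zx wV dzx by auto
  have x'K: "x' \<in> K" using closed_underD[OF K zwK, of x'] x' wV by auto
  have "q \<in> K" if "q \<in> Q" "c q = c z" for q
  proof (cases "q = x'")
    case False
    moreover have "d x q" "q \<in> V" using QA[OF that] by (auto simp: A_def)
    moreover have "q \<noteq> x" using that zx by auto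
    ultimately show ?thesis using closed_underD[OF K xK x'K, of q] x' that by auto
  qed (use x'K in simp)
  then have "Q \<subseteq> K"
    unfolding Q_def using hull_pair_subset[OF uv K z] by (auto simp: Q_def)
  then show ?thesis using xK wV by (auto simp: Q_def K_def)
qed

text \<open>Among the monochromatic pairs whose hull meets \<open>T\<close>, one with largest hull
  works: if part of \<open>T\<close> were missed, an edge inside \<open>T\<close> would leave the
  hull and \<open>hull_pair_extend\<close> would produce a larger one.\<close>

lemma connected_subset_hull_pair:
  assumes T: "T \<subseteq> V" and two: "a \<in> T" "b \<in> T" "a \<noteq> b"
    and conn: "\<And>S. S \<inter> T \<noteq> {} \<Longrightarrow> \<not> T \<subseteq> S \<Longrightarrow> \<exists>z\<in>S \<inter> T. \<exists>x\<in>T - S. d z x"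
  shows "\<exists>u\<in>V. \<exists>v\<in>V. u \<noteq> v \<and> c u = c v \<and> T \<subseteq> hl {u, v}"
proof -
  define good where "good p \<longleftrightarrow> fst p \<in> V \<and> snd p \<in> V \<and> fst p \<noteq> snd p \<and> c (fst p) = c (snd p) \<and>
      hl {fst p, snd p} \<inter> T \<noteq> {}" for p
  define size where "size p = card (hl {fst p, snd p})" for p
  obtain x where x: "x \<in> T" "d a x" using conn[of "{a}"] two by auto
  obtain w where w: "w \<in> V" "c w = c a" "w \<noteq> x" "\<not> d x w"
    using exists_nonadjacent[OF sym[OF x(2)]] by auto
  have "a \<in> hl {a, w}" using hull_under_superset[of "{a, w}" d V c] by auto
  moreover have "w \<noteq> a" using w sym[OF x(2)] by auto
  ultimately have "good (a, w)" using w T two by (auto simp: good_def)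
  moreover have "\<forall>p. good p \<longrightarrow> size p < Suc (card V)"
  proof (intro allI impI)
    fix p assume "good p"
    then have "{fst p, snd p} \<subseteq> V" by (simp add: good_def)
    then show "size p < Suc (card V)"
      unfolding size_def less_Suc_eq_le by (rule card_mono[OF fin hull_under_subset])
  qed
  ultimately have "\<exists>p. good p \<and> (\<forall>q. good q \<longrightarrow> size q \<le> size p)"
    by (rule Lattices_Big.ex_has_greatest_nat)
  then obtain p where p: "good p" and max: "\<And>q. good q \<Longrightarrow> size q \<le> size p"
    by blast
  obtain u v where uv: "p = (u, v)" by (cases p)
  have uvV: "u \<in> V" "v \<in> V" "c u = c v" "u \<noteq> v" using p by (auto simp: good_def uv)
  have "T \<subseteq> hl {u, v}"
  proof (rule ccontr)
    assume "\<not> T \<subseteq> hl {u, v}"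
    then obtain z x where zx: "z \<in> hl {u, v}" "z \<in> T" "x \<in> T" "x \<notin> hl {u, v}" "d z x"
      using conn[of "hl {u, v}"] p by (auto simp: good_def uv)
    obtain w where w: "w \<in> V" "w \<noteq> z" "c w = c z" "insert x (hl {u, v}) \<subseteq> hl {z, w}"
      using hull_pair_extend[OF uvV(1-3) zx(1,4,5)] by blast
    have zV: "z \<in> V" using T zx by auto
    have "good (z, w)" using w zx zV by (auto simp: good_def)
    then have "card (hl {z, w}) \<le> card (hl {u, v})" using max by (auto simp: size_def uv)
    moreover have "finite (hl {z, w})"
      using hull_under_subset[of "{z, w}" V d c] zV w fin by (auto intro: finite_subset)
    then have "card (hl {u, v}) < card (hl {z, w})"
      using w(4) zx by (intro psubset_card_mono) auto
    ultimately show False by simp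
  qed
  then show ?thesis using uvV by blast
qed

end

subsection \<open>The disparity graph of an equitable colouring\<close>

lemma pairs_between_commute: "pairs_between V c \<omega> \<omega>' = pairs_between V c \<omega>' \<omega>"
  unfolding pairs_between_def by (auto simp: insert_commute)

definition majority :: "'v set \<Rightarrow> 'v set set \<Rightarrow> ('v \<Rightarrow> 'c) \<Rightarrow> 'c \<Rightarrow> 'c \<Rightarrow> bool" where
  "majority V G c \<omega> \<omega>' \<longleftrightarrow>
     real (card (pairs_between V c \<omega> \<omega>' \<inter> G)) \<ge> real (card (pairs_between V c \<omega> \<omega>')) / 2"

lemma majority_commute: "majority V G c \<omega> \<omega>' = majority V G c \<omega>' \<omega>"
  unfolding majority_def by (simp add: pairs_between_commute)

lemma mem_pairs_between:
  "{x, y} \<in> pairs_between V c \<omega> \<omega>' \<longleftrightarrow>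
     x \<in> V \<and> y \<in> V \<and> x \<noteq> y \<and> (c x = \<omega> \<and> c y = \<omega>' \<or> c x = \<omega>' \<and> c y = \<omega>)"
  unfolding pairs_between_def by (auto simp: doubleton_eq_iff)

lemma mem_majority_graph:
  "{x, y} \<in> majority_graph V G c \<longleftrightarrow> x \<in> V \<and> y \<in> V \<and> x \<noteq> y \<and> majority V G c (c x) (c y)"
proof -
  have "{x, y} \<in> majority_graph V G c \<longleftrightarrow>
     (\<exists>\<omega>\<in>c ` V. \<exists>\<omega>'\<in>c ` V. majority V G c \<omega> \<omega>' \<and> {x, y} \<in> pairs_between V c \<omega> \<omega>')"
    unfolding majority_graph_def majority_def by auto
  also have "\<dots> \<longleftrightarrow> x \<in> V \<and> y \<in> V \<and> x \<noteq> y \<and> majority V G c (c x) (c y)"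
    unfolding mem_pairs_between by (auto simp: majority_commute)
  finally show ?thesis .
qed

lemma mem_disparity_graph:
  assumes "G \<subseteq> all_edges V"
  shows "{x, y} \<in> disparity_graph V G c \<longleftrightarrow>
           x \<in> V \<and> y \<in> V \<and> x \<noteq> y \<and> majority V G c (c x) (c y) \<noteq> ({x, y} \<in> G)"
proof -
  have "x \<in> V \<and> y \<in> V \<and> x \<noteq> y" if "{x, y} \<in> G"
    using that assms by (auto simp: all_edges_def doubleton_eq_iff dest!: subsetD)
  then show ?thesis
    unfolding disparity_graph_def using mem_majority_graph[of x y V G c] by auto
qed

lemma card_ordered_pairs:
  assumes "finite V" "S \<subseteq> pairs_between V c \<omega> \<omega>'"
  shows "card {(x, y). x \<in> V \<and> y \<in> V \<and> x \<noteq> y \<and> c x = \<omega> \<and> c y = \<omega>' \<and> {x, y} \<in> S} =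
           (if \<omega> = \<omega>' then 2 else 1) * card S"
proof -
  let ?O = "\<lambda>e. {(x, y). x \<in> V \<and> y \<in> V \<and> x \<noteq> y \<and> c x = \<omega> \<and> c y = \<omega>' \<and> {x, y} = e}"
  have "finite (pairs_between V c \<omega> \<omega>')"
    by (rule finite_subset[of _ "Pow V"]) (use assms(1) in \<open>auto simp: pairs_between_def\<close>)
  then have finS: "finite S" using assms(2) by (rule finite_subset[rotated])
  have finO: "finite (?O e)" for e
    by (rule finite_subset[of _ "V \<times> V"]) (use assms(1) in auto)
  have fibre: "card (?O e) = (if \<omega> = \<omega>' then 2 else 1)" if eS: "e \<in> S" for e
  proof -
    obtain a b where ab: "e = {a, b}" "a \<in> V" "b \<in> V" "a \<noteq> b" "c a = \<omega>" "c b = \<omega>'"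
      using eS assms(2) unfolding pairs_between_def by blast
    have "?O e = (if \<omega> = \<omega>' then {(a, b), (b, a)} else {(a, b)})"
      using ab by (auto simp: doubleton_eq_iff)
    then show ?thesis using ab by auto
  qed
  have "{(x, y). x \<in> V \<and> y \<in> V \<and> x \<noteq> y \<and> c x = \<omega> \<and> c y = \<omega>' \<and> {x, y} \<in> S} = (\<Union>e\<in>S. ?O e)"
    by auto
  also have "card \<dots> = (\<Sum>e\<in>S. card (?O e))"
    by (rule card_UN_disjoint) (use finS finO in auto)
  also have "\<dots> = (if \<omega> = \<omega>' then 2 else 1) * card S"
    using fibre by simp
  finally show ?thesis .
qed

text \<open>The majority rule bounds the density between two classes by 1/2. By equitability all
  vertices of a class have the same disparity degree into the other class, so double counting of
  ordered pairs turns the average bound into one for every vertex.\<close>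

lemma sparse_equitable_disparity_graph:
  assumes "finite V" "G \<subseteq> all_edges V" "equitable V G c"
  shows "sparse_equitable V c (\<lambda>x y. {x, y} \<in> disparity_graph V G c)"
proof -
  let ?d = "\<lambda>x y. {x, y} \<in> disparity_graph V G c"
  note mem = mem_disparity_graph[OF assms(2)]
  have nb: "{z \<in> V. z \<noteq> x \<and> {x, z} \<in> G \<and> c z = \<omega>} = {u \<in> neighbours G x. c u = \<omega>}" for x \<omega>
    using assms(2) by (fastforce simp: neighbours_def all_edges_def insert_commute doubleton_eq_iff)
  have degG: "card {z \<in> V. z \<noteq> x \<and> {x, z} \<in> G \<and> c z = \<omega>} = colour_degree G c \<omega> x" for x \<omega>
    unfolding nb colour_degree_def ..
  have class_size: "card {z \<in> V. z \<noteq> x \<and> c z = \<omega>} = card {z \<in> V. c z = \<omega>} - of_bool (c x = \<omega>)"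
    if "x \<in> V" for x \<omega>
  proof -
    have "{z \<in> V. z \<noteq> x \<and> c z = \<omega>} = {z \<in> V. c z = \<omega>} - {x}" by auto
    then show ?thesis using that assms(1) by auto
  qed
  have size_eq: "card {z \<in> V. z \<noteq> x \<and> c z = \<omega>} = card {z \<in> V. z \<noteq> y \<and> c z = \<omega>}"
    if "x \<in> V" "y \<in> V" "c x = c y" for x y \<omega>
    using class_size that by simp
  have deg_eq: "card {z \<in> V. ?d x z \<and> c z = \<omega>} =
      (if majority V G c (c x) \<omega> then card {z \<in> V. z \<noteq> x \<and> c z = \<omega>} - colour_degree G c \<omega> x
       else colour_degree G c \<omega> x)" if "x \<in> V" for x \<omega>
  proof (cases "majority V G c (c x) \<omega>")
    case True
    then have "{z \<in> V. ?d x z \<and> c z = \<omega>} =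
        {z \<in> V. z \<noteq> x \<and> c z = \<omega>} - {z \<in> V. z \<noteq> x \<and> {x, z} \<in> G \<and> c z = \<omega>}"
      using that by (auto simp: mem)
    then have "card {z \<in> V. ?d x z \<and> c z = \<omega>} =
        card {z \<in> V. z \<noteq> x \<and> c z = \<omega>} - card {z \<in> V. z \<noteq> x \<and> {x, z} \<in> G \<and> c z = \<omega>}"
      using assms(1) by (simp only:) (rule card_Diff_subset, auto)
    then show ?thesis using True degG by simp
  next
    case False
    then have "{z \<in> V. ?d x z \<and> c z = \<omega>} = {z \<in> V. z \<noteq> x \<and> {x, z} \<in> G \<and> c z = \<omega>}"
      using that by (auto simp: mem)
    then show ?thesis using False degG by simp
  qed
  have deg: "card {z \<in> V. ?d x z \<and> c z = \<omega>} = card {z \<in> V. ?d y z \<and> c z = \<omega>}"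
    if "x \<in> V" "y \<in> V" "c x = c y" for x y \<omega>
  proof -
    have "colour_degree G c \<omega> x = colour_degree G c \<omega> y"
      using assms(3) that unfolding equitable_def by blast
    then show ?thesis
      by (simp only: deg_eq[OF that(1)] deg_eq[OF that(2)] size_eq[OF that] that(3))
  qed
  show ?thesis
  proof
    fix x \<omega> assume x: "x \<in> V"
    let ?P = "pairs_between V c (c x) \<omega>"
    let ?X = "{y \<in> V. c y = c x}"
    let ?D = "disparity_graph V G c"
    have finP: "finite ?P"
      by (rule finite_subset[of _ "Pow V"]) (use assms(1) in \<open>auto simp: pairs_between_def\<close>)
    have X: "card ?X > 0" using x assms(1) by (auto simp: card_gt_0_iff)
    have PD: "2 * card (?P \<inter> ?D) \<le> card ?P"
    proof (cases "majority V G c (c x) \<omega>")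
      case True
      have PD': "?P \<inter> ?D = ?P - ?P \<inter> G"
        using True by (auto simp: pairs_between_def mem majority_commute)
      have "card (?P - ?P \<inter> G) = card ?P - card (?P \<inter> G)"
        using finP by (intro card_Diff_subset) auto
      moreover have "card ?P \<le> 2 * card (?P \<inter> G)"
        using True unfolding majority_def by linarith
      ultimately show ?thesis unfolding PD' by linarith
    next
      case False
      have PD': "?P \<inter> ?D = ?P \<inter> G"
        using False by (auto simp: pairs_between_def mem majority_commute)
      show ?thesis using False unfolding PD' majority_def by linarith
    qed
    have count: "card {(y, z). y \<in> V \<and> z \<in> V \<and> y \<noteq> z \<and> c y = c x \<and> c z = \<omega> \<and> {y, z} \<in> S} =
        card ?X * k"
      if "\<And>y. y \<in> ?X \<Longrightarrow> card {z \<in> V. y \<noteq> z \<and> c z = \<omega> \<and> {y, z} \<in> S} = k" for S k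
    proof -
      have "{(y, z). y \<in> V \<and> z \<in> V \<and> y \<noteq> z \<and> c y = c x \<and> c z = \<omega> \<and> {y, z} \<in> S} =
          Sigma ?X (\<lambda>y. {z \<in> V. y \<noteq> z \<and> c z = \<omega> \<and> {y, z} \<in> S})" by auto
      then show ?thesis using that assms(1) by simp
    qed
    have 1: "card {(y, z). y \<in> V \<and> z \<in> V \<and> y \<noteq> z \<and> c y = c x \<and> c z = \<omega> \<and> {y, z} \<in> ?P \<inter> ?D} =
        card ?X * card {z \<in> V. ?d x z \<and> c z = \<omega>}"
    proof (rule count)
      fix y assume y: "y \<in> ?X"
      have "{z \<in> V. y \<noteq> z \<and> c z = \<omega> \<and> {y, z} \<in> ?P \<inter> ?D} = {z \<in> V. ?d y z \<and> c z = \<omega>}"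
        using y by (auto simp: mem mem_pairs_between)
      then show "card {z \<in> V. y \<noteq> z \<and> c z = \<omega> \<and> {y, z} \<in> ?P \<inter> ?D} = card {z \<in> V. ?d x z \<and> c z = \<omega>}"
        using deg[of y x \<omega>] x y by simp
    qed
    have 2: "card {(y, z). y \<in> V \<and> z \<in> V \<and> y \<noteq> z \<and> c y = c x \<and> c z = \<omega> \<and> {y, z} \<in> ?P} =
        card ?X * card {z \<in> V. z \<noteq> x \<and> c z = \<omega>}"
    proof (rule count)
      fix y assume y: "y \<in> ?X"
      have "{z \<in> V. y \<noteq> z \<and> c z = \<omega> \<and> {y, z} \<in> ?P} = {z \<in> V. z \<noteq> y \<and> c z = \<omega>}"
        using y by (auto simp: mem_pairs_between)
      then show "card {z \<in> V. y \<noteq> z \<and> c z = \<omega> \<and> {y, z} \<in> ?P} = card {z \<in> V. z \<noteq> x \<and> c z = \<omega>}"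
        using size_eq[of y x \<omega>] x y by simp
    qed
    have "2 * (card ?X * card {z \<in> V. ?d x z \<and> c z = \<omega>}) \<le> card ?X * card {z \<in> V. z \<noteq> x \<and> c z = \<omega>}"
      unfolding 1[symmetric] 2[symmetric]
      using card_ordered_pairs[OF assms(1), of "?P \<inter> ?D" c "c x" \<omega>]
        card_ordered_pairs[OF assms(1), of "?P" c "c x" \<omega>] PD by auto
    then have "card ?X * (2 * card {z \<in> V. ?d x z \<and> c z = \<omega>}) \<le> card ?X * card {z \<in> V. z \<noteq> x \<and> c z = \<omega>}"
      by (simp add: mult.left_commute)
    then show "2 * card {z \<in> V. ?d x z \<and> c z = \<omega>} \<le> card {z \<in> V. z \<noteq> x \<and> c z = \<omega>}"
      using X by simp
  next
    show "finite V" by (rule assms(1))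
    show "?d y x" if "?d x y" for x y using that by (simp add: insert_commute)
    show "\<not> ?d x x" for x using mem[of x x] by simp
    show "x \<in> V" if "?d x y" for x y using that mem by blast
    show "card {z \<in> V. ?d x z \<and> c z = \<omega>} = card {z \<in> V. ?d y z \<and> c z = \<omega>}"
      if "x \<in> V" "y \<in> V" "c x = c y" for x y \<omega> by (rule deg[OF that])
  qed
qed

text \<open>
  The pairs of vertices separated by two vertices of the same colour are the same in the graph and
  in its disparity graph.
\<close>

lemma hull_under_disparity_graph:
  assumes "G \<subseteq> all_edges V"
  shows "hull_under (\<lambda>x y. {x, y} \<in> disparity_graph V G c) V c Q = hull_under (\<lambda>x y. {x, y} \<in> G) V c Q"
proof -
  have "closed_under (\<lambda>x y. {x, y} \<in> disparity_graph V G c) V c Q' =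
      closed_under (\<lambda>x y. {x, y} \<in> G) V c Q'" for Q'
    unfolding closed_under_def mem_disparity_graph[OF assms]
    by (intro conj_cong refl ball_cong imp_cong) auto
  then show ?thesis unfolding hull_under_def by simp
qed

lemma component_subset_hull:
  assumes V: "finite V" "G \<subseteq> all_edges V" and c: "equitable V G c"
    and T: "T \<in> graph_components V (disparity_graph V G c)" "card T \<ge> 2"
  shows "\<exists>u\<in>V. \<exists>v\<in>V. u \<noteq> v \<and> c u = c v \<and> T \<subseteq> hull_under (\<lambda>x y. {x, y} \<in> G) V c {u, v}"
proof -
  let ?D = "disparity_graph V G c"
  let ?r = "{(x, y). {x, y} \<in> ?D}"
  interpret sparse_equitable V c "\<lambda>x y. {x, y} \<in> ?D"
    by (rule sparse_equitable_disparity_graph[OF V c])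
  obtain a where a: "a \<in> V" "T = {y \<in> V. (a, y) \<in> ?r\<^sup>*}"
    using T(1) by (auto simp: graph_components_def quotient_def)
  have symr: "sym (?r\<^sup>*)" by (intro sym_rtrancl) (auto simp: sym_def insert_commute)
  have TV: "T \<subseteq> V" using a by auto
  have reach: "(x, y) \<in> ?r\<^sup>*" if "x \<in> T" "y \<in> T" for x y
    using that a symr by (auto dest: symD intro: rtrancl_trans)
  have step: "\<exists>z\<in>S \<inter> T. \<exists>x\<in>T - S. {z, x} \<in> ?D" if ST: "S \<inter> T \<noteq> {}" "\<not> T \<subseteq> S" for S
  proof -
    obtain s t where s: "s \<in> S" "s \<in> T" and t: "t \<in> T" "t \<notin> S" using ST by auto
    have "y \<in> S \<inter> T \<or> (\<exists>z\<in>S \<inter> T. \<exists>x\<in>T - S. {z, x} \<in> ?D)" if "(s, y) \<in> ?r\<^sup>*" for y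
      using that
    proof (induction rule: rtrancl_induct)
      case (step y z)
      have "z \<in> V" using step.hyps(2) mem_disparity_graph[OF V(2)] by auto
      moreover have "(a, z) \<in> ?r\<^sup>*" if "y \<in> T"
        using that a step.hyps(2) by (auto intro: rtrancl_into_rtrancl)
      ultimately show ?case using step a by blast
    qed (use s in simp)
    then show ?thesis using reach[OF s(2) t(1)] t by blast
  qed
  obtain x y where xy: "x \<in> T" "y \<in> T" "x \<noteq> y"
  proof -
    obtain x where x: "x \<in> T" using T(2) by fastforce
    have "T \<noteq> {x}" using T(2) by auto
    then show ?thesis using that x by blast
  qed
  show ?thesis
    using connected_subset_hull_pair[OF TV xy step] unfolding hull_under_disparity_graph[OF V(2)] by blast
qed

subsection \<open>Balanced vectors\<close>

definition balanced :: "'v set \<Rightarrow> ('v \<Rightarrow> 'c) \<Rightarrow> ('v \<Rightarrow> real) \<Rightarrow> bool" where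
  "balanced V c g \<longleftrightarrow> (\<forall>\<omega>. (\<Sum>x | x \<in> V \<and> c x = \<omega>. g x) = 0)"

definition neighbour_sum :: "'v set \<Rightarrow> 'v set set \<Rightarrow> ('v \<Rightarrow> real) \<Rightarrow> 'v \<Rightarrow> real" where
  "neighbour_sum V G g y = (\<Sum>x | x \<in> V \<and> x \<noteq> y \<and> {x, y} \<in> G. g x)"

text \<open>Quantifying over the colouring turns balance into an event of the graph alone. The type
  is that of the stable refinement of the trivial colouring.\<close>

definition balanceable :: "'v set \<Rightarrow> 'v set set \<Rightarrow> ('v \<Rightarrow> real) \<Rightarrow> bool" where
  "balanceable V G g \<longleftrightarrow> (\<exists>c :: 'v \<Rightarrow> unit colour. equitable V G c \<and> balanced V c g)"

lemma balanced_sum_class_function: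
  assumes "finite V" "balanced V c g" "\<And>x y. x \<in> V \<Longrightarrow> y \<in> V \<Longrightarrow> c x = c y \<Longrightarrow> \<phi> x = \<phi> y"
  shows "(\<Sum>x\<in>V. g x * \<phi> x) = 0"
proof -
  have "(\<Sum>x\<in>V. g x * \<phi> x) = (\<Sum>\<omega>\<in>c ` V. \<Sum>x | x \<in> V \<and> c x = \<omega>. g x * \<phi> x)"
    by (rule sum.image_gen[OF assms(1)])
  also have "\<dots> = (\<Sum>\<omega>\<in>c ` V. 0)"
  proof (rule sum.cong[OF refl])
    fix \<omega> assume "\<omega> \<in> c ` V"
    then obtain a where a: "a \<in> V" "c a = \<omega>" by auto
    have "(\<Sum>x | x \<in> V \<and> c x = \<omega>. g x * \<phi> x) = (\<Sum>x | x \<in> V \<and> c x = \<omega>. g x * \<phi> a)"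
    proof (rule sum.cong[OF refl])
      fix x assume "x \<in> {x \<in> V. c x = \<omega>}"
      then show "g x * \<phi> x = g x * \<phi> a" using assms(3)[of x a] a by simp
    qed
    also have "\<dots> = 0" using assms(2) unfolding balanced_def by (simp flip: sum_distrib_right)
    finally show "(\<Sum>x | x \<in> V \<and> c x = \<omega>. g x * \<phi> x) = 0" .
  qed
  finally show ?thesis by simp
qed

lemma colour_degree_alt:
  assumes "G \<subseteq> all_edges V"
  shows "{u \<in> neighbours G x. c u = \<omega>} = {y \<in> V. c y = \<omega> \<and> x \<noteq> y \<and> {x, y} \<in> G}"
proof -
  have "y \<in> V" if "{y, x} \<in> G" for y
    using that assms by (auto simp: all_edges_def doubleton_eq_iff dest!: subsetD)
  then show ?thesis unfolding neighbours_def by (auto simp: insert_commute)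
qed

text \<open>Summing over a class \<open>\<omega>\<close> the image of \<open>g\<close> under the
  adjacency matrix pairs \<open>g\<close> with the number of \<open>\<omega>\<close>-neighbours.
  That number is constant on colour classes, and a balanced vector is orthogonal to such
  functions.\<close>

lemma balanced_neighbour_sum:
  assumes "finite V" "G \<subseteq> all_edges V" "equitable V G c" "balanced V c g"
  shows "balanced V c (neighbour_sum V G g)"
  unfolding balanced_def
proof
  fix \<omega>
  have "(\<Sum>y | y \<in> V \<and> c y = \<omega>. neighbour_sum V G g y) =
      (\<Sum>y\<in>{y \<in> V. c y = \<omega>}. \<Sum>x | x \<in> V \<and> (x \<noteq> y \<and> {x, y} \<in> G). g x)"
    unfolding neighbour_sum_def by simp
  also have "\<dots> = (\<Sum>x\<in>V. \<Sum>y | y \<in> {y \<in> V. c y = \<omega>} \<and> (x \<noteq> y \<and> {x, y} \<in> G). g x)"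
    by (rule sum.swap_restrict) (use assms(1) in auto)
  also have "\<dots> = (\<Sum>x\<in>V. g x * real (colour_degree G c \<omega> x))"
  proof (rule sum.cong[OF refl])
    fix x
    have "{y. y \<in> {y \<in> V. c y = \<omega>} \<and> (x \<noteq> y \<and> {x, y} \<in> G)} = {u \<in> neighbours G x. c u = \<omega>}"
      unfolding colour_degree_alt[OF assms(2)] by auto
    then show "(\<Sum>y | y \<in> {y \<in> V. c y = \<omega>} \<and> (x \<noteq> y \<and> {x, y} \<in> G). g x) =
        g x * real (colour_degree G c \<omega> x)"
      by (simp only: sum_constant colour_degree_def mult.commute)
  qed
  also have "\<dots> = 0"
  proof (rule balanced_sum_class_function[OF assms(1,4)])
    fix x y assume "x \<in> V" "y \<in> V" "c x = c y"
    then have "colour_degree G c \<omega> x = colour_degree G c \<omega> y"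
      using assms(3) unfolding equitable_def by blast
    then show "real (colour_degree G c \<omega> x) = real (colour_degree G c \<omega> y)" by simp
  qed
  finally show "(\<Sum>y | y \<in> V \<and> c y = \<omega>. neighbour_sum V G g y) = 0" .
qed

lemma balanceable_neighbour_sum:
  assumes "finite V" "G \<subseteq> all_edges V" "balanceable V G g"
  shows "balanceable V G (neighbour_sum V G g)"
  using assms balanced_neighbour_sum unfolding balanceable_def by blast

definition degree_balanced :: "'v set \<Rightarrow> 'v set set \<Rightarrow> ('v \<Rightarrow> real) \<Rightarrow> bool" where
  "degree_balanced V G g \<longleftrightarrow> (\<forall>D. (\<Sum>x\<in>V. g x * of_bool (card (neighbours G x) = D)) = 0)"

text \<open>The degree is a sum of colour degrees, hence constant on colour classes. The conclusion
  no longer mentions a colouring, which opens it to direct probability estimates.\<close>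

lemma balanceable_imp_degree_balanced:
  assumes "finite V" "G \<subseteq> all_edges V" "balanceable V G g"
  shows "degree_balanced V G g"
proof -
  obtain c :: "'a \<Rightarrow> unit colour" where c: "equitable V G c" "balanced V c g"
    using assms(3) by (auto simp: balanceable_def)
  have deg: "card (neighbours G x) = (\<Sum>\<omega>\<in>c ` V. colour_degree G c \<omega> x)" for x
  proof -
    have sub: "neighbours G x \<subseteq> V"
      using assms(2) by (auto simp: neighbours_def all_edges_def doubleton_eq_iff dest!: subsetD)
    have fin: "finite (neighbours G x)" by (rule finite_neighbours[OF assms(1,2)])
    have "card (neighbours G x) = (\<Sum>u\<in>neighbours G x. 1)" by simp
    also have "\<dots> = (\<Sum>\<omega>\<in>c ` V. \<Sum>u | u \<in> neighbours G x \<and> c u = \<omega>. 1)"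
      by (rule sum.group[symmetric]) (use assms(1) fin sub in auto)
    finally show ?thesis by (simp add: colour_degree_def)
  qed
  show ?thesis
    unfolding degree_balanced_def
  proof
    fix D
    show "(\<Sum>x\<in>V. g x * of_bool (card (neighbours G x) = D)) = 0"
    proof (rule balanced_sum_class_function[OF assms(1) c(2)])
      fix x y assume "x \<in> V" "y \<in> V" "c x = c y"
      then have "colour_degree G c \<omega> x = colour_degree G c \<omega> y" for \<omega>
        using c(1) unfolding equitable_def by blast
      then have "card (neighbours G x) = card (neighbours G y)" by (simp add: deg)
      then show "of_bool (card (neighbours G x) = D) = (of_bool (card (neighbours G y) = D) :: real)"
        by simp
    qed
  qed
qed

subsection \<open>Expansion of the support\<close>

lemma subset_exp_image:
  assumes "finite F" "inj_on h F"
  shows "subset_exp p (h ` F) f = subset_exp p F (\<lambda>R. f (h ` R))"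
  using assms
proof (induction F arbitrary: f rule: finite_induct)
  case (insert x F)
  then have "h x \<notin> h ` F" by auto
  then show ?case
    using insert by (simp add: subset_exp_insert)
qed simp

lemma finite_all_edges: "finite V \<Longrightarrow> finite (all_edges V)"
  by (rule finite_subset[of _ "Pow V"]) (auto simp: all_edges_def)

lemma all_edges_mono: "A \<subseteq> B \<Longrightarrow> all_edges A \<subseteq> all_edges B"
  by (auto simp: all_edges_def)

lemma mem_all_edges: "{x, y} \<in> all_edges V \<longleftrightarrow> x \<in> V \<and> y \<in> V \<and> x \<noteq> y"
  by (auto simp: all_edges_def doubleton_eq_iff)

text \<open>The edges at the frontier \<open>F\<close> that avoid the processed set
  \<open>P\<close>. All edges at \<open>P\<close> count as revealed; after this round only edges
  inside \<open>V - P - F\<close> are still random.\<close>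

definition fresh_edges :: "'v set \<Rightarrow> 'v set \<Rightarrow> 'v set \<Rightarrow> 'v set set" where
  "fresh_edges V P F = all_edges (V - P) - all_edges (V - P - F)"

definition new_support :: "'v set \<Rightarrow> 'v set \<Rightarrow> 'v set set \<Rightarrow> ('v \<Rightarrow> real) \<Rightarrow> 'v set" where
  "new_support V Q G g = {y \<in> V - Q. neighbour_sum V G g y \<noteq> 0}"

text \<open>For different outside vertices \<open>y\<close> the edges from \<open>y\<close> to
  \<open>F\<close> are disjoint, and given the rest the neighbour sum at \<open>y\<close> is an
  affine form in these coins with nonzero coefficients. It vanishes with probability at most
  \<open>(1 + (1 - 2 * p) ^ card F) / 2\<close>, so each \<open>y\<close> contributes a factor of at
  most \<open>(3 + (1 - 2 * p) ^ card F) / 4\<close>. The moment at 1/2 penalises small new supports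
  without a separate tail bound.\<close>

lemma expansion:
  fixes g :: "'v \<Rightarrow> real"
  assumes V: "finite V" "P \<subseteq> V" "F \<subseteq> V" "P \<inter> F = {}"
    and p: "0 \<le> p" "p \<le> 1/2"
    and g: "\<And>x. x \<in> F \<Longrightarrow> g x \<noteq> 0" "\<And>x. x \<in> V - P - F \<Longrightarrow> g x = 0"
  shows "subset_exp p (fresh_edges V P F)
           (\<lambda>R. (1/2) ^ card (new_support V (P \<union> F) (sym_diff H R) g)) \<le>
         ((3 + (1 - 2 * p) ^ card F) / 4) ^ card (V - P - F)"
proof -
  define Y where "Y = V - P - F"
  define E where "E y = (\<lambda>x. {x, y}) ` F" for y
  define U where "U = (\<Union>y\<in>Y. E y)"
  let ?N = "\<lambda>R. new_support V (P \<union> F) (sym_diff H R) g"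
  let ?q = "(3 + (1 - 2 * p) ^ card F) / 4"
  have finF: "finite F" "finite Y" using V by (auto intro: finite_subset simp: Y_def)
  have finE: "finite (E y)" for y using finF by (simp add: E_def)
  have inj: "inj_on (\<lambda>x. {x, y}) F" for y by (auto simp: inj_on_def doubleton_eq_iff)
  have U: "U \<subseteq> fresh_edges V P F"
    using V by (auto simp: U_def E_def Y_def fresh_edges_def mem_all_edges)
  have finite_fresh: "finite (fresh_edges V P F)"
    using V(1) by (simp add: fresh_edges_def finite_all_edges)
  have disj: "disjoint_family_on E Y"
    by (auto simp: disjoint_family_on_def E_def doubleton_eq_iff Y_def)
  have q_nonneg: "0 \<le> ?q" using p by simp
  have main: "subset_exp p U (\<lambda>S. (1/2) ^ card (?N (R \<union> S))) \<le> ?q ^ card Y"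
    if R: "R \<subseteq> fresh_edges V P F - U" for R
  proof -
    \<comment> \<open>\<open>b\<close> is the part fixed by \<open>H\<close> and \<open>R\<close>. A
      coin on an edge of \<open>H\<close> deletes that edge, hence the sign in
      \<open>a\<close>.\<close>
    define b where "b y = (\<Sum>x | x \<in> V \<and> x \<noteq> y \<and> {x, y} \<in> sym_diff H R. g x)" for y
    define a where "a y x = (if {x, y} \<in> H then - g x else g x)" for y x
    define f where "f y T = (if b y + (\<Sum>x | x \<in> F \<and> {x, y} \<in> T. a y x) = 0 then 1 else 1/2 :: real)" for y T
    have ns: "neighbour_sum V (sym_diff H (R \<union> S)) g y = b y + (\<Sum>x | x \<in> F \<and> {x, y} \<in> S \<inter> E y. a y x)"
      if y: "y \<in> Y" and S: "S \<subseteq> U" for y S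
    proof -
      have eq: "(\<Sum>x | x \<in> V \<and> Q x. h x) = (\<Sum>x\<in>V. if Q x then h x else 0)" for Q and h :: "'v \<Rightarrow> real"
        using V(1) by (simp add: sum.If_cases Int_def)
      have "(\<Sum>x | x \<in> F \<and> {x, y} \<in> S \<inter> E y. a y x) = (\<Sum>x | x \<in> V \<and> (x \<in> F \<and> {x, y} \<in> S). a y x)"
        using V(3) by (intro sum.cong) (auto simp: E_def)
      moreover have "(if x \<noteq> y \<and> {x, y} \<in> sym_diff H (R \<union> S) then g x else 0) =
          (if x \<noteq> y \<and> {x, y} \<in> sym_diff H R then g x else 0) + (if x \<in> F \<and> {x, y} \<in> S then a y x else 0)"
        if x: "x \<in> V" for x
      proof (cases "x \<in> F")
        case True
        then have "{x, y} \<in> U" "x \<noteq> y" using y by (auto simp: U_def E_def Y_def)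
        then have "{x, y} \<notin> R" using R by auto
        then show ?thesis using True \<open>x \<noteq> y\<close> by (auto simp: a_def)
      next
        case False
        have "{x, y} \<notin> S"
        proof
          assume "{x, y} \<in> S"
          then obtain y' x' where "y' \<in> Y" "x' \<in> F" "{x, y} = {x', y'}"
            using S by (auto simp: U_def E_def)
          then show False using False y by (auto simp: doubleton_eq_iff Y_def)
        qed
        then show ?thesis using False by auto
      qed
      ultimately show ?thesis
        unfolding neighbour_sum_def b_def eq by (simp add: sum.distrib[symmetric])
    qed
    have "subset_exp p U (\<lambda>S. (1/2) ^ card (?N (R \<union> S))) = subset_exp p U (\<lambda>S. \<Prod>y\<in>Y. f y (S \<inter> E y))"
    proof (rule subset_exp_cong)
      fix S assume S: "S \<subseteq> U"
      have "(\<Prod>y\<in>Y. f y (S \<inter> E y)) = (\<Prod>y\<in>Y. if y \<in> ?N (R \<union> S) then 1/2 else 1)"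
      proof (rule prod.cong[OF refl])
        fix y assume y: "y \<in> Y"
        then show "f y (S \<inter> E y) = (if y \<in> ?N (R \<union> S) then 1/2 else 1)"
          using ns[OF y S] by (auto simp: f_def new_support_def Y_def)
      qed
      also have "\<dots> = (1/2) ^ card (Y \<inter> ?N (R \<union> S))"
        using finF(2) by (simp add: prod.If_cases)
      also have "Y \<inter> ?N (R \<union> S) = ?N (R \<union> S)" by (auto simp: new_support_def Y_def)
      finally show "(1/2) ^ card (?N (R \<union> S)) = (\<Prod>y\<in>Y. f y (S \<inter> E y))" ..
    qed
    also have "\<dots> = (\<Prod>y\<in>Y. subset_exp p (E y) (f y))"
      unfolding U_def by (rule subset_exp_prod[OF finF(2) finE disj])
    also have "\<dots> \<le> (\<Prod>y\<in>Y. ?q)"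
    proof (rule prod_mono)
      fix y assume y: "y \<in> Y"
      have nz: "a y x \<noteq> 0" if "x \<in> F" for x using g(1)[OF that] by (simp add: a_def)
      have "subset_exp p (E y) (f y) = subset_exp p F (\<lambda>T. f y ((\<lambda>x. {x, y}) ` T))"
        unfolding E_def by (rule subset_exp_image[OF finF(1) inj])
      also have "\<dots> = subset_exp p F (\<lambda>T. 1/2 + 1/2 * of_bool ((\<Sum>x\<in>T. a y x) = - b y))"
      proof (rule subset_exp_cong)
        fix T assume "T \<subseteq> F"
        then have "{x \<in> F. {x, y} \<in> (\<lambda>x. {x, y}) ` T} = T" by (auto simp: doubleton_eq_iff)
        then show "f y ((\<lambda>x. {x, y}) ` T) = 1/2 + 1/2 * of_bool ((\<Sum>x\<in>T. a y x) = - b y)"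
          unfolding f_def by (auto simp: add_eq_0_iff)
      qed
      also have "\<dots> = 1/2 + 1/2 * subset_exp p F (\<lambda>T. of_bool ((\<Sum>x\<in>T. a y x) = - b y))"
        using finF(1) by (simp only: subset_exp_add subset_exp_cmult subset_exp_const)
      also have "\<dots> \<le> 1/2 + 1/2 * ((1 + (1 - 2 * p) ^ card F) / 2)"
        using atom_le_half[OF finF(1) p nz, where c = "- b y"] by (intro add_left_mono mult_left_mono) auto
      also have "\<dots> = ?q" by (simp add: field_simps)
      finally show "0 \<le> subset_exp p (E y) (f y) \<and> subset_exp p (E y) (f y) \<le> ?q"
        using p by (auto intro!: subset_exp_nonneg simp: f_def)
    qed
    finally show ?thesis by simp
  qed
  have "subset_exp p (fresh_edges V P F) (\<lambda>R. (1/2) ^ card (?N R)) =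
      subset_exp p (fresh_edges V P F - U) (\<lambda>R. subset_exp p U (\<lambda>S. (1/2) ^ card (?N (R \<union> S))))"
    by (rule subset_exp_split[OF finite_fresh U])
  also have "\<dots> \<le> ?q ^ card Y"
    by (rule subset_exp_le_const) (use finite_fresh p main in auto)
  finally show ?thesis by (simp add: Y_def)
qed

text \<open>Unrevealed edges join only vertices where \<open>g\<close> vanishes, even though
  \<open>g\<close> is arbitrary on \<open>P\<close>. So the next vector is determined before the
  remaining edges are sampled.\<close>

lemma neighbour_sum_fresh:
  assumes "finite V" "\<And>x. x \<in> V - P - F \<Longrightarrow> g x = 0" "S \<subseteq> all_edges (V - P - F)"
  shows "neighbour_sum V (sym_diff H (R \<union> S)) g = neighbour_sum V (sym_diff H R) g"
proof
  fix y
  have "{x, y} \<notin> S" if "x \<in> V" "g x \<noteq> 0" for x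
    using that assms mem_all_edges[of x y "V - P - F"] by blast
  then have mem: "x \<in> V \<and> x \<noteq> y \<and> {x, y} \<in> sym_diff H (R \<union> S) \<longleftrightarrow> x \<in> V \<and> x \<noteq> y \<and> {x, y} \<in> sym_diff H R"
    if "g x \<noteq> 0" for x using that by blast
  show "neighbour_sum V (sym_diff H (R \<union> S)) g y = neighbour_sum V (sym_diff H R) g y"
    unfolding neighbour_sum_def using mem assms(1) by (intro sum.mono_neutral_cong) auto
qed

subsection \<open>Exploration with guessed colours\<close>

text \<open>The top digit cannot be compensated, because twice the sum of all lower powers of 3 is
  less than \<open>3 ^ m\<close>.\<close>

lemma balanced_ternary_unique:
  fixes \<epsilon> :: "nat \<Rightarrow> int"
  assumes "finite S" "\<And>i. i \<in> S \<Longrightarrow> \<bar>\<epsilon> i\<bar> \<le> 1" "(\<Sum>i\<in>S. \<epsilon> i * 3 ^ i) = 0" "i \<in> S"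
  shows "\<epsilon> i = 0"
  using assms
proof (induction S arbitrary: i rule: finite_linorder_max_induct)
  case (insert m S)
  have "2 * \<bar>\<Sum>i\<in>S. \<epsilon> i * 3 ^ i\<bar> \<le> 2 * (\<Sum>i\<in>S. 3 ^ i)"
  proof -
    have "\<bar>\<Sum>i\<in>S. \<epsilon> i * 3 ^ i\<bar> \<le> (\<Sum>i\<in>S. \<bar>\<epsilon> i * 3 ^ i\<bar>)" by (rule sum_abs)
    also have "\<dots> \<le> (\<Sum>i\<in>S. 3 ^ i)"
      using insert.prems(1) by (intro sum_mono) (auto simp: abs_mult mult_left_le_one_le)
    finally show ?thesis by simp
  qed
  also have "\<dots> \<le> 2 * (\<Sum>i<m. (3::int) ^ i)"
    using insert.hyps by (intro mult_left_mono sum_mono2) auto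
  also have "\<dots> = 3 ^ m - 1"
    by (induction m) auto
  finally have small: "2 * \<bar>\<Sum>i\<in>S. \<epsilon> i * 3 ^ i\<bar> < 3 ^ m" by simp
  have total: "\<epsilon> m * 3 ^ m + (\<Sum>i\<in>S. \<epsilon> i * 3 ^ i) = 0"
    using insert.prems(2) insert.hyps by (subst (asm) sum.insert) auto
  have "\<epsilon> m = 0"
  proof (rule ccontr)
    assume "\<epsilon> m \<noteq> 0"
    then have "3 ^ m \<le> \<bar>\<epsilon> m * 3 ^ m\<bar>" by (simp add: abs_mult)
    then show False using total small by linarith
  qed
  moreover have "\<epsilon> j = 0" if "j \<in> S" for j
    using insert.IH[of j] insert.prems(1) total \<open>\<epsilon> m = 0\<close> that by auto
  ultimately show ?case using insert.prems(3) by auto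
qed simp

text \<open>
  The map \<open>r\<close> sends each explored vertex to a representative of its (guessed) colour class in the
  explored set \<open>Q\<close>.
\<close>

definition twinned :: "nat set \<Rightarrow> (nat \<Rightarrow> nat) \<Rightarrow> bool" where
  "twinned Q r \<longleftrightarrow> (\<forall>x\<in>Q. r x \<in> Q \<and> r (r x) = r x) \<and> (\<forall>x\<in>Q. \<exists>y\<in>Q. y \<noteq> x \<and> r y = r x)"

text \<open>
  A vector summing to zero over each fibre of \<open>r\<close>, and otherwise as generic as possible: its sum
  over a set vanishes only if the set is a union of fibres.
\<close>

definition generic_vector :: "nat set \<Rightarrow> (nat \<Rightarrow> nat) \<Rightarrow> nat \<Rightarrow> real" where
  "generic_vector Q r x =
     (if x \<notin> Q then 0 else if r x \<noteq> x then 3 ^ x else - (\<Sum>y | y \<in> Q \<and> r y = x \<and> y \<noteq> x. 3 ^ y))"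

text \<open>A representative carries minus the sum of the rest of its fibre, so \<open>3 ^ x\<close>
  enters positively through \<open>x \<in> B\<close> and negatively through
  \<open>r x \<in> B\<close>. This is a balanced ternary number.\<close>

lemma sum_generic_vector:
  assumes "finite Q" "B \<subseteq> Q" "\<And>x. x \<in> Q \<Longrightarrow> r x \<in> Q \<and> r (r x) = r x"
  shows "(\<Sum>x\<in>B. generic_vector Q r x) =
           (\<Sum>x | x \<in> Q \<and> r x \<noteq> x. (of_bool (x \<in> B) - of_bool (r x \<in> B)) * 3 ^ x)"
proof -
  have fB: "finite B" using assms(1,2) by (rule finite_subset[rotated])
  have 1: "(\<Sum>x\<in>{x \<in> B. r x \<noteq> x}. generic_vector Q r x) =
      (\<Sum>x | x \<in> Q \<and> r x \<noteq> x. of_bool (x \<in> B) * 3 ^ x)"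
    using assms(1,2) by (intro sum.mono_neutral_cong_left) (auto simp: generic_vector_def)
  have "(\<Sum>x\<in>{x \<in> B. r x = x}. generic_vector Q r x) =
      - (\<Sum>x\<in>{x \<in> B. r x = x}. \<Sum>y | y \<in> Q \<and> r y = x \<and> y \<noteq> x. 3 ^ y)"
    unfolding sum_negf[symmetric] using assms(2)
    by (intro sum.cong) (auto simp: generic_vector_def sum_negf)
  also have "(\<Sum>x\<in>{x \<in> B. r x = x}. \<Sum>y | y \<in> Q \<and> r y = x \<and> y \<noteq> x. 3 ^ y) =
      (\<Sum>y\<in>Q. \<Sum>x | x \<in> {x \<in> B. r x = x} \<and> (r y = x \<and> y \<noteq> x). (3::real) ^ y)"
    by (rule sum.swap_restrict) (use assms(1) fB in auto)
  also have "\<dots> = (\<Sum>y\<in>Q. if r y \<noteq> y then of_bool (r y \<in> B) * 3 ^ y else 0)"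
  proof (rule sum.cong[OF refl])
    fix y assume y: "y \<in> Q"
    have "{x. x \<in> {x \<in> B. r x = x} \<and> (r y = x \<and> y \<noteq> x)} = (if r y \<in> B \<and> r y \<noteq> y then {r y} else {})"
      using assms(3)[OF y] by auto
    then show "(\<Sum>x | x \<in> {x \<in> B. r x = x} \<and> (r y = x \<and> y \<noteq> x). (3::real) ^ y) =
        (if r y \<noteq> y then of_bool (r y \<in> B) * 3 ^ y else 0)"
      by simp
  qed
  also have "\<dots> = (\<Sum>y | y \<in> Q \<and> r y \<noteq> y. of_bool (r y \<in> B) * 3 ^ y)"
    using assms(1) by (simp add: sum.If_cases Int_def)
  finally have 2: "(\<Sum>x\<in>{x \<in> B. r x = x}. generic_vector Q r x) =
      - (\<Sum>y | y \<in> Q \<and> r y \<noteq> y. of_bool (r y \<in> B) * 3 ^ y)" .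
  have "(\<Sum>x\<in>B. generic_vector Q r x) =
      (\<Sum>x\<in>{x \<in> B. r x \<noteq> x}. generic_vector Q r x) + (\<Sum>x\<in>{x \<in> B. r x = x}. generic_vector Q r x)"
    using fB by (subst sum.union_disjoint[symmetric]) (auto intro: sum.cong)
  also have "\<dots> = (\<Sum>x | x \<in> Q \<and> r x \<noteq> x. (of_bool (x \<in> B) - of_bool (r x \<in> B)) * 3 ^ x)"
    unfolding 1 2 by (simp add: left_diff_distrib sum_subtractf)
  finally show ?thesis .
qed

lemma sum_generic_vector_eq_0_iff:
  assumes "finite Q" "B \<subseteq> Q" "\<And>x. x \<in> Q \<Longrightarrow> r x \<in> Q \<and> r (r x) = r x"
  shows "(\<Sum>x\<in>B. generic_vector Q r x) = 0 \<longleftrightarrow> (\<forall>x\<in>Q. x \<in> B \<longleftrightarrow> r x \<in> B)"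
proof
  define \<epsilon> :: "nat \<Rightarrow> int" where "\<epsilon> x = of_bool (x \<in> B) - of_bool (r x \<in> B)" for x
  assume "(\<Sum>x\<in>B. generic_vector Q r x) = 0"
  then have "real_of_int (\<Sum>x | x \<in> Q \<and> r x \<noteq> x. \<epsilon> x * 3 ^ x) = 0"
    using sum_generic_vector[OF assms] by (simp add: \<epsilon>_def)
  then have 0: "(\<Sum>x | x \<in> Q \<and> r x \<noteq> x. \<epsilon> x * 3 ^ x) = 0" by linarith
  have "\<epsilon> x = 0" if "x \<in> Q" "r x \<noteq> x" for x
    by (rule balanced_ternary_unique[OF _ _ 0]) (use assms(1) that in \<open>auto simp: \<epsilon>_def\<close>)
  then show "\<forall>x\<in>Q. x \<in> B \<longleftrightarrow> r x \<in> B"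
    unfolding \<epsilon>_def by (metis (full_types) diff_self of_bool_eq(1,2) right_minus_eq zero_neq_one)
next
  assume "\<forall>x\<in>Q. x \<in> B \<longleftrightarrow> r x \<in> B"
  then show "(\<Sum>x\<in>B. generic_vector Q r x) = 0"
    by (subst sum_generic_vector[OF assms]) (auto intro!: sum.neutral)
qed

text \<open>A zero entry would make \<open>{x}\<close> a union of fibres, whereas
  \<open>twinned\<close> gives every fibre at least two elements.\<close>

lemma generic_vector_nonzero:
  assumes "finite Q" "twinned Q r" "x \<in> Q"
  shows "generic_vector Q r x \<noteq> 0"
proof
  assume 0: "generic_vector Q r x = 0"
  have r: "r y \<in> Q \<and> r (r y) = r y" if "y \<in> Q" for y using assms(2) that unfolding twinned_def by blast
  have "(\<Sum>y\<in>{x}. generic_vector Q r y) = 0" using 0 by simp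
  then have *: "\<forall>y\<in>Q. y \<in> {x} \<longleftrightarrow> r y \<in> {x}"
    using sum_generic_vector_eq_0_iff[OF assms(1) _ r, of "{x}"] assms(3) by blast
  obtain y where y: "y \<in> Q" "y \<noteq> x" "r y = r x" using assms(2,3) unfolding twinned_def by blast
  have "r x = x" using * assms(3) by blast
  then show False using * y by (metis singletonI singletonD)
qed

lemma balanced_generic_vector:
  assumes "finite V" "Q \<subseteq> V" "\<And>x. x \<in> Q \<Longrightarrow> r x \<in> Q \<and> r (r x) = r x"
    and "\<And>x y. x \<in> Q \<Longrightarrow> y \<in> Q \<Longrightarrow> c x = c y \<longleftrightarrow> r x = r y"
  shows "balanced V c (generic_vector Q r)"
  unfolding balanced_def
proof
  fix \<omega>
  have fQ: "finite Q" using assms(1,2) by (rule finite_subset[rotated])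
  have "(\<Sum>x | x \<in> V \<and> c x = \<omega>. generic_vector Q r x) = (\<Sum>x | x \<in> Q \<and> c x = \<omega>. generic_vector Q r x)"
    using assms(1,2) by (intro sum.mono_neutral_right) (auto simp: generic_vector_def)
  also have "\<dots> = 0"
  proof (subst sum_generic_vector_eq_0_iff[OF fQ])
    show "\<forall>x\<in>Q. x \<in> {x \<in> Q. c x = \<omega>} \<longleftrightarrow> r x \<in> {x \<in> Q. c x = \<omega>}"
    proof
      fix x assume x: "x \<in> Q"
      then have "c (r x) = c x" using assms(3,4) by simp
      then show "x \<in> {x \<in> Q. c x = \<omega>} \<longleftrightarrow> r x \<in> {x \<in> Q. c x = \<omega>}" using x assms(3) by simp
    qed
  qed (use assms(3) in auto)
  finally show "(\<Sum>x | x \<in> V \<and> c x = \<omega>. generic_vector Q r x) = 0" .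
qed

text \<open>The right-hand side says that \<open>y\<close> distinguishes no two vertices of one
  fibre. So the support of the neighbour sum outside \<open>Q\<close> is exactly what one round of
  the closure rule adds.\<close>

lemma neighbour_sum_generic_vector:
  assumes "finite V" "Q \<subseteq> V" "\<And>x. x \<in> Q \<Longrightarrow> r x \<in> Q \<and> r (r x) = r x" "y \<notin> Q"
  shows "neighbour_sum V G (generic_vector Q r) y = 0 \<longleftrightarrow>
           (\<forall>x\<in>Q. {x, y} \<in> G \<longleftrightarrow> {r x, y} \<in> G)"
proof -
  have fQ: "finite Q" using assms(1,2) by (rule finite_subset[rotated])
  have "neighbour_sum V G (generic_vector Q r) y = (\<Sum>x\<in>{x \<in> Q. {x, y} \<in> G}. generic_vector Q r x)"
    unfolding neighbour_sum_def using assms(1,2,4)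
    by (intro sum.mono_neutral_right) (auto simp: generic_vector_def)
  then show ?thesis
    using sum_generic_vector_eq_0_iff[OF fQ, of "{x \<in> Q. {x, y} \<in> G}" r] assms(3) by auto
qed

text \<open>Equal degrees into the class of \<open>y\<close> force a vertex \<open>z\<close> of that
  class to be distinguished in the opposite direction. Hence a vertex found by exploration is never
  alone in its colour, and \<open>twinned\<close> is maintained.\<close>

lemma equitable_twin:
  assumes "finite V" "G \<subseteq> all_edges V" "equitable V G c" "u \<in> V" "v \<in> V" "c u = c v"
    and y: "{u, y} \<in> G" "{v, y} \<notin> G" "y \<noteq> v"
  shows "\<exists>z\<in>V. c z = c y \<and> z \<noteq> y \<and> z \<noteq> u \<and> z \<noteq> v \<and> {v, z} \<in> G \<and> {u, z} \<notin> G"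
proof -
  let ?M = "\<lambda>a. {z \<in> V. c z = c y \<and> a \<noteq> z \<and> {a, z} \<in> G}"
  have yV: "y \<in> V" "y \<noteq> u" using y(1) assms(2) mem_all_edges[of u y V] by auto
  have fM: "finite (?M a)" for a using assms(1) by auto
  have eq: "card (?M u) = card (?M v)"
    using assms(3-6) unfolding equitable_def colour_degree_def colour_degree_alt[OF assms(2)] by blast
  have "card (?M u - {v}) = card (?M v - {u})"
  proof (cases "{u, v} \<in> G \<and> c u = c y")
    case True
    then have "u \<noteq> v" using assms(2) mem_all_edges[of u v V] by auto
    then have "v \<in> ?M u" "u \<in> ?M v" using True assms(4-6) by (auto simp: insert_commute)
    then show ?thesis using eq fM by simp
  next
    case False
    then have "v \<notin> ?M u" "u \<notin> ?M v" using assms(6) by (auto simp: insert_commute)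
    then show ?thesis using eq by simp
  qed
  then have "?M v - {u} = ?M u - {v}" if "?M v - {u} \<subseteq> ?M u - {v}"
    using card_subset_eq[OF _ that] fM by simp
  moreover have "y \<in> (?M u - {v}) - (?M v - {u})" using y yV by auto
  ultimately obtain z where "z \<in> ?M v - {u}" "z \<notin> ?M u - {v}" by blast
  then show ?thesis using y by (intro bexI[of _ z]) auto
qed

text \<open>The unknown colouring enters only through its restriction to \<open>Q\<close>,
  prescribed by the guess \<open>r\<close>; the rest is quantified away. For fixed \<open>Q\<close>
  and \<open>r\<close> this is an event of the graph.\<close>

definition big_hull :: "nat set \<Rightarrow> nat set set \<Rightarrow> real \<Rightarrow> nat set \<Rightarrow> (nat \<Rightarrow> nat) \<Rightarrow> bool" where
  "big_hull V G L Q r \<longleftrightarrow> (\<exists>c :: nat \<Rightarrow> unit colour. equitable V G c \<and>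
     (\<forall>x\<in>Q. \<forall>y\<in>Q. c x = c y \<longleftrightarrow> r x = r y) \<and>
     L < real (card (hull_under (\<lambda>x y. {x, y} \<in> G) V c Q)))"

lemma big_hull_imp_balanceable:
  assumes "finite V" "Q \<subseteq> V" "twinned Q r" "big_hull V G L Q r"
  shows "balanceable V G (generic_vector Q r)"
  using assms balanced_generic_vector[OF assms(1,2)]
  unfolding balanceable_def big_hull_def twinned_def by blast

definition guesses :: "nat set \<Rightarrow> nat set \<Rightarrow> (nat \<Rightarrow> nat) \<Rightarrow> (nat \<Rightarrow> nat) set" where
  "guesses Q F r = (\<lambda>h x. if x \<in> F then h x else r x) ` (F \<rightarrow>\<^sub>E Q \<union> F)"

lemma
  assumes "finite Q" "finite F"
  shows finite_guesses: "finite (guesses Q F r)"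
    and card_guesses: "card (guesses Q F r) \<le> card (Q \<union> F) ^ card F"
proof -
  have fin: "finite (F \<rightarrow>\<^sub>E Q \<union> F)" using assms by (intro finite_PiE) auto
  then show "finite (guesses Q F r)" unfolding guesses_def by simp
  show "card (guesses Q F r) \<le> card (Q \<union> F) ^ card F"
    unfolding guesses_def using card_image_le[OF fin] assms by (simp add: card_PiE)
qed

text \<open>If no vertex is found, \<open>Q\<close> is closed and equals its hull. In general the
  found vertices belong to the hull, and the true colouring of the larger set is among the guesses,
  so the event passes to one of finitely many events of the same shape.\<close>

lemma big_hull_step:
  assumes V: "finite V" "G \<subseteq> all_edges V"
    and Q: "Q \<subseteq> V" "twinned Q r" and big: "big_hull V G L Q r"
    and F: "F = new_support V Q G (generic_vector Q r)"
  shows "F = {} \<Longrightarrow> L < real (card Q)"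
    and "\<exists>r'\<in>guesses Q F r. twinned (Q \<union> F) r' \<and> big_hull V G L (Q \<union> F) r'"
proof -
  let ?d = "\<lambda>x y. {x, y} \<in> G"
  obtain c :: "nat \<Rightarrow> unit colour" where c: "equitable V G c"
      "\<And>x y. x \<in> Q \<Longrightarrow> y \<in> Q \<Longrightarrow> c x = c y \<longleftrightarrow> r x = r y"
      "L < real (card (hull_under ?d V c Q))"
    using big by (auto simp: big_hull_def)
  have r: "r x \<in> Q" "r (r x) = r x" if "x \<in> Q" for x using Q(2) that by (auto simp: twinned_def)
  have cr: "c (r x) = c x" if "x \<in> Q" for x using c(2)[of "r x" x] r that by simp
  have F_iff: "y \<in> F \<longleftrightarrow> y \<in> V \<and> y \<notin> Q \<and> (\<exists>x\<in>Q. ({x, y} \<in> G) \<noteq> ({r x, y} \<in> G))" for y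
    unfolding F new_support_def
    using neighbour_sum_generic_vector[OF V(1) Q(1), of r y G] r by auto
  show "L < real (card Q)" if "F = {}"
  proof -
    have "closed_under ?d V c Q"
      unfolding closed_under_def
    proof (intro conjI ballI impI)
      fix x y z assume *: "x \<in> Q" "y \<in> Q" "c x = c y" "z \<in> V" "?d x z \<noteq> ?d y z"
      have "r x = r y" using c(2) * by auto
      show "z \<in> Q"
      proof (rule ccontr)
        assume "z \<notin> Q"
        then have "{x, z} \<in> G \<longleftrightarrow> {r x, z} \<in> G" if "x \<in> Q" for x
          using F_iff[of z] \<open>F = {}\<close> * that by auto
        then show False using * \<open>r x = r y\<close> by metis
      qed
    qed (use Q in auto)
    then have "hull_under ?d V c Q = Q"
      using hull_under_minimal[of ?d V c Q Q] hull_under_superset[of Q ?d V c] by auto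
    then show ?thesis using c(3) by simp
  qed
  \<comment> \<open>A new vertex is sent to the old representative of its colour if \<open>Q\<close>
    contains that colour, otherwise to the least new vertex of its colour. Old representatives never
    change.\<close>
  define r' where "r' y = (if y \<in> F then if \<exists>x\<in>Q. c x = c y then r (SOME x. x \<in> Q \<and> c x = c y)
      else (LEAST z. z \<in> F \<and> c z = c y) else r y)" for y
  have FQ: "F \<inter> Q = {}" using F_iff by auto
  have r'_Q: "r' y = r y" if "y \<in> Q" for y using that FQ by (auto simp: r'_def)
  have r'_old: "r' y = r x" if "y \<in> F" "x \<in> Q" "c x = c y" for x y
  proof -
    have "(SOME x. x \<in> Q \<and> c x = c y) \<in> Q \<and> c (SOME x. x \<in> Q \<and> c x = c y) = c y"
      by (rule someI[of "\<lambda>x. x \<in> Q \<and> c x = c y" x]) (use that in auto)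
    then have "r (SOME x. x \<in> Q \<and> c x = c y) = r x" using c(2)[of _ x] that by metis
    then show ?thesis using that by (auto simp: r'_def)
  qed
  have r'_new: "r' y = (LEAST z. z \<in> F \<and> c z = c y)" if "y \<in> F" "\<not> (\<exists>x\<in>Q. c x = c y)" for y
    using that by (simp add: r'_def)
  have least: "(LEAST z. z \<in> F \<and> c z = c y) \<in> F \<and> c (LEAST z. z \<in> F \<and> c z = c y) = c y" if "y \<in> F" for y
    by (rule LeastI[of "\<lambda>z. z \<in> F \<and> c z = c y" y]) (use that in auto)
  have r'_mem: "r' y \<in> Q \<union> F" "c (r' y) = c y" if "y \<in> Q \<union> F" for y
  proof -
    have "r' y \<in> Q \<union> F \<and> c (r' y) = c y"
    proof (cases "y \<in> Q")
      case False
      then have y: "y \<in> F" using that by auto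
      show ?thesis
      proof (cases "\<exists>x\<in>Q. c x = c y")
        case True
        then show ?thesis using r'_old[OF y] r cr by fastforce
      next
        case False
        then show ?thesis using r'_new[OF y] least[OF y] by auto
      qed
    qed (use r'_Q r cr in auto)
    then show "r' y \<in> Q \<union> F" "c (r' y) = c y" by auto
  qed
  have match: "c x = c y \<longleftrightarrow> r' x = r' y" if "x \<in> Q \<union> F" "y \<in> Q \<union> F" for x y
  proof
    assume eq: "c x = c y"
    show "r' x = r' y"
    proof (cases "\<exists>z\<in>Q. c z = c x")
      case True
      then obtain z where z: "z \<in> Q" "c z = c x" by auto
      have "r' w = r z" if "w \<in> Q \<union> F" "c w = c x" for w
        using that z r'_old[of w z] r'_Q[of w] c(2)[of z w] by auto
      then show ?thesis using that eq by metis
    next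
      case False
      then have "x \<in> F" "y \<in> F" "\<not> (\<exists>z\<in>Q. c z = c y)" using that eq by auto
      then show ?thesis using r'_new False eq by auto
    qed
  next
    assume "r' x = r' y"
    then show "c x = c y" using r'_mem(2) that by metis
  qed
  have sub: "F \<subseteq> hull_under ?d V c Q"
  proof
    fix y assume "y \<in> F"
    then obtain x where x: "y \<in> V" "y \<notin> Q" "x \<in> Q" "({x, y} \<in> G) \<noteq> ({r x, y} \<in> G)" using F_iff by auto
    have "x \<in> hull_under ?d V c Q" "r x \<in> hull_under ?d V c Q"
      using x r hull_under_superset[of Q ?d V c] by auto
    then show "y \<in> hull_under ?d V c Q"
      using closed_underD[OF closed_under_hull[OF Q(1), of ?d c], of x "r x" y] x r cr by auto
  qed
  have "hull_under ?d V c (Q \<union> F) = hull_under ?d V c Q"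
    using sub hull_under_superset[of Q ?d V c] by (intro hull_under_between[OF Q(1)]) auto
  then have bh: "big_hull V G L (Q \<union> F) r'"
    unfolding big_hull_def using c match by (intro exI[of _ c]) auto
  have "\<exists>y\<in>Q \<union> F. y \<noteq> x \<and> r' y = r' x" if x: "x \<in> Q \<union> F" for x
  proof (cases "x \<in> Q")
    case True
    then obtain y where "y \<in> Q" "y \<noteq> x" "r y = r x" using Q(2) by (auto simp: twinned_def)
    then show ?thesis using True r'_Q by (intro bexI[of _ y]) auto
  next
    case False
    then obtain q where q: "x \<in> V" "x \<notin> Q" "q \<in> Q" "({q, x} \<in> G) \<noteq> ({r q, x} \<in> G)"
      using x F_iff by auto
    \<comment> \<open>The pair \<open>q\<close>, \<open>r q\<close> is ordered so that
      \<open>u\<close> is the one adjacent to \<open>x\<close>. The twin of \<open>x\<close> is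
      distinguished by the same pair, so it lies in \<open>Q\<close> or is found in the same
      round.\<close>
    have "\<exists>u\<in>Q. \<exists>v\<in>Q. r u = r v \<and> {u, x} \<in> G \<and> {v, x} \<notin> G"
    proof (cases "{q, x} \<in> G")
      case True
      then have "r q \<in> Q" "r q = r (r q)" "{r q, x} \<notin> G" using q r by auto
      then show ?thesis using True q(3) by blast
    next
      case False
      then have "r q \<in> Q" "r (r q) = r q" "{r q, x} \<in> G" using q r by auto
      then show ?thesis using False q(3) by blast
    qed
    then obtain u v where uv: "u \<in> Q" "v \<in> Q" "r u = r v" "{u, x} \<in> G" "{v, x} \<notin> G" by blast
    have "\<exists>z\<in>V. c z = c x \<and> z \<noteq> x \<and> z \<noteq> u \<and> z \<noteq> v \<and> {v, z} \<in> G \<and> {u, z} \<notin> G"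
      by (rule equitable_twin[OF V c(1)]) (use uv q Q c(2) in auto)
    then obtain z where z: "z \<in> V" "c z = c x" "z \<noteq> x" "{v, z} \<in> G" "{u, z} \<notin> G" by blast
    have "z \<in> Q \<union> F"
    proof (rule ccontr)
      assume "z \<notin> Q \<union> F"
      then have "{w, z} \<in> G \<longleftrightarrow> {r w, z} \<in> G" if "w \<in> Q" for w using F_iff[of z] z that by auto
      then show False using uv z by metis
    qed
    then show ?thesis using z match x by (intro bexI[of _ z]) auto
  qed
  then have tw: "twinned (Q \<union> F) r'"
    unfolding twinned_def using r'_mem match by metis
  have "r' \<in> guesses Q F r"
    unfolding guesses_def
  proof (rule image_eqI)
    show "r' = (\<lambda>x. if x \<in> F then (restrict r' F) x else r x)" by (auto simp: r'_def)
    show "restrict r' F \<in> F \<rightarrow>\<^sub>E Q \<union> F" using r'_mem by auto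
  qed
  then show "\<exists>r'\<in>guesses Q F r. twinned (Q \<union> F) r' \<and> big_hull V G L (Q \<union> F) r'"
    using tw bh by blast
qed

subsection \<open>Degree classes under random switchings\<close>

lemma card_neighbours_eq_incident:
  assumes "G \<subseteq> all_edges V"
  shows "card (neighbours G x) = card {e \<in> G. x \<in> e}"
proof (rule bij_betw_same_card)
  show "bij_betw (\<lambda>u. {u, x}) (neighbours G x) {e \<in> G. x \<in> e}"
    unfolding bij_betw_def
  proof
    show "inj_on (\<lambda>u. {u, x}) (neighbours G x)" by (auto simp: inj_on_def doubleton_eq_iff)
    show "(\<lambda>u. {u, x}) ` neighbours G x = {e \<in> G. x \<in> e}"
    proof
      show "{e \<in> G. x \<in> e} \<subseteq> (\<lambda>u. {u, x}) ` neighbours G x"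
      proof
        fix e assume e: "e \<in> {e \<in> G. x \<in> e}"
        then obtain a b where "e = {a, b}" "a \<noteq> b" using assms by (auto simp: all_edges_def)
        then obtain u where "e = {u, x}" "u \<noteq> x" using e by auto
        then show "e \<in> (\<lambda>u. {u, x}) ` neighbours G x" using e by (auto simp: neighbours_def)
      qed
    qed (auto simp: neighbours_def)
  qed
qed

text \<open>The effect of the coin \<open>e\<close> on a degree: an edge of \<open>H\<close> is
  removed, a non-edge is added. Degrees in \<open>sym_diff H R\<close> thus become affine functions
  of the coins.\<close>

definition flip_sign :: "'v set set \<Rightarrow> 'v set \<Rightarrow> real" where
  "flip_sign H e = (if e \<in> H then - 1 else 1)"

definition degree_shift :: "'v set set \<Rightarrow> 'v set set \<Rightarrow> 'v \<Rightarrow> real" where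
  "degree_shift H R x = (\<Sum>e | e \<in> R \<and> x \<in> e. flip_sign H e)"

lemma degree_sym_diff:
  assumes "finite V" "H \<subseteq> all_edges V" "R \<subseteq> all_edges V"
  shows "real (card (neighbours (sym_diff H R) x)) = real (card (neighbours H x)) + degree_shift H R x"
proof -
  have fin: "finite H" "finite R"
    using assms finite_all_edges[OF assms(1)] by (auto intro: finite_subset)
  let ?h = "{e \<in> H. x \<in> e}" and ?r = "{e \<in> R. x \<in> e}"
  have f: "finite ?h" "finite ?r" using fin by auto
  have "{e \<in> sym_diff H R. x \<in> e} = (?h - ?r) \<union> (?r - ?h)" by auto
  then have "card {e \<in> sym_diff H R. x \<in> e} = card (?h - ?r) + card (?r - ?h)"
    using f by (simp only:) (rule card_Un_disjoint, auto)
  moreover have "card ?h = card (?h \<inter> ?r) + card (?h - ?r)" by (rule card_Int_Diff[OF f(1)])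
  moreover have "degree_shift H R x = real (card (?r - ?h)) - real (card (?h \<inter> ?r))"
  proof -
    have *: "(\<Sum>e\<in>B. if e \<in> A then - 1 else 1) = real (card (B - A)) - real (card (A \<inter> B))"
      if "finite B" for A B :: "'a set set"
      using that by (simp add: sum.If_cases Diff_eq Int_commute)
    have "degree_shift H R x = (\<Sum>e\<in>?r. if e \<in> ?h then - 1 else 1)"
      unfolding degree_shift_def flip_sign_def by (intro sum.cong) auto
    then show ?thesis using *[OF f(2), of ?h] by (simp only:)
  qed
  moreover have "sym_diff H R \<subseteq> all_edges V" using assms by auto
  ultimately show ?thesis
    by (simp add: card_neighbours_eq_incident[OF assms(2)] card_neighbours_eq_incident[of "sym_diff H R" V])
qed

text \<open>Each \<open>s i\<close> is a size-preserving involution on the subsets of its block, so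
  applying it in any set \<open>J\<close> of blocks preserves the biased measure. Averaging over
  \<open>J\<close> will turn the blocks into fair coins.\<close>

lemma subset_exp_blockwise:
  assumes I: "finite I" "\<And>i. i \<in> I \<Longrightarrow> finite (E i)" "disjoint_family_on E I"
    and s: "\<And>i T. i \<in> I \<Longrightarrow> T \<subseteq> E i \<Longrightarrow> s i T \<subseteq> E i"
      "\<And>i T. i \<in> I \<Longrightarrow> T \<subseteq> E i \<Longrightarrow> s i (s i T) = T"
      "\<And>i T. i \<in> I \<Longrightarrow> T \<subseteq> E i \<Longrightarrow> card (s i T) = card T"
    and J: "J \<subseteq> I"
  defines "sw \<equiv> \<lambda>R. \<Union>i\<in>I. if i \<in> J then s i (R \<inter> E i) else R \<inter> E i"
  shows "subset_exp p (\<Union>i\<in>I. E i) (\<lambda>R. f (sw R)) = subset_exp p (\<Union>i\<in>I. E i) f"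
    and "\<And>i R. i \<in> I \<Longrightarrow> sw R \<inter> E i = (if i \<in> J then s i (R \<inter> E i) else R \<inter> E i)"
    and "\<And>R. sw R \<subseteq> (\<Union>i\<in>I. E i)"
proof -
  let ?U = "\<Union>i\<in>I. E i"
  have disj: "E i \<inter> E j = {}" if "i \<in> I" "j \<in> I" "i \<noteq> j" for i j
    using I(3) that by (auto simp: disjoint_family_on_def)
  have part: "(if i \<in> J then s i (R \<inter> E i) else R \<inter> E i) \<subseteq> E i" if "i \<in> I" for i R
    using s(1)[OF that, of "R \<inter> E i"] by auto
  show sw_part: "sw R \<inter> E i = (if i \<in> J then s i (R \<inter> E i) else R \<inter> E i)" if i: "i \<in> I" for i R
  proof
    show "(if i \<in> J then s i (R \<inter> E i) else R \<inter> E i) \<subseteq> sw R \<inter> E i"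
      using part[OF i, of R] i unfolding sw_def by blast
    show "sw R \<inter> E i \<subseteq> (if i \<in> J then s i (R \<inter> E i) else R \<inter> E i)"
    proof
      fix e assume e: "e \<in> sw R \<inter> E i"
      then obtain j where j: "j \<in> I" "e \<in> (if j \<in> J then s j (R \<inter> E j) else R \<inter> E j)"
        unfolding sw_def by blast
      then have "e \<in> E j" using part[OF j(1), of R] by blast
      then have "j = i" using disj[OF j(1) i] e by blast
      then show "e \<in> (if i \<in> J then s i (R \<inter> E i) else R \<inter> E i)" using j(2) by (simp only:)
    qed
  qed
  show sw_sub: "sw R \<subseteq> ?U" for R unfolding sw_def using part[of _ R] by blast
  have eqI: "A = B" if "A \<subseteq> ?U" "B \<subseteq> ?U" "\<And>i. i \<in> I \<Longrightarrow> A \<inter> E i = B \<inter> E i" for A B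
    using that by blast
  have inv: "sw (sw R) = R" if R: "R \<subseteq> ?U" for R
  proof (rule eqI)
    fix i assume i: "i \<in> I"
    show "sw (sw R) \<inter> E i = R \<inter> E i"
      unfolding sw_part[OF i, of "sw R"] sw_part[OF i, of R] using s(2)[OF i, of "R \<inter> E i"] by simp
  qed (use R sw_sub in auto)
  have card_sum: "card R = (\<Sum>i\<in>I. card (R \<inter> E i))" if R: "R \<subseteq> ?U" for R
  proof -
    have "R = (\<Union>i\<in>I. R \<inter> E i)" using R by auto
    also have "card \<dots> = (\<Sum>i\<in>I. card (R \<inter> E i))"
      by (rule card_UN_disjoint) (use I disj in auto)
    finally show ?thesis .
  qed
  have "card (sw R) = card R" if R: "R \<subseteq> ?U" for R
  proof -
    have "card (sw R) = (\<Sum>i\<in>I. card (sw R \<inter> E i))" by (rule card_sum[OF sw_sub])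
    also have "\<dots> = (\<Sum>i\<in>I. card (R \<inter> E i))"
      by (intro sum.cong refl) (simp add: sw_part s(3))
    finally show ?thesis using card_sum[OF R] by simp
  qed
  moreover have "bij_betw sw (Pow ?U) (Pow ?U)"
  proof (rule bij_betw_byWitness[where f' = sw])
    show "sw ` Pow ?U \<subseteq> Pow ?U" using sw_sub by blast
    then show "sw ` Pow ?U \<subseteq> Pow ?U" .
  qed (use inv in auto)
  ultimately show "subset_exp p ?U (\<lambda>R. f (sw R)) = subset_exp p ?U f"
    using I by (intro subset_exp_reindex) auto
qed

text \<open>There are \<open>m\<close> disjoint pairs \<open>f i\<close>, \<open>f' i\<close> in the
  support of \<open>g\<close>, each with its own coins: the edges from the pair to
  \<open>A i\<close>. Since \<open>H\<close> agrees on these edges, exchanging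
  \<open>{f i, y}\<close> and \<open>{f' i, y}\<close> has the same sign at both ends and cancels at
  \<open>y\<close>. Paired vertices avoid every \<open>A i\<close>, so their degrees depend on their
  own block only.\<close>

locale switching =
  fixes V :: "nat set" and H :: "nat set set" and g :: "nat \<Rightarrow> real"
    and m :: nat and f f' :: "nat \<Rightarrow> nat" and A :: "nat \<Rightarrow> nat set" and p :: real
  assumes fin: "finite V" and H: "H \<subseteq> all_edges V"
    and fV: "i < m \<Longrightarrow> f i \<in> V" "i < m \<Longrightarrow> f' i \<in> V"
    and inj: "inj_on f {..<m}" "inj_on f' {..<m}"
    and ff': "i < m \<Longrightarrow> j < m \<Longrightarrow> f i \<noteq> f' j"
    and A: "i < m \<Longrightarrow> A i \<subseteq> V" "i < m \<Longrightarrow> j < m \<Longrightarrow> f j \<notin> A i" "i < m \<Longrightarrow> j < m \<Longrightarrow> f' j \<notin> A i"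
    and agree: "i < m \<Longrightarrow> y \<in> A i \<Longrightarrow> {f i, y} \<in> H \<longleftrightarrow> {f' i, y} \<in> H"
    and g: "i < m \<Longrightarrow> g (f i) \<noteq> 0" "i < m \<Longrightarrow> g (f' i) \<noteq> 0"
    and p: "0 \<le> p" "p \<le> 1/2"
begin

definition Ef where "Ef i = (\<lambda>y. {f i, y}) ` A i"
definition Ef' where "Ef' i = (\<lambda>y. {f' i, y}) ` A i"
definition E where "E i = Ef i \<union> Ef' i"
definition U where "U = (\<Union>i<m. E i)"

text \<open>
  A switch moves one unit of degree between \<open>f i\<close> and \<open>f' i\<close> and preserves all other degrees and the
  probability, so that, after conditioning on the unordered data, every discordant pair carries a
  fair coin.
\<close>

definition discordant where "discordant i T = {y \<in> A i. ({f i, y} \<in> T) \<noteq> ({f' i, y} \<in> T)}"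
definition switch where
  "switch i T = (if discordant i T = {} then T
     else sym_diff T {{f i, Min (discordant i T)}, {f' i, Min (discordant i T)}})"

lemma finA: "i < m \<Longrightarrow> finite (A i)"
  using A(1) fin by (auto intro: finite_subset)

lemma finE: "i < m \<Longrightarrow> finite (E i)"
  by (simp add: E_def Ef_def Ef'_def finA)

lemma E_edges: "i < m \<Longrightarrow> E i \<subseteq> all_edges V"
  using A fV by (fastforce simp: E_def Ef_def Ef'_def mem_all_edges)

lemma U_edges: "U \<subseteq> all_edges V"
  using E_edges by (auto simp: U_def)

lemma finU: "finite U"
  using finE by (auto simp: U_def)

lemma disjE: "disjoint_family_on E {..<m}"
  unfolding disjoint_family_on_def
proof (intro ballI impI)
  fix i j assume ij: "i \<in> {..<m}" "j \<in> {..<m}" "i \<noteq> j"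
  then have "f i \<noteq> f j" "f' i \<noteq> f' j" using inj by (auto dest: inj_onD)
  then show "E i \<inter> E j = {}"
    using ij A ff'[of i j] ff'[of j i] by (auto simp: E_def Ef_def Ef'_def doubleton_eq_iff)
qed

lemma discordant_switch_cases:
  assumes i: "i < m" and T: "T \<subseteq> E i" and ne: "discordant i T \<noteq> {}"
  obtains y a b where "y \<in> A i" "{a, b} = {{f i, y}, {f' i, y}}" "a \<in> T" "b \<notin> T"
    "switch i T = insert b (T - {a})" "a \<noteq> b" "b \<in> E i" "y = Min (discordant i T)"
proof -
  define y where "y = Min (discordant i T)"
  have "y \<in> discordant i T"
    unfolding y_def using ne finA[OF i] by (intro Min_in) (auto simp: discordant_def)
  then have y: "y \<in> A i" "({f i, y} \<in> T) \<noteq> ({f' i, y} \<in> T)" by (auto simp: discordant_def)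
  have neq: "{f i, y} \<noteq> {f' i, y}" using ff'[OF i i] by (auto simp: doubleton_eq_iff)
  have mem: "{f i, y} \<in> E i" "{f' i, y} \<in> E i" using y by (auto simp: E_def Ef_def Ef'_def)
  have sw: "switch i T = sym_diff T {{f i, y}, {f' i, y}}" using ne by (simp add: switch_def y_def)
  show thesis
  proof (cases "{f i, y} \<in> T")
    case True
    then show thesis
      using y neq mem sw by (intro that[of y "{f i, y}" "{f' i, y}"]) (auto simp: y_def)
  next
    case False
    then show thesis
      using y neq mem sw by (intro that[of y "{f' i, y}" "{f i, y}"]) (auto simp: y_def)
  qed
qed

lemma switch_subset: "i < m \<Longrightarrow> T \<subseteq> E i \<Longrightarrow> switch i T \<subseteq> E i"
proof (cases "discordant i T = {}")
  case False
  assume *: "i < m" "T \<subseteq> E i"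
  show ?thesis
    by (rule discordant_switch_cases[OF * False]) (use *(2) in auto)
qed (simp add: switch_def)

text \<open>The switch acts at the least discordant vertex and keeps the discordant set, so a second
  switch acts at the same vertex and undoes the first.\<close>

lemma discordant_switch:
  assumes "i < m" "T \<subseteq> E i"
  shows "discordant i (switch i T) = discordant i T"
proof (cases "discordant i T = {}")
  case False
  define y where "y = Min (discordant i T)"
  have sw: "switch i T = sym_diff T {{f i, y}, {f' i, y}}" using False by (simp add: switch_def y_def)
  have "y \<in> discordant i T"
    unfolding y_def using False finA[OF assms(1)] by (intro Min_in) (auto simp: discordant_def)
  then have y: "y \<noteq> f i" "y \<noteq> f' i" using A(2,3)[OF assms(1,1)] by (auto simp: discordant_def)
  have "({f i, z} \<in> switch i T) \<noteq> ({f' i, z} \<in> switch i T) \<longleftrightarrow> ({f i, z} \<in> T) \<noteq> ({f' i, z} \<in> T)"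
    if "z \<in> A i" for z
  proof -
    have "z \<noteq> f i" "z \<noteq> f' i" using A(2,3)[OF assms(1,1)] that by auto
    then have "{f i, z} \<in> {{f i, y}, {f' i, y}} \<longleftrightarrow> z = y" "{f' i, z} \<in> {{f i, y}, {f' i, y}} \<longleftrightarrow> z = y"
      using y by (auto simp: doubleton_eq_iff)
    then show ?thesis unfolding sw by blast
  qed
  then show ?thesis unfolding discordant_def by blast
qed (simp add: switch_def)

lemma switch_switch:
  assumes "i < m" "T \<subseteq> E i"
  shows "switch i (switch i T) = T"
proof (cases "discordant i T = {}")
  case False
  let ?D = "{{f i, Min (discordant i T)}, {f' i, Min (discordant i T)}}"
  have "switch i T = sym_diff T ?D" using False by (simp add: switch_def)
  moreover have "switch i (switch i T) = sym_diff (switch i T) ?D"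
    using False discordant_switch[OF assms] by (simp add: switch_def)
  ultimately show ?thesis by blast
qed (simp add: switch_def)

lemma card_switch:
  assumes "i < m" "T \<subseteq> E i"
  shows "card (switch i T) = card T"
proof (cases "discordant i T = {}")
  case False
  have "finite T" using assms finE by (auto intro: finite_subset)
  show ?thesis
  proof (rule discordant_switch_cases[OF assms False])
    fix a b assume "a \<in> T" "b \<notin> T" "switch i T = insert b (T - {a})"
    then show ?thesis using \<open>finite T\<close> by (simp add: card_Diff_singleton) (metis card_gt_0_iff Suc_pred empty_iff)
  qed
qed (simp add: switch_def)

lemma degree_shift_switch:
  assumes i: "i < m" and T: "T \<subseteq> E i" and ne: "discordant i T \<noteq> {}"
  shows "x \<noteq> f i \<Longrightarrow> x \<noteq> f' i \<Longrightarrow> degree_shift H (switch i T) x = degree_shift H T x"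
    and "\<bar>degree_shift H (switch i T) (f i) - degree_shift H T (f i)\<bar> = 1"
    and "degree_shift H (switch i T) (f i) + degree_shift H (switch i T) (f' i) =
         degree_shift H T (f i) + degree_shift H T (f' i)"
proof -
  obtain y a b where *: "y \<in> A i" "{a, b} = {{f i, y}, {f' i, y}}" "a \<in> T" "b \<notin> T"
    "switch i T = insert b (T - {a})" "a \<noteq> b"
    using discordant_switch_cases[OF i T ne] by metis
  have ab: "a = {f i, y} \<and> b = {f' i, y} \<or> a = {f' i, y} \<and> b = {f i, y}"
    using *(2) by (auto simp: doubleton_eq_iff)
  have sign: "flip_sign H a = flip_sign H b"
    using ab agree[OF i *(1)] by (auto simp: flip_sign_def)
  have finT: "finite T" using T finE[OF i] by (rule finite_subset)
  have shift: "degree_shift H R x = (\<Sum>e\<in>R. if x \<in> e then flip_sign H e else 0)" if "finite R" for R x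
    unfolding degree_shift_def using that by (simp add: sum.If_cases Int_def)
  have diff: "degree_shift H (switch i T) x = degree_shift H T x
       - (if x \<in> a then flip_sign H a else 0) + (if x \<in> b then flip_sign H a else 0)" for x
  proof -
    have "degree_shift H (switch i T) x =
        (if x \<in> b then flip_sign H b else 0) + (\<Sum>e\<in>T - {a}. if x \<in> e then flip_sign H e else 0)"
      using finT *(4) unfolding *(5) by (subst shift) auto
    then show ?thesis
      using finT *(3) sign by (simp add: shift sum.remove[OF finT *(3)])
  qed
  have dist: "f i \<noteq> f' i" "f i \<noteq> y" "f' i \<noteq> y" using ff'[OF i i] A(2,3)[OF i i] *(1) by auto
  show "degree_shift H (switch i T) x = degree_shift H T x" if "x \<noteq> f i" "x \<noteq> f' i"
    using ab that by (auto simp: diff)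
  have s1: "\<bar>flip_sign H a\<bar> = 1" by (simp add: flip_sign_def)
  show "\<bar>degree_shift H (switch i T) (f i) - degree_shift H T (f i)\<bar> = 1"
    using ab dist s1 by (auto simp: diff)
  show "degree_shift H (switch i T) (f i) + degree_shift H (switch i T) (f' i) =
         degree_shift H T (f i) + degree_shift H T (f' i)"
    using ab dist by (auto simp: diff)
qed

definition deg where "deg R x = card (neighbours (sym_diff H R) x)"

lemma deg_eq: "R \<subseteq> U \<Longrightarrow> real (deg R x) = real (card (neighbours H x)) + degree_shift H R x"
  unfolding deg_def using degree_sym_diff[OF fin H] U_edges by blast

lemma degree_shift_blocks:
  assumes "R \<subseteq> U"
  shows "degree_shift H R x = (\<Sum>i<m. degree_shift H (R \<inter> E i) x)"
proof -
  have "{e \<in> R. x \<in> e} = (\<Union>i<m. {e \<in> R \<inter> E i. x \<in> e})" using assms by (auto simp: U_def)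
  then have "degree_shift H R x = sum (flip_sign H) (\<Union>i<m. {e \<in> R \<inter> E i. x \<in> e})"
    by (simp add: degree_shift_def)
  also have "\<dots> = (\<Sum>i<m. sum (flip_sign H) {e \<in> R \<inter> E i. x \<in> e})"
    by (rule sum.UNION_disjoint) (use finE disjE in \<open>auto simp: disjoint_family_on_def\<close>)
  finally show ?thesis by (simp add: degree_shift_def)
qed

lemma degree_shift_own_block:
  assumes "R \<subseteq> U" "i < m" "x = f i \<or> x = f' i"
  shows "degree_shift H R x = degree_shift H (R \<inter> E i) x"
proof -
  have "{e \<in> R. x \<in> e} = {e \<in> R \<inter> E i. x \<in> e}"
  proof -
    have "e \<in> E i" if e: "e \<in> R" "x \<in> e" for e
    proof -
      obtain j where j: "j < m" "e \<in> E j" using e assms(1) by (auto simp: U_def)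
      obtain y where y: "y \<in> A j" "e = {f j, y} \<or> e = {f' j, y}"
        using j(2) by (auto simp: E_def Ef_def Ef'_def)
      have "x \<noteq> y" using y(1) assms(3) A(2,3)[OF j(1) assms(2)] by auto
      then have "x = f j \<or> x = f' j" using y(2) e(2) by auto
      then have "f i = f j \<or> f' i = f' j" using assms(3) ff'[OF assms(2) j(1)] ff'[OF j(1) assms(2)] by auto
      then have "i = j" using inj assms(2) j(1) by (auto dest: inj_onD)
      then show ?thesis using j by simp
    qed
    then show ?thesis by auto
  qed
  then show ?thesis by (simp add: degree_shift_def)
qed

lemma deg_own_block:
  assumes "R \<subseteq> U" "i < m" "x = f i \<or> x = f' i"
  shows "deg R x = deg (R \<inter> E i) x"
proof -
  have "R \<inter> E i \<subseteq> U" using assms by auto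
  then have "real (deg R x) = real (deg (R \<inter> E i) x)"
    using deg_eq assms(1) degree_shift_own_block[OF assms] by simp
  then show ?thesis by simp
qed

definition sw where "sw J R = (\<Union>i<m. if i \<in> J then switch i (R \<inter> E i) else R \<inter> E i)"

lemma
  assumes "J \<subseteq> {..<m}"
  shows subset_exp_sw: "subset_exp p U (\<lambda>R. F (sw J R)) = subset_exp p U F"
    and sw_block: "\<And>i R. i < m \<Longrightarrow> sw J R \<inter> E i = (if i \<in> J then switch i (R \<inter> E i) else R \<inter> E i)"
    and sw_subset: "\<And>R. sw J R \<subseteq> U"
proof -
  note block = subset_exp_blockwise[where I = "{..<m}" and E = E and s = switch and J = J, OF _ _ disjE]
  show "subset_exp p U (\<lambda>R. F (sw J R)) = subset_exp p U F"
    unfolding sw_def U_def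
    by (rule block(1)) (use finE switch_subset switch_switch card_switch assms in auto)
  show "sw J R \<inter> E i = (if i \<in> J then switch i (R \<inter> E i) else R \<inter> E i)" if "i < m" for i R
    unfolding sw_def
    by (rule block(2)) (use finE switch_subset switch_switch card_switch assms that in auto)
  show "sw J R \<subseteq> U" for R
    unfolding sw_def U_def
    by (rule block(3)) (use finE switch_subset switch_switch card_switch assms in auto)
qed

lemma deg_switch:
  assumes "i < m" "T \<subseteq> E i" "discordant i T \<noteq> {}"
  shows "deg (switch i T) (f i) = deg T (f i) + 1 \<and> deg T (f' i) = deg (switch i T) (f' i) + 1 \<or>
         deg T (f i) = deg (switch i T) (f i) + 1 \<and> deg (switch i T) (f' i) = deg T (f' i) + 1"
proof -
  have sub: "T \<subseteq> U" "switch i T \<subseteq> U"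
    using assms switch_subset[OF assms(1,2)] by (auto simp: U_def)
  note eq = deg_eq[OF sub(1), of "f i"] deg_eq[OF sub(1), of "f' i"]
    deg_eq[OF sub(2), of "f i"] deg_eq[OF sub(2), of "f' i"]
  note shift = degree_shift_switch(2,3)[OF assms]
  let ?a = "real (deg (switch i T) (f i)) - real (deg T (f i))"
  have "\<bar>?a\<bar> = 1" using eq shift(1) by simp
  then consider "?a = 1" | "?a = - 1" by linarith
  then show ?thesis
  proof cases
    case 1
    then have "real (deg (switch i T) (f i)) = real (deg T (f i) + 1)"
      "real (deg T (f' i)) = real (deg (switch i T) (f' i) + 1)" using eq shift(2) by simp_all
    then show ?thesis by (simp only: of_nat_eq_iff) simp
  next
    case 2
    then have "real (deg T (f i)) = real (deg (switch i T) (f i) + 1)"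
      "real (deg (switch i T) (f' i)) = real (deg T (f' i) + 1)" using eq shift(2) by simp_all
    then show ?thesis by (simp only: of_nat_eq_iff) simp
  qed
qed

lemma deg_sw_other:
  assumes J: "J \<subseteq> {..<m}" and R: "R \<subseteq> U" and x: "\<And>i. i < m \<Longrightarrow> x \<noteq> f i \<and> x \<noteq> f' i"
  shows "deg (sw J R) x = deg R x"
proof -
  have "degree_shift H (sw J R) x = degree_shift H R x"
    unfolding degree_shift_blocks[OF sw_subset[OF J]] degree_shift_blocks[OF R]
  proof (rule sum.cong[OF refl])
    fix i assume i: "i \<in> {..<m}"
    show "degree_shift H (sw J R \<inter> E i) x = degree_shift H (R \<inter> E i) x"
    proof (cases "i \<in> J \<and> discordant i (R \<inter> E i) \<noteq> {}")
      case True
      then show ?thesis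
        using degree_shift_switch(1)[of i "R \<inter> E i" x] i x[of i] by (simp add: sw_block[OF J])
    next
      case False
      then show ?thesis using i by (auto simp: sw_block[OF J] switch_def)
    qed
  qed
  then have "real (deg (sw J R) x) = real (deg R x)"
    using deg_eq[OF R] deg_eq[OF sw_subset[OF J]] by simp
  then show ?thesis by simp
qed

text \<open>The coin of a discordant pair toggles the degree of \<open>f i\<close> between
  \<open>lo\<close> and \<open>lo + 1\<close>, and that of \<open>f' i\<close> oppositely between
  \<open>lo'\<close> and \<open>lo' + 1\<close>. If \<open>lo = lo'\<close>, the two vertices merely
  exchange their degree classes, without effect when their \<open>g\<close>-values coincide; such
  pairs are not \<open>good\<close>. Otherwise \<open>level\<close> is the lowest class that feels
  the coin, and its sum changes by one nonzero entry of \<open>g\<close>.\<close>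

definition lo where "lo T i = min (deg T (f i)) (deg (switch i T) (f i))"
definition lo' where "lo' T i = min (deg T (f' i)) (deg (switch i T) (f' i))"
definition good where "good R = {i. i < m \<and> discordant i (R \<inter> E i) \<noteq> {} \<and> lo (R \<inter> E i) i \<noteq> lo' (R \<inter> E i) i}"
definition level where "level R i = min (lo (R \<inter> E i) i) (lo' (R \<inter> E i) i)"
definition multiplicity where "multiplicity R D = card {i \<in> good R. level R i = D}"
definition likelihood where
  "likelihood R = (\<Prod>D\<in>level R ` good R.
     real (multiplicity R D choose (multiplicity R D div 2)) / 2 ^ multiplicity R D)"

lemma good_subset: "good R \<subseteq> {..<m}" by (auto simp: good_def)

lemma finite_good: "finite (good R)" using good_subset by (rule finite_subset) simp

lemma card_good: "card (good R) = (\<Sum>D\<in>level R ` good R. multiplicity R D)"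
proof -
  have "card (good R) = (\<Sum>i\<in>good R. 1)" by simp
  also have "\<dots> = (\<Sum>D\<in>level R ` good R. \<Sum>i | i \<in> good R \<and> level R i = D. 1)"
    by (rule sum.image_gen[OF finite_good])
  finally show ?thesis by (simp add: multiplicity_def)
qed

text \<open>With the choices \<open>B\<close> for all pairs that are not good held fixed, the class
  sums depend on the coins of the good pairs only, and \<open>level\<close> makes this system
  triangular. The product in \<open>likelihood\<close> is then the bound of
  \<open>triangular_littlewood_offord\<close>.\<close>

lemma card_balanced_switches:
  assumes R: "R \<subseteq> U"
  shows "real (card {J. J \<subseteq> {..<m} \<and> degree_balanced V (sym_diff H (sw J R)) g}) / 2 ^ m \<le> likelihood R"
proof -
  define d where "d i b = deg (if b then switch i (R \<inter> E i) else R \<inter> E i) (f i)" for i b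
  define d' where "d' i b = deg (if b then switch i (R \<inter> E i) else R \<inter> E i) (f' i)" for i b
  define h where "h i D b = g (f i) * of_bool (d i b = D) + g (f' i) * of_bool (d' i b = D)" for i D b
  define X where "X = V - f ` {..<m} - f' ` {..<m}"
  define c where "c D = (\<Sum>x\<in>X. g x * of_bool (deg R x = D))" for D
  let ?G = "good R"
  define c' where "c' B D = c D + (\<Sum>i\<in>{..<m} - ?G. h i D (i \<in> B))" for B D
  have balance: "c D + (\<Sum>i<m. h i D (i \<in> J)) = 0"
    if J: "J \<subseteq> {..<m}" and bal: "degree_balanced V (sym_diff H (sw J R)) g" for J D
  proof -
    have dJ: "deg (sw J R) (f i) = d i (i \<in> J)" "deg (sw J R) (f' i) = d' i (i \<in> J)" if "i < m" for i
      using deg_own_block[OF sw_subset[OF J] that] sw_block[OF J that] by (auto simp: d_def d'_def)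
    have V: "V = X \<union> (f ` {..<m} \<union> f' ` {..<m})" using fV by (auto simp: X_def)
    have dj: "f ` {..<m} \<inter> f' ` {..<m} = {}" using ff' by auto
    let ?t = "\<lambda>x. g x * of_bool (deg (sw J R) x = D)"
    have "0 = (\<Sum>x\<in>V. ?t x)" using bal unfolding degree_balanced_def deg_def by simp
    also have "\<dots> = (\<Sum>x\<in>X. ?t x) + (\<Sum>x\<in>f ` {..<m} \<union> f' ` {..<m}. ?t x)"
      by (subst V, rule sum.union_disjoint) (use fin in \<open>auto simp: X_def\<close>)
    also have "(\<Sum>x\<in>f ` {..<m} \<union> f' ` {..<m}. ?t x) = (\<Sum>x\<in>f ` {..<m}. ?t x) + (\<Sum>x\<in>f' ` {..<m}. ?t x)"
      by (rule sum.union_disjoint) (use dj in auto)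
    also have "(\<Sum>x\<in>f ` {..<m}. ?t x) + (\<Sum>x\<in>f' ` {..<m}. ?t x) = (\<Sum>i<m. h i D (i \<in> J))"
    proof -
      have "(\<Sum>x\<in>f ` {..<m}. ?t x) = (\<Sum>i<m. g (f i) * of_bool (d i (i \<in> J) = D))"
        unfolding sum.reindex[OF inj(1)] o_def by (intro sum.cong refl) (simp only: dJ lessThan_iff)
      moreover have "(\<Sum>x\<in>f' ` {..<m}. ?t x) = (\<Sum>i<m. g (f' i) * of_bool (d' i (i \<in> J) = D))"
        unfolding sum.reindex[OF inj(2)] o_def by (intro sum.cong refl) (simp only: dJ lessThan_iff)
      ultimately show ?thesis unfolding h_def sum.distrib by (simp only:)
    qed
    also have "(\<Sum>x\<in>X. ?t x) = c D"
      unfolding c_def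
    proof (rule sum.cong[OF refl])
      fix x assume "x \<in> X"
      then have "deg (sw J R) x = deg R x" by (intro deg_sw_other[OF J R]) (auto simp: X_def)
      then show "?t x = g x * of_bool (deg R x = D)" by simp
    qed
    finally show ?thesis by simp
  qed
  have facts: "discordant i (R \<inter> E i) \<noteq> {}" "lo (R \<inter> E i) i \<noteq> lo' (R \<inter> E i) i" "i < m"
    "lo (R \<inter> E i) i = min (d i False) (d i True)" "lo' (R \<inter> E i) i = min (d' i False) (d' i True)"
    "d i True = d i False + 1 \<and> d' i False = d' i True + 1 \<or>
     d i False = d i True + 1 \<and> d' i True = d' i False + 1" if "i \<in> ?G" for i
    using that deg_switch[of i "R \<inter> E i"] by (auto simp: good_def lo_def lo'_def d_def d'_def)
  have jump: "h i (level R i) True \<noteq> h i (level R i) False" if i: "i \<in> ?G" for i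
  proof (cases "lo (R \<inter> E i) i < lo' (R \<inter> E i) i")
    case True
    then show ?thesis
      using facts[OF i] g(1)[of i] unfolding level_def h_def by (auto simp: min_def split: if_splits)
  next
    case False
    then show ?thesis
      using facts[OF i] g(2)[of i] unfolding level_def h_def by (auto simp: min_def split: if_splits)
  qed
  have flat: "h i D True = h i D False" if i: "i \<in> ?G" and D: "D < level R i" for i D
    using facts[OF i] D unfolding level_def h_def by (auto simp: min_def split: if_splits)
  let ?\<J> = "{J. J \<subseteq> {..<m} \<and> degree_balanced V (sym_diff H (sw J R)) g}"
  let ?S = "\<lambda>B. {J. J \<subseteq> ?G \<and> (\<forall>D\<in>level R ` ?G. c' B D + (\<Sum>i\<in>?G. h i D (i \<in> J)) = 0)}"
  let ?M = "\<Prod>D\<in>level R ` ?G. multiplicity R D choose (multiplicity R D div 2)"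
  have cardS: "card (?S B) \<le> ?M" for B
    unfolding multiplicity_def by (rule triangular_littlewood_offord) (use finite_good jump flat in auto)
  have finS: "finite (?S B)" for B using finite_good by auto
  have sub: "?\<J> \<subseteq> (\<lambda>(B, J). B \<union> J) ` (SIGMA B:Pow ({..<m} - ?G). ?S B)"
  proof
    fix J assume J: "J \<in> ?\<J>"
    have "c' (J - ?G) D + (\<Sum>i\<in>?G. h i D (i \<in> J \<inter> ?G)) = 0" for D
    proof -
      have "(\<Sum>i<m. h i D (i \<in> J)) =
          (\<Sum>i\<in>{..<m} - ?G. h i D (i \<in> J)) + (\<Sum>i\<in>?G. h i D (i \<in> J))"
        using sum.subset_diff[OF good_subset, of "\<lambda>i. h i D (i \<in> J)"] by simp
      moreover have "(\<Sum>i\<in>{..<m} - ?G. h i D (i \<in> J)) = (\<Sum>i\<in>{..<m} - ?G. h i D (i \<in> J - ?G))"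
        "(\<Sum>i\<in>?G. h i D (i \<in> J)) = (\<Sum>i\<in>?G. h i D (i \<in> J \<inter> ?G))"
        by (rule sum.cong[OF refl], simp)+
      moreover have "c D + (\<Sum>i<m. h i D (i \<in> J)) = 0" using balance J by blast
      ultimately show ?thesis unfolding c'_def by linarith
    qed
    then show "J \<in> (\<lambda>(B, J). B \<union> J) ` (SIGMA B:Pow ({..<m} - ?G). ?S B)"
      using J by (intro image_eqI[where x = "(J - ?G, J \<inter> ?G)"]) auto
  qed
  have "card ?\<J> \<le> card (SIGMA B:Pow ({..<m} - ?G). ?S B)"
    by (rule surj_card_le[OF _ sub]) (use finS in auto)
  also have "\<dots> = (\<Sum>B\<in>Pow ({..<m} - ?G). card (?S B))"
    by (rule card_SigmaI) (use finS in auto)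
  also have "\<dots> \<le> (\<Sum>B\<in>Pow ({..<m} - ?G). ?M)" by (rule sum_mono) (rule cardS)
  also have "\<dots> = 2 ^ (m - card ?G) * ?M"
    using good_subset finite_good by (simp add: card_Pow card_Diff_subset)
  finally have "real (card ?\<J>) \<le> real (2 ^ (m - card ?G) * ?M)" by (rule of_nat_mono)
  also have "\<dots> = 2 ^ m / 2 ^ card ?G * real ?M"
  proof -
    have "card ?G \<le> m" using card_mono[OF _ good_subset, of R] by simp
    then have "(2::real) ^ (m - card ?G) = 2 ^ m / 2 ^ card ?G" by (intro power_diff) auto
    then show ?thesis by (simp only: of_nat_mult of_nat_power of_nat_numeral)
  qed
  also have "\<dots> = 2 ^ m * likelihood R"
    unfolding card_good likelihood_def by (simp add: power_sum prod_dividef)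
  finally show ?thesis by (simp add: field_simps)
qed

text \<open>Switching any set \<open>J\<close> of blocks leaves the probability unchanged, so it
  equals its average over all \<open>J\<close>, and for each outcome \<open>R\<close> this average
  counts switchings.\<close>

lemma prob_degree_balanced_le_likelihood:
  "subset_exp p U (\<lambda>R. of_bool (degree_balanced V (sym_diff H R) g)) \<le> subset_exp p U likelihood"
proof -
  let ?e = "\<lambda>R. of_bool (degree_balanced V (sym_diff H R) g) :: real"
  have "subset_exp p U ?e = (\<Sum>J\<in>Pow {..<m}. subset_exp p U (\<lambda>R. ?e (sw J R))) / 2 ^ m"
  proof -
    have "(\<Sum>J\<in>Pow {..<m}. subset_exp p U (\<lambda>R. ?e (sw J R))) = (\<Sum>J\<in>Pow {..<m}. subset_exp p U ?e)"
    proof (rule sum.cong[OF refl])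
      fix J assume "J \<in> Pow {..<m}"
      then show "subset_exp p U (\<lambda>R. ?e (sw J R)) = subset_exp p U ?e"
        using subset_exp_sw[of J ?e] by simp
    qed
    then show ?thesis by (simp only: sum_constant) (simp add: card_Pow)
  qed
  also have "\<dots> = subset_exp p U (\<lambda>R. (\<Sum>J\<in>Pow {..<m}. ?e (sw J R)) / 2 ^ m)"
    unfolding divide_inverse subset_exp_multc subset_exp_sum ..
  also have "\<dots> \<le> subset_exp p U likelihood"
  proof (rule subset_exp_mono)
    fix R assume "R \<subseteq> U"
    have "(\<Sum>J\<in>Pow {..<m}. ?e (sw J R)) =
        real (card {J. J \<subseteq> {..<m} \<and> degree_balanced V (sym_diff H (sw J R)) g})"
      by (subst sum_of_bool_eq) (auto simp: Int_def Pow_def)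
    then show "(\<Sum>J\<in>Pow {..<m}. ?e (sw J R)) / 2 ^ m \<le> likelihood R"
      using card_balanced_switches[OF \<open>R \<subseteq> U\<close>] by simp
  qed (use p in auto)
  finally show ?thesis .
qed

end

section \<open>Multiplicities of levels and the probability of bad pairs\<close>

context switching
begin

definition bad where
  "bad D i T \<longleftrightarrow> discordant i T = {} \<or> lo T i = lo' T i \<or> min (lo T i) (lo' T i) \<in> D"

lemma deg_le: "deg R x \<le> card V" if "R \<subseteq> U"
proof -
  have "sym_diff H R \<subseteq> all_edges V" using that U_edges H by auto
  then have "neighbours (sym_diff H R) x \<subseteq> V"
    by (auto simp: neighbours_def all_edges_def doubleton_eq_iff dest!: subsetD)
  then show ?thesis unfolding deg_def using fin by (rule card_mono[rotated])
qed

lemma level_le: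
  assumes "i \<in> good R"
  shows "level R i \<le> card V"
proof -
  have "i < m" using assms by (simp add: good_def)
  then have "R \<inter> E i \<subseteq> U" by (auto simp: U_def)
  then have "deg (R \<inter> E i) (f i) \<le> card V" by (rule deg_le)
  then show ?thesis unfolding level_def lo_def by linarith
qed

text \<open>At least \<open>t\<close> distinct levels give a factor 1/2 each; at least
  \<open>r\<close> levels of multiplicity \<open>s\<close> or more give a factor
  \<open>1 / sqrt s\<close> each. Otherwise the light levels hold at most \<open>t * s\<close>
  pairs, so at least half of all pairs are bad with respect to the fewer than \<open>r\<close> heavy
  levels.\<close>

lemma likelihood_dichotomy:
  assumes s: "0 < s" and \<eta>: "(1 / sqrt (real s)) ^ r \<le> \<eta>" "(1/2) ^ t \<le> \<eta>" and m: "2 * t * s \<le> m"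
  shows "likelihood R \<le> \<eta> \<or>
    (\<exists>xs. set xs \<subseteq> {..card V} \<and> length xs = r \<and> m \<le> 2 * card {i. i < m \<and> bad (set xs) i (R \<inter> E i)})"
proof -
  let ?L = "level R ` good R"
  let ?q = "\<lambda>D. real (multiplicity R D choose (multiplicity R D div 2)) / 2 ^ multiplicity R D"
  define B where "B = {D \<in> ?L. s \<le> multiplicity R D}"
  have finL: "finite ?L" "finite B" using finite_good by (auto simp: B_def)
  have pos: "0 < multiplicity R D" if "D \<in> ?L" for D
    using that finite_good by (auto simp: multiplicity_def card_gt_0_iff)
  have half: "?q D \<le> 1/2" if "D \<in> ?L" for D by (rule middle_binomial_le_half[OF pos[OF that]])
  have nonneg: "0 \<le> ?q D" for D by simp
  consider "t \<le> card ?L" | "r \<le> card B" | "card ?L < t" "card B < r" by linarith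
  then show ?thesis
  proof cases
    case 1
    have "likelihood R \<le> (\<Prod>D\<in>?L. 1/2)"
      unfolding likelihood_def by (rule prod_mono) (use half in simp)
    also have "\<dots> = (1/2) ^ card ?L" by simp
    also have "\<dots> \<le> (1/2) ^ t" using 1 by (intro power_decreasing) auto
    finally show ?thesis using \<eta>(2) by simp
  next
    case 2
    have "likelihood R \<le> (\<Prod>D\<in>?L. if D \<in> B then 1 / sqrt (real s) else 1)"
      unfolding likelihood_def
    proof (rule prod_mono, intro conjI nonneg)
      fix D assume D: "D \<in> ?L"
      show "?q D \<le> (if D \<in> B then 1 / sqrt (real s) else 1)"
      proof (cases "D \<in> B")
        case True
        then have "1 / sqrt (real (multiplicity R D + 1)) \<le> 1 / sqrt (real s)"
          using s by (intro divide_left_mono) (auto simp: B_def)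
        then show ?thesis using True middle_binomial_bound[of "multiplicity R D"] by simp
      qed (use order.trans[OF half[OF D], of 1] in simp)
    qed
    also have "\<dots> = (1 / sqrt (real s)) ^ card (?L \<inter> B)"
      using finL(1) by (simp add: prod.If_cases)
    also have "?L \<inter> B = B" by (auto simp: B_def)
    also have "(1 / sqrt (real s)) ^ card B \<le> (1 / sqrt (real s)) ^ r"
      using 2 s by (intro power_decreasing) auto
    finally show ?thesis using \<eta>(1) by simp
  next
    case 3
    obtain ys where ys: "set ys = B" "distinct ys" using finite_distinct_list[OF finL(2)] by auto
    \<comment> \<open>Padding to length exactly \<open>r\<close> makes the number of candidate lists
      \<open>(card V + 1) ^ r\<close>; the extra level 0 can only make more pairs bad.\<close>
    define xs where "xs = ys @ replicate (r - card B) 0"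
    have len: "length xs = r" using ys 3 distinct_card[OF ys(2)] by (simp add: xs_def)
    have xs: "set xs \<subseteq> {..card V}" "B \<subseteq> set xs"
      using ys(1) level_le by (auto simp: xs_def B_def)
    let ?X = "{i. i < m \<and> bad (set xs) i (R \<inter> E i)}"
    have "{..<m} - ?X \<subseteq> {i \<in> good R. level R i \<in> ?L - B}"
      using xs(2) by (auto simp: bad_def good_def level_def)
    then have "card ({..<m} - ?X) \<le> card {i \<in> good R. level R i \<in> ?L - B}"
      using finite_good by (intro card_mono) auto
    also have "{i \<in> good R. level R i \<in> ?L - B} = (\<Union>D\<in>?L - B. {i \<in> good R. level R i = D})" by auto
    also have "card \<dots> \<le> (\<Sum>D\<in>?L - B. card {i \<in> good R. level R i = D})"
      by (rule card_UN_le) (use finL in auto)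
    also have "\<dots> \<le> (\<Sum>D\<in>?L - B. s)"
      by (rule sum_mono) (auto simp: B_def multiplicity_def)
    also have "\<dots> \<le> t * s" using 3(1) card_mono[OF finL(1), of "?L - B"] by simp
    finally have "card ({..<m} - ?X) \<le> t * s" .
    moreover have "card ({..<m} - ?X) = m - card ?X"
      by (subst card_Diff_subset) auto
    ultimately have "m \<le> 2 * card ?X" using m by linarith
    then show ?thesis using xs(1) len by blast
  qed
qed

text \<open>An exponential moment: a bad pair has weight 4, any other 1/4, so the product is at
  least 1 when half of the pairs are bad. The mean weight of a pair is at most
  \<open>(1 + 15/16) / 4 \<le> 1/2\<close>.\<close>

lemma prob_many_bad:
  assumes "\<And>i. i < m \<Longrightarrow> subset_exp p (E i) (\<lambda>T. of_bool (bad D i T)) \<le> 1/16"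
  shows "subset_exp p U (\<lambda>R. of_bool (m \<le> 2 * card {i. i < m \<and> bad D i (R \<inter> E i)})) \<le> (1/2) ^ m"
proof -
  let ?h = "\<lambda>i T. (1 + 15 * of_bool (bad D i T)) / 4 :: real"
  have "subset_exp p U (\<lambda>R. of_bool (m \<le> 2 * card {i. i < m \<and> bad D i (R \<inter> E i)})) \<le>
      subset_exp p U (\<lambda>R. \<Prod>i<m. ?h i (R \<inter> E i))"
  proof (rule subset_exp_mono)
    fix R
    let ?X = "{i. i < m \<and> bad D i (R \<inter> E i)}"
    have "(\<Prod>i<m. ?h i (R \<inter> E i)) = (\<Prod>i<m. 1 + 15 * of_bool (bad D i (R \<inter> E i))) / 4 ^ m"
      by (simp add: prod_dividef)
    also have "(\<Prod>i<m. 1 + 15 * of_bool (bad D i (R \<inter> E i))) = (\<Prod>i<m. if bad D i (R \<inter> E i) then 16 else (1::real))"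
      by (intro prod.cong) auto
    also have "\<dots> = 16 ^ card ({..<m} \<inter> {i. bad D i (R \<inter> E i)})"
      by (simp add: prod.If_cases)
    also have "{..<m} \<inter> {i. bad D i (R \<inter> E i)} = ?X" by auto
    finally have eq: "(\<Prod>i<m. ?h i (R \<inter> E i)) = 16 ^ card ?X / 4 ^ m" .
    have "1 \<le> (16::real) ^ card ?X / 4 ^ m" if "m \<le> 2 * card ?X"
    proof -
      have "(4::real) ^ m \<le> 4 ^ (2 * card ?X)" using that by (intro power_increasing) auto
      then show ?thesis by (simp add: power_mult)
    qed
    then show "of_bool (m \<le> 2 * card ?X) \<le> (\<Prod>i<m. ?h i (R \<inter> E i))"
      unfolding eq by simp
  qed (use p in auto)
  also have "\<dots> = (\<Prod>i<m. subset_exp p (E i) (?h i))"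
    unfolding U_def by (rule subset_exp_prod) (use finE disjE in auto)
  also have "\<dots> \<le> (\<Prod>i<m. 1/2)"
  proof (rule prod_mono)
    fix i assume i: "i \<in> {..<m}"
    have "subset_exp p (E i) (?h i) = (1 + 15 * subset_exp p (E i) (\<lambda>T. of_bool (bad D i T))) / 4"
      unfolding divide_inverse subset_exp_multc subset_exp_add subset_exp_cmult
      using finE i by simp
    also have "\<dots> \<le> 1/2" using assms[of i] i by simp
    finally show "0 \<le> subset_exp p (E i) (?h i) \<and> subset_exp p (E i) (?h i) \<le> 1/2"
      using p by (auto intro!: subset_exp_nonneg)
  qed
  finally show ?thesis by simp
qed

lemma switching_swap: "switching V H g m f' f A p"
  by unfold_locales (use fin H fV inj ff' A agree g p in \<open>auto simp: eq_commute[of "f _"]\<close>)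

lemma atom_degree:
  assumes i: "i < m" and k: "0 < k" and a: "a \<le> card (A i)"
  shows "subset_exp p (E i) (\<lambda>T. of_bool (real (deg T (f i)) = c)) \<le> 1 / sqrt (real k) + 2 ^ k * (1 - p) ^ a"
proof -
  have "subset_exp p (E i) (\<lambda>T. of_bool (real (deg T (f i)) = c)) =
      subset_exp p (Ef i) (\<lambda>T. of_bool ((\<Sum>e\<in>T. flip_sign H e) = c - real (card (neighbours H (f i)))))"
  proof (rule subset_exp_marginal[OF finE[OF i]])
    fix T assume T: "T \<subseteq> E i"
    then have "T \<subseteq> U" using i by (auto simp: U_def)
    moreover have "{e \<in> T. f i \<in> e} = T \<inter> Ef i"
      using T A(2)[OF i i] ff'[OF i i] by (auto simp: E_def Ef_def Ef'_def)
    ultimately show "of_bool (real (deg T (f i)) = c) =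
        (of_bool ((\<Sum>e\<in>T \<inter> Ef i. flip_sign H e) = c - real (card (neighbours H (f i)))) :: real)"
      by (auto simp: deg_eq degree_shift_def)
  qed (auto simp: E_def)
  also have "\<dots> \<le> 1 / sqrt (real k) + 2 ^ k * (1 - p) ^ card (Ef i)"
    by (rule atom_le_sqrt) (use finA[OF i] p k in \<open>auto simp: Ef_def flip_sign_def\<close>)
  also have "card (Ef i) = card (A i)"
    unfolding Ef_def by (rule card_image) (auto simp: inj_on_def doubleton_eq_iff)
  also have "(1 - p) ^ card (A i) \<le> (1 - p) ^ a"
    using a p by (intro power_decreasing) auto
  finally show ?thesis by simp
qed

lemma atom_degree_difference:
  assumes i: "i < m" and k: "0 < k" and a: "a \<le> card (A i)"
  shows "subset_exp p (E i) (\<lambda>T. of_bool (real (deg T (f i)) - real (deg T (f' i)) = c)) \<le>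
           1 / sqrt (real k) + 2 ^ k * (1 - p) ^ a"
proof -
  let ?\<kappa> = "real (card (neighbours H (f i))) - real (card (neighbours H (f' i)))"
  let ?s = "\<lambda>e. if f i \<in> e then flip_sign H e else - flip_sign H e"
  have "subset_exp p (E i) (\<lambda>T. of_bool (real (deg T (f i)) - real (deg T (f' i)) = c)) =
      subset_exp p (E i) (\<lambda>T. of_bool ((\<Sum>e\<in>T. ?s e) = c - ?\<kappa>))"
  proof (rule subset_exp_cong)
    fix T assume T: "T \<subseteq> E i"
    then have TU: "T \<subseteq> U" using i by (auto simp: U_def)
    have finT: "finite T" using T finE[OF i] by (rule finite_subset)
    have "f' i \<in> e \<longleftrightarrow> f i \<notin> e" if "e \<in> T" for e
      using that T A(2,3)[OF i i] ff'[OF i i] by (auto simp: E_def Ef_def Ef'_def)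
    then have "degree_shift H T (f' i) = (\<Sum>e | e \<in> T \<and> f i \<notin> e. flip_sign H e)"
      unfolding degree_shift_def by (intro sum.cong) auto
    moreover have "(\<Sum>e\<in>T. ?s e) = (\<Sum>e | e \<in> T \<and> f i \<in> e. flip_sign H e) + (\<Sum>e | e \<in> T \<and> f i \<notin> e. - flip_sign H e)"
      using finT by (simp add: sum.If_cases Int_def)
    ultimately have "(\<Sum>e\<in>T. ?s e) = degree_shift H T (f i) - degree_shift H T (f' i)"
      by (simp add: degree_shift_def sum_negf)
    then show "of_bool (real (deg T (f i)) - real (deg T (f' i)) = c) =
        (of_bool ((\<Sum>e\<in>T. ?s e) = c - ?\<kappa>) :: real)"
      using TU by (auto simp: deg_eq)
  qed
  also have "\<dots> \<le> 1 / sqrt (real k) + 2 ^ k * (1 - p) ^ card (E i)"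
    by (rule atom_le_sqrt) (use finE[OF i] p k in \<open>auto simp: flip_sign_def\<close>)
  also have "(1 - p) ^ card (E i) \<le> (1 - p) ^ a"
  proof (rule power_decreasing)
    have "card (A i) = card (Ef i)"
      unfolding Ef_def by (rule card_image[symmetric]) (auto simp: inj_on_def doubleton_eq_iff)
    also have "\<dots> \<le> card (E i)" using finE[OF i] by (intro card_mono) (auto simp: E_def)
    finally show "a \<le> card (E i)" using a by simp
  qed (use p in auto)
  finally show ?thesis by simp
qed

lemma degree_shift_concordant:
  assumes i: "i < m" and T: "T \<subseteq> E i" and c: "discordant i T = {}"
  shows "degree_shift H T (f i) = degree_shift H T (f' i)"
proof -
  let ?Y = "{y \<in> A i. {f i, y} \<in> T}" and ?Y' = "{y \<in> A i. {f' i, y} \<in> T}"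
  have fs: "{e \<in> T. f i \<in> e} = (\<lambda>y. {f i, y}) ` ?Y" "{e \<in> T. f' i \<in> e} = (\<lambda>y. {f' i, y}) ` ?Y'"
    using T A(2,3)[OF i i] ff'[OF i i] by (auto simp: E_def Ef_def Ef'_def)
  have inj: "inj_on (\<lambda>y. {x, y}) B" for x :: nat and B by (auto simp: inj_on_def doubleton_eq_iff)
  have "?Y = ?Y'" using c by (auto simp: discordant_def)
  have "degree_shift H T (f i) = (\<Sum>y\<in>?Y. flip_sign H {f i, y})"
    unfolding degree_shift_def fs by (subst sum.reindex[OF inj]) simp
  also have "\<dots> = (\<Sum>y\<in>?Y'. flip_sign H {f' i, y})"
    using \<open>?Y = ?Y'\<close> agree[OF i] by (intro sum.cong) (auto simp: flip_sign_def)
  also have "\<dots> = degree_shift H T (f' i)"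
    unfolding degree_shift_def fs by (subst sum.reindex[OF inj]) simp
  finally show ?thesis .
qed

lemma prob_bad:
  assumes i: "i < m" and k: "0 < k" and a: "a \<le> card (A i)" and D: "finite D" "card D \<le> r"
    and small: "(4 + 4 * real r) * (1 / sqrt (real k) + 2 ^ k * (1 - p) ^ a) \<le> 1/16"
  shows "subset_exp p (E i) (\<lambda>T. of_bool (bad D i T)) \<le> 1/16"
proof -
  let ?q = "1 / sqrt (real k) + 2 ^ k * (1 - p) ^ a"
  let ?\<kappa> = "real (card (neighbours H (f i))) - real (card (neighbours H (f' i)))"
  let ?C = "{- 1, 0, 1, ?\<kappa>}"
  let ?D = "real ` (D \<union> Suc ` D)"
  let ?x = "\<lambda>T. real (deg T (f i))" and ?x' = "\<lambda>T. real (deg T (f' i))"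
  interpret sw': switching V H g m f' f A p by (rule switching_swap)
  have q: "0 \<le> ?q" using p by simp
  have E': "sw'.E i = E i" by (auto simp: E_def sw'.E_def Ef_def Ef'_def sw'.Ef_def sw'.Ef'_def)
  have finD: "finite ?D" using D by auto
  have "card ?D \<le> card (D \<union> Suc ` D)" using D by (intro card_image_le) auto
  also have "\<dots> \<le> card D + card (Suc ` D)" by (rule card_Un_le)
  also have "\<dots> \<le> r + r" using D card_image_le[OF D(1), of Suc] by linarith
  finally have cardD: "real (card ?D) \<le> 2 * real r" by linarith
  have cover: "of_bool (bad D i T) \<le> (\<Sum>c\<in>?C. of_bool (?x T - ?x' T = c) :: real) +
      ((\<Sum>c\<in>?D. of_bool (?x T = c)) + (\<Sum>c\<in>?D. of_bool (?x' T = c)))" if T: "T \<subseteq> E i" for T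
  proof -
    have hit: "1 \<le> (\<Sum>c\<in>S. of_bool (z = c) :: real)" if "finite S" "z \<in> S" for S and z :: real
      using that by (simp add: sum.remove[of S z] sum_nonneg)
    have nn: "0 \<le> (\<Sum>c\<in>S. of_bool (z = c) :: real)" for S and z :: real by (simp add: sum_nonneg)
    have TU: "T \<subseteq> U" using T i by (auto simp: U_def)
    have "?x T - ?x' T \<in> ?C \<or> ?x T \<in> ?D \<or> ?x' T \<in> ?D" if b: "bad D i T"
    proof (cases "discordant i T = {}")
      case True
      then have "?x T - ?x' T = ?\<kappa>"
        using degree_shift_concordant[OF i T True] deg_eq[OF TU] by simp
      then show ?thesis by simp
    next
      case False
      note sw = deg_switch[OF i T False]
      from b False have "lo T i = lo' T i \<or> lo T i \<in> D \<or> lo' T i \<in> D" by (auto simp: bad_def min_def split: if_splits)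
      moreover have "deg T (f i) = lo T i \<or> deg T (f i) = Suc (lo T i)"
        "deg T (f' i) = lo' T i \<or> deg T (f' i) = Suc (lo' T i)"
        using sw by (auto simp: lo_def lo'_def)
      ultimately show ?thesis by auto
    qed
    then have h: "1 \<le> (\<Sum>c\<in>?C. of_bool (?x T - ?x' T = c) :: real) \<or>
        1 \<le> (\<Sum>c\<in>?D. of_bool (?x T = c) :: real) \<or> 1 \<le> (\<Sum>c\<in>?D. of_bool (?x' T = c) :: real)"
      if "bad D i T"
      using that hit[of ?C "?x T - ?x' T"] hit[OF finD, of "?x T"] hit[OF finD, of "?x' T"] by blast
    have aux: "z \<le> a + (b + c)" if "z = 1 \<and> (1 \<le> a \<or> 1 \<le> b \<or> 1 \<le> c) \<or> z = 0" "0 \<le> a" "0 \<le> b" "0 \<le> c"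
      for z a b c :: real using that by linarith
    note nn' = nn[of "?x T - ?x' T" ?C] nn[of "?x T" ?D] nn[of "?x' T" ?D]
    show ?thesis
    proof (rule aux[OF _ nn'], cases "bad D i T")
      case True
      then have "of_bool (bad D i T) = (1::real)" by simp
      then show "of_bool (bad D i T) = (1::real) \<and>
          (1 \<le> (\<Sum>c\<in>?C. of_bool (?x T - ?x' T = c) :: real) \<or>
           1 \<le> (\<Sum>c\<in>?D. of_bool (?x T = c) :: real) \<or> 1 \<le> (\<Sum>c\<in>?D. of_bool (?x' T = c) :: real)) \<or>
          of_bool (bad D i T) = (0::real)"
        using h[OF True] by blast
    qed simp
  qed
  have "subset_exp p (E i) (\<lambda>T. of_bool (bad D i T)) \<le>
      (\<Sum>c\<in>?C. subset_exp p (E i) (\<lambda>T. of_bool (?x T - ?x' T = c))) +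
      ((\<Sum>c\<in>?D. subset_exp p (E i) (\<lambda>T. of_bool (?x T = c))) +
       (\<Sum>c\<in>?D. subset_exp p (E i) (\<lambda>T. of_bool (?x' T = c))))"
    unfolding subset_exp_sum[symmetric] subset_exp_add[symmetric]
  proof (rule subset_exp_mono[OF p(1)])
    show "p \<le> 1" using p by simp
  qed (rule cover)
  also have "\<dots> \<le> (\<Sum>c\<in>?C. ?q) + ((\<Sum>c\<in>?D. ?q) + (\<Sum>c\<in>?D. ?q))"
  proof (intro add_mono sum_mono)
    fix c
    show "subset_exp p (E i) (\<lambda>T. of_bool (?x T - ?x' T = c)) \<le> ?q"
      by (rule atom_degree_difference[OF i k a])
    show "subset_exp p (E i) (\<lambda>T. of_bool (?x T = c)) \<le> ?q"
      by (rule atom_degree[OF i k a])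
    show "subset_exp p (E i) (\<lambda>T. of_bool (?x' T = c)) \<le> ?q"
      using sw'.atom_degree[OF i k a, of c] unfolding E' .
  qed
  also have "\<dots> = (real (card ?C) + 2 * real (card ?D)) * ?q"
    by (simp add: algebra_simps)
  also have "\<dots> \<le> (4 + 4 * real r) * ?q"
  proof (rule mult_right_mono[OF _ q])
    have "card ?C \<le> 4" by (simp add: card_insert_if)
    then show "real (card ?C) + 2 * real (card ?D) \<le> 4 + 4 * real r" using cardD by linarith
  qed
  finally show ?thesis using small by linarith
qed

lemma prob_degree_balanced:
  assumes s: "0 < s" and \<eta>: "(1 / sqrt (real s)) ^ r \<le> \<eta>" "(1/2) ^ t \<le> \<eta>" and ts: "2 * t * s \<le> m"
    and k: "0 < k" and a: "\<And>i. i < m \<Longrightarrow> a \<le> card (A i)"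
    and small: "(4 + 4 * real r) * (1 / sqrt (real k) + 2 ^ k * (1 - p) ^ a) \<le> 1/16"
  shows "subset_exp p U (\<lambda>R. of_bool (degree_balanced V (sym_diff H R) g)) \<le>
           \<eta> + real (card V + 1) ^ r * (1/2) ^ m"
proof -
  let ?X = "{xs. set xs \<subseteq> {..card V} \<and> length xs = r}"
  let ?many = "\<lambda>xs R. m \<le> 2 * card {i. i < m \<and> bad (set xs) i (R \<inter> E i)}"
  have finX: "finite ?X" by (rule finite_lists_length_eq) simp
  have \<eta>0: "0 \<le> \<eta>" by (rule order.trans[OF _ \<eta>(2)]) simp
  have le1: "likelihood R \<le> 1" for R
    unfolding likelihood_def
  proof (rule prod_le_1, intro conjI)
    fix D
    show "real (multiplicity R D choose (multiplicity R D div 2)) / 2 ^ multiplicity R D \<le> 1"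
      using order.trans[OF middle_binomial_le_half[of "multiplicity R D"], of 1]
      by (cases "multiplicity R D = 0") simp_all
  qed simp
  have "subset_exp p U (\<lambda>R. of_bool (degree_balanced V (sym_diff H R) g)) \<le> subset_exp p U likelihood"
    by (rule prob_degree_balanced_le_likelihood)
  also have "\<dots> \<le> subset_exp p U (\<lambda>R. \<eta> + (\<Sum>xs\<in>?X. of_bool (?many xs R)))"
  proof (rule subset_exp_mono)
    fix R
    show "likelihood R \<le> \<eta> + (\<Sum>xs\<in>?X. of_bool (?many xs R))"
    proof (cases "likelihood R \<le> \<eta>")
      case False
      then obtain xs where xs: "xs \<in> ?X" "?many xs R"
        using likelihood_dichotomy[OF s \<eta> ts, of R] by auto
      have "(1::real) \<le> (\<Sum>xs\<in>?X. of_bool (?many xs R))"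
        using member_le_sum[OF xs(1), of "\<lambda>xs. of_bool (?many xs R) :: real"] finX xs(2) by simp
      then show ?thesis using le1[of R] \<eta>0 by linarith
    qed (simp add: add_increasing2 sum_nonneg)
  qed (use p in auto)
  also have "\<dots> = \<eta> + (\<Sum>xs\<in>?X. subset_exp p U (\<lambda>R. of_bool (?many xs R)))"
    unfolding subset_exp_add subset_exp_sum using finU by simp
  also have "(\<Sum>xs\<in>?X. subset_exp p U (\<lambda>R. of_bool (?many xs R))) \<le> (\<Sum>xs\<in>?X. (1/2) ^ m)"
  proof (rule sum_mono)
    fix xs assume "xs \<in> ?X"
    then have "card (set xs) \<le> r" using card_length[of xs] by simp
    then show "subset_exp p U (\<lambda>R. of_bool (?many xs R)) \<le> (1/2) ^ m"
      by (intro prob_many_bad prob_bad[OF _ k a _ _ small]) auto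
  qed
  also have "(\<Sum>xs\<in>?X. (1/2) ^ m) = real (card V + 1) ^ r * (1/2) ^ m"
    by (simp add: card_lists_length_eq)
  finally show ?thesis by simp
qed

end

text \<open>At each \<open>y\<close> some two of any three vertices agree, so one of the three pairs
  agrees on a third of \<open>Y\<close>. The size \<open>2 * m + 1\<close> leaves at least three
  vertices whenever another pair is wanted.\<close>

lemma agreeing_pairs:
  fixes F :: "'v set"
  assumes "finite Y" "2 * m + 1 \<le> card F"
  shows "\<exists>f f'. (\<forall>i<m. f i \<in> F \<and> f' i \<in> F) \<and> inj_on f {..<m} \<and> inj_on f' {..<m} \<and>
           (\<forall>i<m. \<forall>j<m. f i \<noteq> f' j) \<and>
           (\<forall>i<m. card Y \<le> 3 * card {y \<in> Y. {f i, y} \<in> H \<longleftrightarrow> {f' i, y} \<in> H})"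
  using assms(2)
proof (induction m arbitrary: F)
  case (Suc m)
  let ?ag = "\<lambda>x x'. {y \<in> Y. {x, y} \<in> H \<longleftrightarrow> {x', y} \<in> H}"
  have "3 \<le> card F" using Suc.prems by simp
  then obtain B where "B \<subseteq> F" "card B = 3" by (meson obtain_subset_with_card_n)
  then obtain a b c where abc: "a \<in> F" "b \<in> F" "c \<in> F" "a \<noteq> b" "b \<noteq> c" "a \<noteq> c"
    by (auto simp: card_3_iff)
  have "Y \<subseteq> ?ag a b \<union> ?ag b c \<union> ?ag a c" by blast
  then have "card Y \<le> card (?ag a b \<union> ?ag b c \<union> ?ag a c)"
    using assms(1) by (intro card_mono) auto
  also have "\<dots> \<le> card (?ag a b) + card (?ag b c) + card (?ag a c)"
    using card_Un_le[of "?ag a b \<union> ?ag b c" "?ag a c"] card_Un_le[of "?ag a b" "?ag b c"] by linarith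
  finally have "card Y \<le> 3 * card (?ag a b) \<or> card Y \<le> 3 * card (?ag b c) \<or> card Y \<le> 3 * card (?ag a c)"
    by linarith
  then obtain u v where uv: "u \<in> F" "v \<in> F" "u \<noteq> v" "card Y \<le> 3 * card (?ag u v)"
    using abc by blast
  have "finite F" using Suc.prems by (auto intro: card_ge_0_finite)
  then have "2 * m + 1 \<le> card (F - {u, v})" using uv Suc.prems by (simp add: card_Diff_insert)
  from Suc.IH[OF this] obtain f f' where ff': "\<And>i. i < m \<Longrightarrow> f i \<in> F - {u, v} \<and> f' i \<in> F - {u, v}"
    "inj_on f {..<m}" "inj_on f' {..<m}" "\<And>i j. i < m \<Longrightarrow> j < m \<Longrightarrow> f i \<noteq> f' j"
    "\<And>i. i < m \<Longrightarrow> card Y \<le> 3 * card (?ag (f i) (f' i))"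
    by blast
  have eq: "(f(m := u)) i = (if i = m then u else f i)" "(f'(m := v)) i = (if i = m then v else f' i)" for i
    by auto
  have "inj_on (f(m := u)) {..<Suc m}" "inj_on (f'(m := v)) {..<Suc m}"
    using ff'(1-3) by (fastforce simp: inj_on_def less_Suc_eq eq)+
  moreover have "\<forall>i<Suc m. (f(m := u)) i \<in> F \<and> (f'(m := v)) i \<in> F"
    using ff'(1) uv by (auto simp: less_Suc_eq)
  moreover have "\<forall>i<Suc m. \<forall>j<Suc m. (f(m := u)) i \<noteq> (f'(m := v)) j"
    using ff'(1,4) uv by (fastforce simp: less_Suc_eq eq)
  moreover have "\<forall>i<Suc m. card Y \<le> 3 * card (?ag ((f(m := u)) i) ((f'(m := v)) i))"
    using ff'(5) uv(4) by (auto simp: less_Suc_eq)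
  ultimately show ?case by blast
qed simp

text \<open>The pairs are chosen from \<open>H\<close> alone, before any coin is seen. All edges
  outside their blocks are then fixed and absorbed into \<open>H\<close>; agreement on the sets
  \<open>A i\<close> persists because the blocks avoid these edges.\<close>

theorem degree_balanced_unlikely:
  fixes V :: "nat set" and g :: "nat \<Rightarrow> real"
  assumes V: "finite V" "H \<subseteq> all_edges V" "P \<subseteq> V" "F \<subseteq> V - P" and g: "\<And>x. x \<in> F \<Longrightarrow> g x \<noteq> 0"
    and p: "0 \<le> p" "p \<le> 1/2"
    and m: "2 * m + 1 \<le> card F" and a: "3 * a + card P + (2 * m + 1) \<le> card V"
    and s: "0 < s" and \<eta>: "(1 / sqrt (real s)) ^ r \<le> \<eta>" "(1/2) ^ t \<le> \<eta>" and ts: "2 * t * s \<le> m"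
    and k: "0 < k" and small: "(4 + 4 * real r) * (1 / sqrt (real k) + 2 ^ k * (1 - p) ^ a) \<le> 1/16"
  shows "subset_exp p (all_edges (V - P)) (\<lambda>R. of_bool (degree_balanced V (sym_diff H R) g)) \<le>
           \<eta> + real (card V + 1) ^ r * (1/2) ^ m"
proof -
  \<comment> \<open>Only \<open>2 * m + 1\<close> support vertices are kept, so that
    \<open>Y\<close> stays large even if \<open>F\<close> is almost everything.\<close>
  obtain F0 where F0: "F0 \<subseteq> F" "card F0 = 2 * m + 1" using obtain_subset_with_card_n[OF m] by metis
  define Y where "Y = V - P - F0"
  have finY: "finite Y" using V(1) by (simp add: Y_def)
  have finF0: "finite F0" using F0(2) by (auto intro: card_ge_0_finite)
  have "card Y = card V - card P - card F0"
    unfolding Y_def using V F0 finF0 by (subst card_Diff_subset) (auto simp: card_Diff_subset finite_subset)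
  then have cardY: "3 * a \<le> card Y" using a F0(2) by simp
  obtain f f' where ff': "\<And>i. i < m \<Longrightarrow> f i \<in> F0 \<and> f' i \<in> F0"
    "inj_on f {..<m}" "inj_on f' {..<m}" "\<And>i j. i < m \<Longrightarrow> j < m \<Longrightarrow> f i \<noteq> f' j"
    "\<And>i. i < m \<Longrightarrow> card Y \<le> 3 * card {y \<in> Y. {f i, y} \<in> H \<longleftrightarrow> {f' i, y} \<in> H}"
  proof -
    have "2 * m + 1 \<le> card F0" using F0(2) by simp
    from agreeing_pairs[OF finY this, of H] obtain f f' where
      *: "\<forall>i<m. f i \<in> F0 \<and> f' i \<in> F0" "inj_on f {..<m}" "inj_on f' {..<m}"
        "\<forall>i<m. \<forall>j<m. f i \<noteq> f' j"
        "\<forall>i<m. card Y \<le> 3 * card {y \<in> Y. {f i, y} \<in> H \<longleftrightarrow> {f' i, y} \<in> H}"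
      by blast
    show thesis by (rule that[of f f']) (use * in blast)+
  qed
  define A where "A i = {y \<in> Y. {f i, y} \<in> H \<longleftrightarrow> {f' i, y} \<in> H}" for i
  let ?U = "switching.U m f f' A"
  have sw: "switching V (sym_diff H R) g m f f' A p" if R: "R \<subseteq> all_edges V"
    and disj: "\<And>i y. i < m \<Longrightarrow> y \<in> A i \<Longrightarrow> {f i, y} \<notin> R \<and> {f' i, y} \<notin> R" for R
  proof unfold_locales
    show "sym_diff H R \<subseteq> all_edges V" using V(2) R by auto
    show "f i \<in> V" "f' i \<in> V" "g (f i) \<noteq> 0" "g (f' i) \<noteq> 0" if "i < m" for i
      using ff'(1)[OF that] F0(1) V(4) g by auto
    show "A i \<subseteq> V" if "i < m" for i by (auto simp: A_def Y_def)
    show "f j \<notin> A i" "f' j \<notin> A i" if "i < m" "j < m" for i j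
      using ff'(1)[OF that(2)] by (auto simp: A_def Y_def)
    show "{f i, y} \<in> sym_diff H R \<longleftrightarrow> {f' i, y} \<in> sym_diff H R" if "i < m" "y \<in> A i" for i y
      using disj[OF that] that(2) by (auto simp: A_def)
  qed (use V p ff' in auto)
  \<comment> \<open>The instance with nothing revealed serves to unfold the block edges
    \<open>?U\<close>, which do not depend on \<open>R\<close>.\<close>
  interpret sw0: switching V "sym_diff H {}" g m f f' A p by (rule sw) auto
  have U: "?U = (\<Union>i<m. (\<lambda>y. {f i, y}) ` A i \<union> (\<lambda>y. {f' i, y}) ` A i)"
    by (simp add: sw0.U_def sw0.E_def sw0.Ef_def sw0.Ef'_def)
  have U_sub: "?U \<subseteq> all_edges (V - P)"
    unfolding U using ff'(1) F0(1) V(4) by (fastforce simp: A_def Y_def mem_all_edges)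
  have finE: "finite (all_edges (V - P))" using V(1) by (simp add: finite_all_edges)
  have "subset_exp p (all_edges (V - P)) (\<lambda>R. of_bool (degree_balanced V (sym_diff H R) g)) =
      subset_exp p (all_edges (V - P) - ?U)
        (\<lambda>R. subset_exp p ?U (\<lambda>S. of_bool (degree_balanced V (sym_diff H (R \<union> S)) g)))"
    by (rule subset_exp_split[OF finE U_sub])
  also have "\<dots> \<le> \<eta> + real (card V + 1) ^ r * (1/2) ^ m"
  proof (rule subset_exp_le_const)
    fix R assume R: "R \<subseteq> all_edges (V - P) - ?U"
    interpret sw: switching V "sym_diff H R" g m f f' A p
    proof (rule sw)
      show "R \<subseteq> all_edges V" using R all_edges_mono[of "V - P" V] by auto
      show "{f i, y} \<notin> R \<and> {f' i, y} \<notin> R" if "i < m" "y \<in> A i" for i y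
        using R that unfolding U by blast
    qed
    have "subset_exp p ?U (\<lambda>S. of_bool (degree_balanced V (sym_diff H (R \<union> S)) g)) =
        subset_exp p ?U (\<lambda>S. of_bool (degree_balanced V (sym_diff (sym_diff H R) S) g))"
    proof (rule subset_exp_cong)
      fix S assume "S \<subseteq> ?U"
      then have "sym_diff H (R \<union> S) = sym_diff (sym_diff H R) S" using R by blast
      then show "of_bool (degree_balanced V (sym_diff H (R \<union> S)) g) =
          (of_bool (degree_balanced V (sym_diff (sym_diff H R) S) g) :: real)" by simp
    qed
    also have "\<dots> \<le> \<eta> + real (card V + 1) ^ r * (1/2) ^ m"
    proof (rule sw.prob_degree_balanced[OF s \<eta> ts k _ small])
      fix i assume "i < m"
      then show "a \<le> card (A i)" using ff'(5)[of i] cardY by (simp add: A_def)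
    qed
    finally show "subset_exp p ?U (\<lambda>S. of_bool (degree_balanced V (sym_diff H (R \<union> S)) g)) \<le>
        \<eta> + real (card V + 1) ^ r * (1/2) ^ m" .
  qed (use finE p in auto)
  finally show ?thesis .
qed

subsection \<open>Exploration from a pair of vertices\<close>

text \<open>In the application \<open>\<beta> = ln (ln n)\<close> and
  \<open>L = ln n / \<beta>\<close>, so \<open>exp \<beta> = ln n\<close> and
  \<open>exp (\<beta> * L) = n\<close>; \<open>M\<close> is about \<open>sqrt n / 2\<close>, and
  \<open>\<tau>\<close> bounds the failure of the degree argument. By \<open>expand\<close>, each
  frontier vertex earns \<open>5 * \<beta>\<close> in the exponent; the factor 1/2 leaves room for a
  second error term.\<close>

locale exploration =
  fixes V :: "nat set" and p \<beta> L \<tau> :: real and M :: nat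
  assumes finV: "finite V" and p: "0 \<le> p" "p \<le> 1/2"
    and \<beta>: "2 \<le> \<beta>" and L: "0 \<le> L" "L \<le> exp \<beta>" "L \<le> real M"
    and expand: "\<And>m N. 1 \<le> m \<Longrightarrow> m \<le> M \<Longrightarrow> card V \<le> 2 * N \<Longrightarrow>
      ((3 + (1 - 2 * p) ^ m) / 4) ^ N \<le> exp (- 5 * \<beta> * real m) / 2"
    and degree_bound: "\<And>H P F g. H \<subseteq> all_edges V \<Longrightarrow> P \<subseteq> V \<Longrightarrow> F \<subseteq> V - P \<Longrightarrow> (\<And>x. x \<in> F \<Longrightarrow> g x \<noteq> 0) \<Longrightarrow>
      M \<le> card F \<Longrightarrow> real (card P) \<le> L + 4 * real M \<Longrightarrow>
      subset_exp p (all_edges (V - P)) (\<lambda>R. of_bool (degree_balanced V (sym_diff H R) g)) \<le> \<tau>"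
    and size: "2 * (L + 5 * real M) \<le> real (card V)"
    and \<tau>: "0 \<le> \<tau>" "\<tau> \<le> exp (- 8 * \<beta> * L) / 2"
begin

lemma expected_new_support:
  fixes g :: "nat \<Rightarrow> real"
  assumes PF: "P \<subseteq> V" "F \<subseteq> V - P" "1 \<le> card F" "card F \<le> M" "real (card P) \<le> L + 4 * real M"
    and g: "\<And>x. x \<in> F \<Longrightarrow> g x \<noteq> 0" "\<And>x. x \<in> V - P - F \<Longrightarrow> g x = 0"
  shows "subset_exp p (fresh_edges V P F)
           (\<lambda>R. (1/2) ^ card (new_support V (P \<union> F) (sym_diff H R) g)) \<le> exp (- 5 * \<beta> * real (card F)) / 2"
proof -
  have fin: "finite P" "finite F" using PF finV by (auto intro: finite_subset)
  have "V - P - F = V - (P \<union> F)" by auto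
  moreover have "card (P \<union> F) \<le> card P + card F" by (rule card_Un_le)
  moreover have "card (V - (P \<union> F)) = card V - card (P \<union> F)"
    using PF fin by (intro card_Diff_subset) auto
  ultimately have "card V \<le> 2 * card (V - P - F)" using PF size by simp
  then have "((3 + (1 - 2 * p) ^ card F) / 4) ^ card (V - P - F) \<le> exp (- 5 * \<beta> * real (card F)) / 2"
    using PF by (intro expand) auto
  moreover have "subset_exp p (fresh_edges V P F)
           (\<lambda>R. (1/2) ^ card (new_support V (P \<union> F) (sym_diff H R) g)) \<le>
       ((3 + (1 - 2 * p) ^ card F) / 4) ^ card (V - P - F)"
    by (rule expansion) (use finV PF p g in auto)
  ultimately show ?thesis by linarith
qed

lemma exp_le_half_power: "exp (- \<beta> * real k) \<le> (1/2) ^ k"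
proof -
  have "2 \<le> exp (1::real)" using exp_ge_add_one_self[of 1] by simp
  also have "\<dots> \<le> exp \<beta>" using \<beta> by simp
  finally have "exp (- \<beta>) \<le> 1/2" by (simp add: exp_minus field_simps)
  then have "exp (- \<beta>) ^ k \<le> (1/2) ^ k" by (intro power_mono) auto
  then show ?thesis by (simp add: mult.commute exp_of_nat2_mult[symmetric])
qed

lemma split_fresh_edges:
  "subset_exp p (all_edges (V - P)) f =
     subset_exp p (fresh_edges V P F) (\<lambda>R. subset_exp p (all_edges (V - (P \<union> F))) (\<lambda>S. f (R \<union> S)))"
proof -
  have "V - P - F = V - (P \<union> F)" by auto
  then show ?thesis
    unfolding fresh_edges_def
    using subset_exp_split[OF finite_all_edges[of "V - P"], of "all_edges (V - (P \<union> F))" p f]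
      all_edges_mono[of "V - (P \<union> F)" "V - P"] finV by (simp add: Diff_mono)
qed

lemma sym_diff_fresh:
  assumes "R \<subseteq> fresh_edges V P F" "S \<subseteq> all_edges (V - (P \<union> F))"
  shows "sym_diff H (R \<union> S) = sym_diff (sym_diff H R) S"
proof -
  have "V - P - F = V - (P \<union> F)" by auto
  then have "R \<inter> S = {}" using assms by (auto simp: fresh_edges_def)
  then show ?thesis by blast
qed

lemma fresh_edges_subset: "fresh_edges V P F \<subseteq> all_edges V"
  using all_edges_mono[of "V - P" V] by (auto simp: fresh_edges_def)

text \<open>Values of \<open>g\<close> on \<open>P\<close> do no harm, because edges at
  \<open>P\<close> are revealed. If the new support has at least \<open>2 * m\<close> vertices, the
  neighbour sum takes over and the induction gives \<open>exp (- 8 * \<beta> * m)\<close>. If it is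
  smaller, the trivial bound 1 is dominated by \<open>4 ^ m * (1/2) ^ card (?N R)\<close>, with mean
  at most \<open>exp (- 4 * \<beta> * m) / 2\<close>. The term \<open>\<tau>\<close> is passed
  through the rounds without accumulating, and doubling keeps \<open>P\<close> within
  \<open>L\<close> plus twice the frontier.\<close>

lemma balanceable_unlikely:
  fixes g :: "nat \<Rightarrow> real"
  assumes "H \<subseteq> all_edges V" "P \<subseteq> V" "F = {x \<in> V - P. g x \<noteq> 0}" "1 \<le> card F"
    and "real (card P) \<le> L + 2 * real (card F)" "real (card P) \<le> L + 4 * real M"
  shows "subset_exp p (all_edges (V - P)) (\<lambda>R. of_bool (balanceable V (sym_diff H R) g)) \<le>
           exp (- 4 * \<beta> * real (card F)) + \<tau>"
  using assms
proof (induction "card V - card F" arbitrary: H P F g rule: less_induct)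
  case less
  define m where "m = card F"
  have FV: "F \<subseteq> V - P" "F \<subseteq> V" "P \<inter> F = {}" using less.prems(3) by auto
  have sub: "P \<union> F \<subseteq> V" using less.prems(2) FV by auto
  have finF: "finite F" using FV finV by (auto intro: finite_subset)
  have gF: "g x \<noteq> 0" if "x \<in> F" for x using less.prems(3) that by auto
  have g0: "g x = 0" if "x \<in> V - P - F" for x using less.prems(3) that by auto
  have edges: "sym_diff H R \<subseteq> all_edges V" if "R \<subseteq> all_edges V" for R
    using less.prems(1) that by auto
  show ?case
  proof (cases "M \<le> card F")
    case True
    have "subset_exp p (all_edges (V - P)) (\<lambda>R. of_bool (balanceable V (sym_diff H R) g)) \<le>
        subset_exp p (all_edges (V - P)) (\<lambda>R. of_bool (degree_balanced V (sym_diff H R) g))"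
    proof (rule subset_exp_mono)
      fix R assume "R \<subseteq> all_edges (V - P)"
      then have "R \<subseteq> all_edges V" using all_edges_mono[of "V - P" V] by auto
      then show "of_bool (balanceable V (sym_diff H R) g) \<le> (of_bool (degree_balanced V (sym_diff H R) g) :: real)"
        using balanceable_imp_degree_balanced[OF finV edges] by auto
    qed (use p in auto)
    also have "\<dots> \<le> \<tau>"
      by (rule degree_bound[OF less.prems(1,2) FV(1) gF True less.prems(6)])
    finally show ?thesis by (simp add: add_increasing)
  next
    case False
    let ?N = "\<lambda>R. new_support V (P \<union> F) (sym_diff H R) g"
    have m: "1 \<le> m" "m \<le> M" using less.prems(4) False by (auto simp: m_def)
    have cardPF: "real (card (P \<union> F)) \<le> L + 3 * real m"
      using card_Un_le[of P F] less.prems(5) unfolding m_def by linarith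
    have step: "subset_exp p (all_edges (V - (P \<union> F))) (\<lambda>S. of_bool (balanceable V (sym_diff H (R \<union> S)) g))
        \<le> 4 ^ m * (1/2) ^ card (?N R) + (exp (- 8 * \<beta> * real m) + \<tau>)"
      if R: "R \<subseteq> fresh_edges V P F" for R
    proof -
      define g1 where "g1 = neighbour_sum V (sym_diff H R) g"
      have N: "?N R = {x \<in> V - (P \<union> F). g1 x \<noteq> 0}" by (simp add: new_support_def g1_def)
      have RV: "R \<subseteq> all_edges V" using R fresh_edges_subset by blast
      have finN: "finite (?N R)" using finV by (simp add: N)
      have fin: "finite (all_edges (V - (P \<union> F)))" using finV by (simp add: finite_all_edges)
      show ?thesis
      proof (cases "card (?N R) < 2 * m")
        case True
        have "1 \<le> (2::real) ^ (2 * m - card (?N R))" by simp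
        also have "\<dots> = 4 ^ m * (1/2) ^ card (?N R)"
          using True by (simp add: power_diff power_mult power_one_over)
        finally have one: "1 \<le> 4 ^ m * (1/2 :: real) ^ card (?N R)" .
        have "subset_exp p (all_edges (V - (P \<union> F))) (\<lambda>S. of_bool (balanceable V (sym_diff H (R \<union> S)) g)) \<le> 1"
          using fin p by (intro subset_exp_le_const) auto
        moreover have "0 \<le> exp (- 8 * \<beta> * real m) + \<tau>" using \<tau>(1) by simp
        ultimately show ?thesis using one by linarith
      next
        case big: False
        have "subset_exp p (all_edges (V - (P \<union> F))) (\<lambda>S. of_bool (balanceable V (sym_diff H (R \<union> S)) g)) \<le>
            subset_exp p (all_edges (V - (P \<union> F))) (\<lambda>S. of_bool (balanceable V (sym_diff (sym_diff H R) S) g1))"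
        proof (rule subset_exp_mono)
          fix S assume S: "S \<subseteq> all_edges (V - (P \<union> F))"
          have "S \<subseteq> all_edges V" using S all_edges_mono[of "V - (P \<union> F)" V] by auto
          then have "R \<union> S \<subseteq> all_edges V" using RV by simp
          have "neighbour_sum V (sym_diff H (R \<union> S)) g = g1"
            unfolding g1_def by (rule neighbour_sum_fresh[OF finV g0]) (use S in \<open>auto simp: Diff_Un set_diff_eq\<close>)
          then show "of_bool (balanceable V (sym_diff H (R \<union> S)) g) \<le>
              (of_bool (balanceable V (sym_diff (sym_diff H R) S) g1) :: real)"
            using balanceable_neighbour_sum[OF finV edges[OF \<open>R \<union> S \<subseteq> all_edges V\<close>], of g]
              sym_diff_fresh[OF R S, of H] by auto
        qed (use p in auto)
        also have "\<dots> \<le> exp (- 4 * \<beta> * real (card (?N R))) + \<tau>"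
        proof (rule less.hyps[OF _ edges[OF RV] sub N])
          have "m < card (?N R)" using big m by linarith
          moreover have "card (?N R) \<le> card V" using finV N by (intro card_mono) auto
          ultimately show "card V - card (?N R) < card V - card F" unfolding m_def by linarith
          show "1 \<le> card (?N R)" using big m by linarith
          show "real (card (P \<union> F)) \<le> L + 2 * real (card (?N R))" using big cardPF by linarith
          show "real (card (P \<union> F)) \<le> L + 4 * real M" using m(2) cardPF by linarith
        qed
        also have "\<dots> \<le> exp (- 8 * \<beta> * real m) + \<tau>"
        proof -
          have "8 * \<beta> * real m = 4 * \<beta> * (2 * real m)" by simp
          also have "\<dots> \<le> 4 * \<beta> * real (card (?N R))"
            using big \<beta> by (intro mult_left_mono) auto
          finally show ?thesis by simp
        qed
        finally show ?thesis by (simp add: add_increasing)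
      qed
    qed
    have "subset_exp p (all_edges (V - P)) (\<lambda>R. of_bool (balanceable V (sym_diff H R) g)) \<le>
        subset_exp p (fresh_edges V P F) (\<lambda>R. 4 ^ m * (1/2) ^ card (?N R) + (exp (- 8 * \<beta> * real m) + \<tau>))"
      unfolding split_fresh_edges[of P _ F]
    proof (rule subset_exp_mono[OF p(1)])
      show "p \<le> 1" using p by simp
    qed (rule step)
    also have "\<dots> = 4 ^ m * subset_exp p (fresh_edges V P F) (\<lambda>R. (1/2) ^ card (?N R)) + (exp (- 8 * \<beta> * real m) + \<tau>)"
      unfolding subset_exp_add subset_exp_cmult
      using finV by (simp add: fresh_edges_def finite_all_edges)
    also have "\<dots> \<le> 4 ^ m * (exp (- 5 * \<beta> * real m) / 2) + (exp (- 8 * \<beta> * real m) + \<tau>)"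
    proof (intro add_right_mono mult_left_mono)
      show "subset_exp p (fresh_edges V P F) (\<lambda>R. (1/2) ^ card (?N R)) \<le> exp (- 5 * \<beta> * real m) / 2"
        unfolding m_def
        by (rule expected_new_support[OF less.prems(2) FV(1) _ _ less.prems(6) gF g0]) (use m in \<open>auto simp: m_def\<close>)
    qed simp
    finally have main: "subset_exp p (all_edges (V - P)) (\<lambda>R. of_bool (balanceable V (sym_diff H R) g)) \<le>
        4 ^ m * (exp (- 5 * \<beta> * real m) / 2) + (exp (- 8 * \<beta> * real m) + \<tau>)" .
    have e1: "4 ^ m * (exp (- 5 * \<beta> * real m) / 2) \<le> exp (- 4 * \<beta> * real m) / 2"
    proof -
      have "(4::real) \<le> exp \<beta>" 
      proof -
        have "(4::real) \<le> 2 * 2" by simp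
        also have "\<dots> \<le> exp 1 * exp (1::real)" using exp_ge_add_one_self[of 1] by (intro mult_mono) auto
        also have "\<dots> = exp 2" by (simp flip: exp_add)
        also have "\<dots> \<le> exp \<beta>" using \<beta> by simp
        finally show ?thesis .
      qed
      then have "4 ^ m \<le> exp \<beta> ^ m" by (intro power_mono) auto
      also have "\<dots> = exp (\<beta> * real m)" by (simp add: exp_of_nat2_mult)
      finally have "4 ^ m * exp (- 5 * \<beta> * real m) \<le> exp (\<beta> * real m) * exp (- 5 * \<beta> * real m)"
        by (intro mult_right_mono) auto
      also have "\<dots> = exp (- 4 * \<beta> * real m)" by (simp flip: exp_add)
      finally show ?thesis by simp
    qed
    have e2: "exp (- 8 * \<beta> * real m) \<le> exp (- 4 * \<beta> * real m) / 2"
    proof -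
      have "1 \<le> 4 * \<beta> * real m" using mult_mono[of 2 \<beta> 1 "real m"] \<beta> m(1) by simp
      then have "exp (- (4 * \<beta> * real m)) \<le> exp (- 1)" by simp
      also have "\<dots> \<le> (1/2 :: real)" using exp_ge_add_one_self[of 1] by (simp add: exp_minus field_simps)
      finally have "exp (- 4 * \<beta> * real m) * exp (- (4 * \<beta> * real m)) \<le> exp (- 4 * \<beta> * real m) * (1/2)"
        by (intro mult_left_mono) auto
      then show ?thesis by (simp add: mult.assoc flip: exp_add)
    qed
    show ?thesis using main e1 e2 unfolding m_def by linarith
  qed
qed

text \<open>The exponent is a potential: \<open>3 * \<beta>\<close> for every vertex missing to
  \<open>L\<close> and \<open>5 * \<beta>\<close> for every frontier vertex, whose edges are still
  partly random. Finding \<open>N\<close> costs \<open>3 * \<beta>\<close> per new vertex in the gap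
  and \<open>\<beta>\<close> for guessing its colour, and earns \<open>5 * \<beta>\<close>. The
  surplus \<open>\<beta>\<close> yields the factor \<open>(1/2) ^ card N\<close>, whose mean is at
  most \<open>exp (- 5 * \<beta> * card F) / 2\<close> by expansion.\<close>

lemma big_hull_unlikely:
  assumes "H \<subseteq> all_edges V" "Q \<subseteq> V" "twinned Q r" "F \<subseteq> Q" "F \<noteq> {}" "real (card Q) \<le> L"
  shows "subset_exp p (all_edges (V - (Q - F))) (\<lambda>R. of_bool (big_hull V (sym_diff H R) L Q r)) \<le>
           exp (- \<beta> * (3 * (L - real (card Q)) + 5 * real (card F)))"
  using assms
proof (induction "card V - card Q" arbitrary: H Q r F rule: less_induct)
  case less
  define P where "P = Q - F"
  define g where "g = generic_vector Q r"
  let ?N = "\<lambda>R. new_support V Q (sym_diff H R) g"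
  let ?gap = "L - real (card Q)"
  have PF: "P \<union> F = Q" "P \<subseteq> V" "F \<subseteq> V - P" using less.prems(2,4) by (auto simp: P_def)
  have finQ: "finite Q" "finite F" using less.prems(2,4) finV by (auto intro: finite_subset)
  have gQ: "g x \<noteq> 0" if "x \<in> Q" for x
    unfolding g_def by (rule generic_vector_nonzero[OF finQ(1) less.prems(3) that])
  have g0: "g x = 0" if "x \<in> V - P - F" for x using that by (auto simp: g_def generic_vector_def P_def)
  have edges: "sym_diff H R \<subseteq> all_edges V" if "R \<subseteq> all_edges V" for R
    using less.prems(1) that by auto
  have F1: "1 \<le> card F" using less.prems(5) finQ by (simp add: Suc_leI card_gt_0_iff)
  have FQ: "real (card F) \<le> real (card Q)" using finQ less.prems(4) by (simp add: card_mono)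
  have gap: "0 \<le> ?gap" using less.prems(6) by simp
  have step: "subset_exp p (all_edges (V - Q)) (\<lambda>S. of_bool (big_hull V (sym_diff H (R \<union> S)) L Q r))
      \<le> exp (- 3 * \<beta> * ?gap) * (1/2) ^ card (?N R) + \<tau>" if R: "R \<subseteq> fresh_edges V P F" for R
  proof -
    define N where "N = ?N R"
    have RV: "R \<subseteq> all_edges V" using R fresh_edges_subset by blast
    have fin: "finite (all_edges (V - Q))" using finV by (simp add: finite_all_edges)
    have finN: "finite N" "N \<subseteq> V" "N \<inter> Q = {}" using finV by (auto simp: N_def new_support_def)
    have same: "neighbour_sum V (sym_diff H (R \<union> S)) g = neighbour_sum V (sym_diff H R) g"
      "sym_diff H (R \<union> S) = sym_diff (sym_diff H R) S" "R \<union> S \<subseteq> all_edges V"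
      "new_support V Q (sym_diff H (R \<union> S)) g = N" if S: "S \<subseteq> all_edges (V - Q)" for S
    proof -
      have VQ: "V - P - F = V - Q" "V - (P \<union> F) = V - Q" using PF(1) by auto
      show eq: "neighbour_sum V (sym_diff H (R \<union> S)) g = neighbour_sum V (sym_diff H R) g"
        by (rule neighbour_sum_fresh[where P = P and F = F, OF finV g0]) (use S VQ in simp_all)
      show "sym_diff H (R \<union> S) = sym_diff (sym_diff H R) S"
        by (rule sym_diff_fresh[OF R]) (use S in \<open>simp add: VQ\<close>)
      show "R \<union> S \<subseteq> all_edges V" using RV S all_edges_mono[of "V - Q" V] by auto
      show "new_support V Q (sym_diff H (R \<union> S)) g = N" by (simp add: N_def new_support_def eq)
    qed
    \<comment> \<open>Without new vertices a large hull is impossible. A set still of size at most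
      \<open>L\<close> is treated by induction over all guesses. A set beyond \<open>L\<close>
      leaves the guessing phase: the whole gap is then at most \<open>card N\<close>, and
      \<open>balanceable_unlikely\<close> suffices.\<close>
    consider "N = {}" | "N \<noteq> {}" "real (card (Q \<union> N)) \<le> L" | "N \<noteq> {}" "L < real (card (Q \<union> N))"
      by linarith
    then have "subset_exp p (all_edges (V - Q)) (\<lambda>S. of_bool (big_hull V (sym_diff H (R \<union> S)) L Q r))
        \<le> exp (- 3 * \<beta> * ?gap) * (1/2) ^ card N + \<tau>"
    proof cases
      case 1
      have "subset_exp p (all_edges (V - Q)) (\<lambda>S. of_bool (big_hull V (sym_diff H (R \<union> S)) L Q r)) \<le>
          (0::real)"
      proof (rule subset_exp_le_const[OF fin])
        fix S assume S: "S \<subseteq> all_edges (V - Q)"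
        have "\<not> big_hull V (sym_diff H (R \<union> S)) L Q r"
          using big_hull_step(1)[OF finV edges[OF same(3)[OF S]] less.prems(2,3) _ refl] same(4)[OF S] 1
            less.prems(6) unfolding g_def by fastforce
        then show "of_bool (big_hull V (sym_diff H (R \<union> S)) L Q r) \<le> (0::real)" by simp
      qed (use p in auto)
      then show ?thesis using \<tau>(1) by (simp add: add_increasing order.trans)
    next
      case 2
      have sub: "Q \<union> N \<subseteq> V" using less.prems(2) finN by auto
      have cardQN: "card (Q \<union> N) = card Q + card N"
        using finQ finN by (intro card_Un_disjoint) auto
      have N1: "1 \<le> card N" using 2(1) finN by (simp add: Suc_leI card_gt_0_iff)
      let ?G = "{r' \<in> guesses Q N r. twinned (Q \<union> N) r'}"
      have finG: "finite (guesses Q N r)" by (rule finite_guesses) (use finQ finN in auto)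
      have "subset_exp p (all_edges (V - Q)) (\<lambda>S. of_bool (big_hull V (sym_diff H (R \<union> S)) L Q r)) \<le>
          subset_exp p (all_edges (V - Q))
            (\<lambda>S. \<Sum>r'\<in>?G. of_bool (big_hull V (sym_diff (sym_diff H R) S) L (Q \<union> N) r'))"
      proof (rule subset_exp_mono[OF p(1)])
        fix S assume S: "S \<subseteq> all_edges (V - Q)"
        show "of_bool (big_hull V (sym_diff H (R \<union> S)) L Q r) \<le>
            (\<Sum>r'\<in>?G. of_bool (big_hull V (sym_diff (sym_diff H R) S) L (Q \<union> N) r') :: real)"
        proof (cases "big_hull V (sym_diff H (R \<union> S)) L Q r")
          case True
          obtain r' where r': "r' \<in> ?G" "big_hull V (sym_diff H (R \<union> S)) L (Q \<union> N) r'"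
            using big_hull_step(2)[OF finV edges[OF same(3)[OF S]] less.prems(2,3) True refl]
              same(4)[OF S] unfolding g_def by auto
          have "(1::real) = of_bool (big_hull V (sym_diff (sym_diff H R) S) L (Q \<union> N) r')"
            using r'(2) same(2)[OF S] by simp
          also have "\<dots> \<le> (\<Sum>r'\<in>?G. of_bool (big_hull V (sym_diff (sym_diff H R) S) L (Q \<union> N) r'))"
            by (rule member_le_sum[OF r'(1)]) (use finG in auto)
          finally show ?thesis using True by simp
        qed (simp add: sum_nonneg)
      qed (use p in simp)
      also have "\<dots> = (\<Sum>r'\<in>?G. subset_exp p (all_edges (V - ((Q \<union> N) - N)))
            (\<lambda>S. of_bool (big_hull V (sym_diff (sym_diff H R) S) L (Q \<union> N) r')))"
      proof -
        have "(Q \<union> N) - N = Q" using finN by auto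
        then show ?thesis by (simp only: subset_exp_sum)
      qed
      also have "\<dots> \<le> (\<Sum>r'\<in>?G. exp (- \<beta> * (3 * (L - real (card (Q \<union> N))) + 5 * real (card N))))"
      proof (rule sum_mono)
        fix r' assume r': "r' \<in> ?G"
        have "card (Q \<union> N) \<le> card V" using finV sub by (intro card_mono) auto
        then have dec: "card V - card (Q \<union> N) < card V - card Q" using cardQN N1 by linarith
        show "subset_exp p (all_edges (V - ((Q \<union> N) - N)))
            (\<lambda>S. of_bool (big_hull V (sym_diff (sym_diff H R) S) L (Q \<union> N) r')) \<le>
            exp (- \<beta> * (3 * (L - real (card (Q \<union> N))) + 5 * real (card N)))"
          by (rule less.hyps[OF dec edges[OF RV] sub]) (use r' 2 in auto)
      qed
      also have "\<dots> = real (card ?G) * exp (- \<beta> * (3 * (L - real (card (Q \<union> N))) + 5 * real (card N)))"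
        by simp
      also have "\<dots> \<le> exp (\<beta> * real (card N)) *
          exp (- \<beta> * (3 * (L - real (card (Q \<union> N))) + 5 * real (card N)))"
      proof (rule mult_right_mono)
        have "card ?G \<le> card (guesses Q N r)" using finG by (intro card_mono) auto
        also have "\<dots> \<le> card (Q \<union> N) ^ card N" by (rule card_guesses) (use finQ finN in auto)
        finally have "real (card ?G) \<le> real (card (Q \<union> N)) ^ card N"
          by (simp flip: of_nat_power)
        also have "\<dots> \<le> exp \<beta> ^ card N" using 2(2) L(2) by (intro power_mono) auto
        also have "\<dots> = exp (\<beta> * real (card N))" by (simp add: exp_of_nat2_mult)
        finally show "real (card ?G) \<le> exp (\<beta> * real (card N))" .
      qed simp
      also have "\<dots> = exp (- 3 * \<beta> * ?gap) * exp (- \<beta> * real (card N))"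
        by (simp add: cardQN algebra_simps flip: exp_add)
      also have "\<dots> \<le> exp (- 3 * \<beta> * ?gap) * (1/2) ^ card N"
        by (intro mult_left_mono exp_le_half_power) auto
      finally show ?thesis using \<tau>(1) by linarith
    next
      case 3
      define g1 where "g1 = neighbour_sum V (sym_diff H R) g"
      have N_eq: "N = {x \<in> V - Q. g1 x \<noteq> 0}" by (simp add: N_def new_support_def g1_def)
      have cardQN: "card (Q \<union> N) = card Q + card N"
        using finQ finN by (intro card_Un_disjoint) auto
      have N1: "1 \<le> card N" using 3(1) finN by (simp add: Suc_leI card_gt_0_iff)
      have "subset_exp p (all_edges (V - Q)) (\<lambda>S. of_bool (big_hull V (sym_diff H (R \<union> S)) L Q r)) \<le>
          subset_exp p (all_edges (V - Q)) (\<lambda>S. of_bool (balanceable V (sym_diff (sym_diff H R) S) g1))"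
      proof (rule subset_exp_mono[OF p(1)])
        fix S assume S: "S \<subseteq> all_edges (V - Q)"
        have "balanceable V (sym_diff (sym_diff H R) S) g1" if "big_hull V (sym_diff H (R \<union> S)) L Q r"
          using balanceable_neighbour_sum[OF finV edges[OF same(3)[OF S]]
              big_hull_imp_balanceable[OF finV less.prems(2,3) that]]
            same(1,2)[OF S] by (simp add: g1_def g_def)
        then show "of_bool (big_hull V (sym_diff H (R \<union> S)) L Q r) \<le>
            (of_bool (balanceable V (sym_diff (sym_diff H R) S) g1) :: real)" by auto
      qed (use p in simp)
      also have "\<dots> \<le> exp (- 4 * \<beta> * real (card N)) + \<tau>"
        by (rule balanceable_unlikely[OF edges[OF RV] less.prems(2) N_eq N1]) (use less.prems(6) in auto)
      also have "exp (- 4 * \<beta> * real (card N)) \<le> exp (- 3 * \<beta> * ?gap) * exp (- \<beta> * real (card N))"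
      proof -
        have "?gap \<le> real (card N)" using 3(2) cardQN by simp
        then have "\<beta> * ?gap \<le> \<beta> * real (card N)" using \<beta> by (intro mult_left_mono) auto
        then show ?thesis by (simp add: algebra_simps flip: exp_add)
      qed
      also have "\<dots> \<le> exp (- 3 * \<beta> * ?gap) * (1/2) ^ card N"
        by (intro mult_left_mono exp_le_half_power) auto
      finally show ?thesis by simp
    qed
    then show ?thesis by (simp add: N_def)
  qed
  have fin_fresh: "finite (fresh_edges V P F)" using finV by (simp add: fresh_edges_def finite_all_edges)
  have "subset_exp p (all_edges (V - P)) (\<lambda>R. of_bool (big_hull V (sym_diff H R) L Q r)) \<le>
      subset_exp p (fresh_edges V P F) (\<lambda>R. exp (- 3 * \<beta> * ?gap) * (1/2) ^ card (?N R) + \<tau>)"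
    unfolding split_fresh_edges[of P _ F] PF(1)
  proof (rule subset_exp_mono[OF p(1)])
    show "p \<le> 1" using p by simp
  qed (rule step)
  also have "\<dots> = exp (- 3 * \<beta> * ?gap) * subset_exp p (fresh_edges V P F) (\<lambda>R. (1/2) ^ card (?N R)) + \<tau>"
    unfolding subset_exp_add subset_exp_cmult using fin_fresh by simp
  finally have main: "subset_exp p (all_edges (V - P)) (\<lambda>R. of_bool (big_hull V (sym_diff H R) L Q r)) \<le>
      exp (- 3 * \<beta> * ?gap) * subset_exp p (fresh_edges V P F) (\<lambda>R. (1/2) ^ card (?N R)) + \<tau>" .
  have "subset_exp p (fresh_edges V P F) (\<lambda>R. (1/2) ^ card (?N R)) \<le> exp (- 5 * \<beta> * real (card F)) / 2"
  proof -
    have "card P \<le> card Q" unfolding P_def using finQ by (intro card_mono) auto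
    then have "real (card P) \<le> L + 4 * real M" using less.prems(6) by linarith
    moreover have "card F \<le> M" using FQ less.prems(6) L(3) by linarith
    ultimately show ?thesis
      using expected_new_support[OF PF(2,3) F1, where g = g and H = H] gQ g0 less.prems(4) unfolding PF(1) by blast
  qed
  then have e1: "exp (- 3 * \<beta> * ?gap) * subset_exp p (fresh_edges V P F) (\<lambda>R. (1/2) ^ card (?N R)) \<le>
      exp (- 3 * \<beta> * ?gap) * (exp (- 5 * \<beta> * real (card F)) / 2)"
    by (intro mult_left_mono) auto
  have e2: "exp (- 3 * \<beta> * ?gap) * (exp (- 5 * \<beta> * real (card F)) / 2) =
      exp (- \<beta> * (3 * ?gap + 5 * real (card F))) / 2"
    by (simp add: algebra_simps flip: exp_add)
  \<comment> \<open>Since \<open>card F \<le> card Q \<le> L\<close>, the bracket never exceeds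
    \<open>8 * L\<close>; hence the bound \<open>exp (- 8 * \<beta> * L) / 2\<close> on
    \<open>\<tau>\<close>.\<close>
  have "\<tau> \<le> exp (- \<beta> * (3 * ?gap + 5 * real (card F))) / 2"
  proof -
    have "3 * (l - q) + 5 * f \<le> 8 * l" if "f \<le> q" "q \<le> l" "0 \<le> l" for f q l :: real
      using that by argo
    then have "3 * ?gap + 5 * real (card F) \<le> 8 * L" using FQ less.prems(6) L(1) by blast
    then have "\<beta> * (3 * ?gap + 5 * real (card F)) \<le> \<beta> * (8 * L)" using \<beta> by (intro mult_left_mono) auto
    then have "exp (- 8 * \<beta> * L) \<le> exp (- \<beta> * (3 * ?gap + 5 * real (card F)))" by (simp add: algebra_simps)
    then show ?thesis using \<tau>(2) by linarith
  qed
  then show ?case using main e1 e2 unfolding P_def by linarith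
qed

end

subsection \<open>Asymptotic estimates\<close>

text \<open>Here the constant 100 enters. With \<open>x = 2 * p * m\<close> one has
  \<open>1 - z \<ge> x / (1 + x)\<close>. For \<open>x \<le> 1\<close> this is at least
  \<open>p * m\<close>, and \<open>N \<ge> n / 2\<close> gives the exponent
  \<open>12.5 * \<beta> * m\<close>, above the required \<open>5 * \<beta> * m + 1\<close>. For
  \<open>x > 1\<close> it is at least 1/2, and \<open>M\<close> is small against \<open>n\<close>.
  The additional 1 in the exponent yields the factor 1/2.\<close>

lemma expansion_rate:
  fixes p \<beta> :: real
  assumes p: "0 \<le> p" "p \<le> 1/2" "100 * \<beta> \<le> p * real n" and \<beta>: "2 \<le> \<beta>"
    and m: "1 \<le> m" "m \<le> M" and N: "n \<le> 2 * N" and M: "16 * (5 * \<beta> * real M + 1) \<le> real n"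
  shows "((3 + (1 - 2 * p) ^ m) / 4) ^ N \<le> exp (- 5 * \<beta> * real m) / 2"
proof -
  define z where "z = (1 - 2 * p) ^ m"
  define x where "x = 2 * p * real m"
  have x: "0 \<le> x" using p by (simp add: x_def)
  have "z \<le> exp (- (2 * p)) ^ m"
    unfolding z_def using p exp_ge_add_one_self[of "- (2 * p)"] by (intro power_mono) auto
  also have "\<dots> = exp (- x)" by (simp add: x_def exp_of_nat2_mult[symmetric] mult.commute)
  also have "\<dots> \<le> 1 / (1 + x)"
    using exp_ge_add_one_self[of x] x by (simp add: exp_minus divide_inverse le_imp_inverse_le)
  finally have z: "1 - z \<ge> x / (1 + x)" using x by (simp add: field_simps)
  have z1: "z \<le> 1" using z x by (smt (verit) divide_nonneg_nonneg)
  have \<beta>m: "2 \<le> \<beta> * real m" using mult_mono[of 2 \<beta> 1 "real m"] \<beta> m(1) by simp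
  have N': "real n / 8 \<le> real N / 4" using N by linarith
  have key: "5 * \<beta> * real m + 1 \<le> (1 - z) * (real N / 4)"
  proof (cases "x \<le> 1")
    case True
    have "x / 2 \<le> x / (1 + x)" using x True by (intro divide_left_mono) auto
    then have "p * real m \<le> 1 - z" using z by (simp add: x_def)
    then have "(p * real m) * (real n / 8) \<le> (1 - z) * (real N / 4)"
      using N' p z1 by (intro mult_mono) auto
    moreover have "(100 * \<beta>) * (real m / 8) \<le> (p * real n) * (real m / 8)"
      using p(3) by (intro mult_right_mono) auto
    ultimately show ?thesis using \<beta>m by (simp add: algebra_simps)
  next
    case False
    have "1 / 2 \<le> x / (1 + x)" using False by (simp add: field_simps)
    then have "1 / 2 \<le> 1 - z" using z by linarith
    then have "(1/2) * (real n / 8) \<le> (1 - z) * (real N / 4)"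
      using N' z z1 by (intro mult_mono) auto
    moreover have "5 * \<beta> * real m \<le> 5 * \<beta> * real M" using m \<beta> by (intro mult_left_mono) auto
    then have "5 * \<beta> * real m + 1 \<le> (1/2) * (real n / 8)" using M by simp
    ultimately show ?thesis by (rule order.trans[rotated])
  qed
  have "((3 + z) / 4) ^ N \<le> exp (- ((1 - z) / 4)) ^ N"
  proof (rule power_mono)
    show "(3 + z) / 4 \<le> exp (- ((1 - z) / 4))"
      using exp_ge_add_one_self[of "- ((1 - z) / 4)"] by (simp add: field_simps)
    show "0 \<le> (3 + z) / 4" using p by (simp add: z_def)
  qed
  also have "\<dots> = exp (- ((1 - z) * (real N / 4)))"
    by (simp add: exp_of_nat2_mult[symmetric])
  also have "\<dots> \<le> exp (- (5 * \<beta> * real m + 1))" using key by simp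
  also have "\<dots> = exp (- 5 * \<beta> * real m) * exp (- 1)" by (simp flip: exp_add)
  also have "\<dots> \<le> exp (- 5 * \<beta> * real m) * (1 / 2)"
    using exp_ge_add_one_self[of 1] by (intro mult_left_mono) (auto simp: exp_minus field_simps)
  finally show ?thesis by (simp add: z_def)
qed

lemma asymptotic_conditions:
  "\<forall>\<^sub>F n in sequentially.
     2 \<le> ln (ln (real n)) \<and> 2 \<le> ln (real n) / ln (ln (real n)) \<and>
     ln (real n) / ln (ln (real n)) \<le> sqrt (real n) / 4 - 1 \<and>
     16 * (5 * ln (ln (real n)) * (sqrt (real n) / 2 + 1) + 1) \<le> real n \<and>
     3 * real n / 4 + ln (real n) / ln (ln (real n)) + 5 * (sqrt (real n) / 2 + 1) \<le> real n \<and>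
     2 * (ln (real n) / ln (ln (real n)) + 5 * (sqrt (real n) / 2 + 1)) \<le> real n \<and>
     1 \<le> sqrt (sqrt (real n)) - 1 \<and> real n ^ 9 \<le> (sqrt (sqrt (real n)) - 1) ^ 50 \<and>
     2 * (20 * ln (real n) + 1) * sqrt (sqrt (real n)) \<le> sqrt (real n) / 4 - 1 \<and>
     1 / real n ^ 9 + (real n + 1) ^ 100 * exp (- ((sqrt (real n) / 4 - 1) / 2)) \<le> 1 / real n ^ 8 / 2"
  by (intro eventually_conj; real_asymp)

text \<open>The exponent is the lower bound \<open>(100 * \<beta> / n) * (n / 4 - 1)\<close> for
  \<open>p * a\<close> with \<open>a\<close> about \<open>n / 4\<close>. It grows only like
  \<open>ln (ln n)\<close>, enough to beat a fixed \<open>C\<close>.\<close>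

lemma asymptotic_exp_small:
  assumes "0 < C"
  shows "\<forall>\<^sub>F n in sequentially. C * exp (- (25 * ln (ln (real n)) - 100 * ln (ln (real n)) / real n)) \<le> 1/32"
proof -
  have "(\<lambda>n. exp (- (25 * ln (ln (real n)) - 100 * ln (ln (real n)) / real n))) \<longlonglongrightarrow> 0"
    by real_asymp
  then have "\<forall>\<^sub>F n in sequentially. exp (- (25 * ln (ln (real n)) - 100 * ln (ln (real n)) / real n)) < 1 / (32 * C)"
    by (rule order_tendstoD) (use assms in simp)
  then show ?thesis
    by eventually_elim (use assms in \<open>simp add: field_simps\<close>)
qed

lemma half_power_le_exp: "(1/2 :: real) ^ k \<le> exp (- (real k / 2))"
proof -
  have "exp (1/2 :: real) \<le> 2"
  proof -
    have "exp (1/2 :: real) \<le> exp (ln 2)" using ln2_ge_two_thirds by (subst exp_le_cancel_iff) simp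
    then show ?thesis by simp
  qed
  then have "1/2 \<le> exp (- (1/2) :: real)" by (simp add: exp_minus field_simps)
  then have "(1/2 :: real) ^ k \<le> exp (- (1/2)) ^ k" by (intro power_mono) auto
  then show ?thesis by (simp add: exp_of_nat2_mult[symmetric])
qed

lemma exploration_eventually:
  obtains m where "\<forall>\<^sub>F n in sequentially. \<forall>p. p \<in> {0..1/2} \<longrightarrow> 100 * ln (ln (real n)) / real n \<le> p \<longrightarrow>
      2 \<le> ln (real n) / ln (ln (real n)) \<and>
      exploration {1..n} p (ln (ln (real n))) (ln (real n) / ln (ln (real n)))
        (1 / real n ^ 9 + (real n + 1) ^ 100 * exp (- ((sqrt (real n) / 4 - 1) / 2))) (m n)"
proof -
  \<comment> \<open>404 is \<open>4 + 4 * r\<close> for \<open>r = 100\<close>. As \<open>k\<close>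
    is constant, \<open>2 ^ k * (1 - p) ^ a\<close> still becomes small.\<close>
  obtain k :: nat where k: "0 < k" "404 * (1 / sqrt (real k)) \<le> 1/32"
  proof -
    obtain j :: nat where j: "404 * 32 < real j" using reals_Archimedean2 by blast
    then have "404 * (1 / sqrt (real (j\<^sup>2))) \<le> 1/32" by (simp add: field_simps)
    moreover have "0 < j\<^sup>2" using j by (cases j) auto
    ultimately show thesis by (rule that[rotated])
  qed
  have small: "\<forall>\<^sub>F n in sequentially. 404 * 2 ^ k *
      exp (- (25 * ln (ln (real n)) - 100 * ln (ln (real n)) / real n)) \<le> 1/32"
    by (rule asymptotic_exp_small) simp
  \<comment> \<open>\<open>m0\<close> pairs need \<open>2 * m0 + 1\<close> support vertices. At size
    about \<open>sqrt n\<close> the power \<open>(1/2) ^ m0\<close> beats the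
    \<open>(n + 1) ^ 100\<close> lists of degrees, while \<open>\<beta> * M\<close> stays small
    enough against \<open>n\<close> for the expansion.\<close>
  define m0 where "m0 n = nat \<lfloor>sqrt (real n) / 4\<rfloor>" for n
  show thesis
  proof (rule that[of "\<lambda>n. 2 * m0 n + 1"])
    show "\<forall>\<^sub>F n in sequentially. \<forall>p. p \<in> {0..1/2} \<longrightarrow> 100 * ln (ln (real n)) / real n \<le> p \<longrightarrow>
      2 \<le> ln (real n) / ln (ln (real n)) \<and>
      exploration {1..n} p (ln (ln (real n))) (ln (real n) / ln (ln (real n)))
        (1 / real n ^ 9 + (real n + 1) ^ 100 * exp (- ((sqrt (real n) / 4 - 1) / 2))) (2 * m0 n + 1)"
      using asymptotic_conditions small eventually_gt_at_top[of 1]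
    proof eventually_elim
      case (elim n)
      show ?case
      proof (intro allI impI)
        fix p assume p_range: "p \<in> {0..1/2::real}" and p_lower: "100 * ln (ln (real n)) / real n \<le> p"
        define x \<beta> L where "x = real n" and "\<beta> = ln (ln x)" and "L = ln x / \<beta>"
        define M where "M = 2 * m0 n + 1"
        define \<tau> where "\<tau> = 1 / x ^ 9 + (x + 1) ^ 100 * exp (- ((sqrt x / 4 - 1) / 2))"
        note C = elim(1)[folded x_def, folded \<beta>_def, folded L_def, folded \<tau>_def]
        have x: "0 < x" using elim by (simp add: x_def)
        have p: "0 \<le> p" "p \<le> 1/2" "100 * \<beta> \<le> p * x"
          using p_range p_lower x by (auto simp: x_def \<beta>_def field_simps)
        have \<beta>: "2 \<le> \<beta>" using C by simp
        have lnx: "exp \<beta> = ln x"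
          unfolding \<beta>_def using elim(3) by (intro exp_ln) (simp add: x_def)
        have \<beta>L: "\<beta> * L = ln x" using \<beta> by (simp add: L_def)
        have floor: "y - 1 \<le> real (nat \<lfloor>y\<rfloor>) \<and> real (nat \<lfloor>y\<rfloor>) \<le> y" if "0 \<le> y" for y
          using that of_nat_floor[of y] by linarith
        have m0: "sqrt x / 4 - 1 \<le> real (m0 n)" "real (m0 n) \<le> sqrt x / 4"
          using floor[of "sqrt x / 4"] x by (simp_all add: m0_def x_def)
        have M: "real M \<le> sqrt x / 2 + 1" "L \<le> real M"
          using m0 C by (simp_all add: M_def)
        have "exploration {1..n} p \<beta> L \<tau> M"
        proof
          show "finite {1..n}" "0 \<le> p" "p \<le> 1/2" "2 \<le> \<beta>" "L \<le> real M" by (fact | simp)+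
          show "0 \<le> L" using C by simp
          show "L \<le> exp \<beta>" unfolding lnx
          proof -
            have "L \<le> ln x / 1" unfolding L_def using \<beta> lnx by (intro divide_left_mono) (auto simp flip: lnx)
            then show "L \<le> ln x" by simp
          qed
          show "((3 + (1 - 2 * p) ^ m) / 4) ^ N \<le> exp (- 5 * \<beta> * real m) / 2"
            if "1 \<le> m" "m \<le> M" "card {1..n} \<le> 2 * N" for m N
          proof (rule expansion_rate[OF p(1,2) _ \<beta> that(1,2)])
            show "100 * \<beta> \<le> p * real n" using p(3) by (simp add: x_def)
            show "n \<le> 2 * N" using that(3) by simp
            have "5 * \<beta> * real M \<le> 5 * \<beta> * (sqrt x / 2 + 1)" using M(1) \<beta> by (intro mult_left_mono) auto
            then have "16 * (5 * \<beta> * real M + 1) \<le> 16 * (5 * \<beta> * (sqrt x / 2 + 1) + 1)" by simp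
            also have "\<dots> \<le> x" using C by blast
            finally show "16 * (5 * \<beta> * real M + 1) \<le> real n" by (simp add: x_def)
          qed
          show "2 * (L + 5 * real M) \<le> real (card {1..n})"
            using C M(1) by (simp flip: x_def)
          show "0 \<le> \<tau>" using x by (simp add: \<tau>_def)
          have "exp (- 8 * \<beta> * L) = 1 / x ^ 8"
          proof -
            have "exp (- 8 * \<beta> * L) = exp (- (real 8 * ln x))" using \<beta>L by (simp add: mult.assoc)
            also have "\<dots> = 1 / exp (ln x) ^ 8"
              unfolding exp_minus exp_of_nat_mult by (simp add: inverse_eq_divide)
            finally show ?thesis using x by simp
          qed
          then show "\<tau> \<le> exp (- 8 * \<beta> * L) / 2" using C by (simp only:)
        next
          fix H :: "nat set set" and P F :: "nat set" and g :: "nat \<Rightarrow> real"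
          assume H: "H \<subseteq> all_edges {1..n}" "P \<subseteq> {1..n}" "F \<subseteq> {1..n} - P" "\<And>y. y \<in> F \<Longrightarrow> g y \<noteq> 0"
            "M \<le> card F" "real (card P) \<le> L + 4 * real M"
          \<comment> \<open>With \<open>s\<close> about \<open>n ^ (1/4)\<close> and
            \<open>r = 100\<close>, the heavy levels give \<open>s ^ (-50)\<close>, below
            \<open>n ^ (-9)\<close>; with \<open>t\<close> about \<open>20 * ln n\<close>, the
            distinct levels give at most \<open>n ^ (-10)\<close>. Both are compatible with
            \<open>2 * t * s \<le> m0\<close>. Taking \<open>a\<close> about \<open>n / 4\<close>
            leaves room for \<open>P\<close> and the pairs in
            \<open>3 * a + card P + (2 * m0 + 1) \<le> n\<close>.\<close>
          define s where "s = nat \<lfloor>sqrt (sqrt x)\<rfloor>"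
          define t where "t = nat \<lceil>20 * ln x\<rceil>"
          define a where "a = nat \<lfloor>x / 4\<rfloor>"
          have s: "sqrt (sqrt x) - 1 \<le> real s" "real s \<le> sqrt (sqrt x)" "0 < s"
            using C x floor[of "sqrt (sqrt x)"] unfolding s_def by (simp, simp, linarith)
          have lnx0: "0 \<le> ln x" by (simp flip: lnx)
          have t: "20 * ln x \<le> real t" "real t \<le> 20 * ln x + 1"
            using lnx0 unfolding t_def by linarith+
          have a: "real a \<le> x / 4" "x / 4 - 1 \<le> real a" using x floor[of "x / 4"] by (simp_all add: a_def)
          have "subset_exp p (all_edges ({1..n} - P)) (\<lambda>R. of_bool (degree_balanced {1..n} (sym_diff H R) g)) \<le>
              1 / x ^ 9 + real (card {1..n} + 1) ^ 100 * (1/2) ^ m0 n"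
          proof (rule degree_balanced_unlikely[OF _ H(1-4) p(1,2)])
            show "2 * m0 n + 1 \<le> card F" using H(5) by (simp add: M_def)
            have "real (3 * a + card P + (2 * m0 n + 1)) \<le> real n"
              using a(1) H(6) M(1) C by (simp add: M_def flip: x_def)
            then show "3 * a + card P + (2 * m0 n + 1) \<le> card {1..n}" by simp
            show "0 < s" by (fact s)
            have "(1 / sqrt (real s)) ^ 100 = ((1 / sqrt (real s))\<^sup>2) ^ 50"
              unfolding power_mult[symmetric] by simp
            also have "\<dots> = 1 / real s ^ 50" by (simp add: power_one_over)
            also have "\<dots> \<le> 1 / x ^ 9"
            proof (rule divide_left_mono)
              have "x ^ 9 \<le> (sqrt (sqrt x) - 1) ^ 50" using C by simp
              also have "\<dots> \<le> real s ^ 50" using s C by (intro power_mono) auto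
              finally show "x ^ 9 \<le> real s ^ 50" .
            qed (use x s in auto)
            finally show "(1 / sqrt (real s)) ^ 100 \<le> 1 / x ^ 9" .
            have "(1/2) ^ t \<le> exp (- (real t / 2))" by (rule half_power_le_exp)
            also have "\<dots> \<le> exp (- (real 9 * ln x))" using t(1) lnx0 by simp
            also have "\<dots> = 1 / exp (ln x) ^ 9"
              unfolding exp_minus exp_of_nat_mult by (simp add: inverse_eq_divide)
            finally show "(1/2) ^ t \<le> 1 / x ^ 9" using x by simp
            have "real (2 * t * s) \<le> 2 * (20 * ln x + 1) * sqrt (sqrt x)"
              using t(2) s(2) lnx0 by (simp add: mult_mono)
            also have "\<dots> \<le> real (m0 n)" using C m0(1) by linarith
            finally show "2 * t * s \<le> m0 n" by (simp only: of_nat_le_iff)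
            show "0 < k" by (fact k)
            have "(1 - p) ^ a \<le> exp (- p) ^ a"
              using p exp_ge_add_one_self[of "- p"] by (intro power_mono) auto
            also have "\<dots> = exp (- (p * real a))" by (simp add: exp_of_nat2_mult[symmetric])
            also have "\<dots> \<le> exp (- (25 * \<beta> - 100 * \<beta> / x))"
            proof -
              have "25 * \<beta> - 100 * \<beta> / x = (100 * \<beta> / x) * (x / 4 - 1)" using x by (simp add: field_simps)
              also have "\<dots> \<le> p * real a"
              proof (rule mult_mono)
                show "100 * \<beta> / x \<le> p" using p(3) x by (simp add: field_simps)
                show "0 \<le> x / 4 - 1"
                proof -
                  have "2 \<le> L" "L \<le> sqrt x / 4 - 1" using C by blast+
                  then have "2 \<le> sqrt x" by linarith
                  then have "2 * 2 \<le> sqrt x * sqrt x" using x by (intro mult_mono) auto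
                  then show ?thesis using x by simp
                qed
              qed (use a p in auto)
              finally show ?thesis by simp
            qed
            finally have "404 * 2 ^ k * (1 - p) ^ a \<le> 404 * 2 ^ k * exp (- (25 * \<beta> - 100 * \<beta> / x))"
              by (intro mult_left_mono) auto
            also have "\<dots> \<le> 1/32" using elim(2) by (simp add: \<beta>_def x_def)
            finally have "404 * (2 ^ k * (1 - p) ^ a) \<le> 1/32" by (simp only: mult.assoc)
            then show "(4 + 4 * real 100) * (1 / sqrt (real k) + 2 ^ k * (1 - p) ^ a) \<le> 1 / 16"
              using k(2) by (simp only: distrib_left) simp
          qed simp
          also have "real (card {1..n} + 1) ^ 100 * (1/2) ^ m0 n \<le>
              (x + 1) ^ 100 * exp (- ((sqrt x / 4 - 1) / 2))"
          proof -
            have "(1/2) ^ m0 n \<le> exp (- (real (m0 n) / 2))" by (rule half_power_le_exp)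
            also have "\<dots> \<le> exp (- ((sqrt x / 4 - 1) / 2))" using m0(1) by simp
            finally have "(x + 1) ^ 100 * (1/2) ^ m0 n \<le> (x + 1) ^ 100 * exp (- ((sqrt x / 4 - 1) / 2))"
              using x by (intro mult_left_mono) auto
            then show ?thesis by (simp add: x_def add.commute)
          qed
          finally show "subset_exp p (all_edges ({1..n} - P)) (\<lambda>R. of_bool (degree_balanced {1..n} (sym_diff H R) g)) \<le> \<tau>"
            by (simp add: \<tau>_def)
        qed
        then show "2 \<le> ln (real n) / ln (ln (real n)) \<and>
            exploration {1..n} p (ln (ln (real n))) (ln (real n) / ln (ln (real n)))
              (1 / real n ^ 9 + (real n + 1) ^ 100 * exp (- ((sqrt (real n) / 4 - 1) / 2))) (2 * m0 n + 1)"
          using C by (simp add: x_def \<beta>_def L_def M_def \<tau>_def)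
      qed
    qed
  qed
qed

section \<open>Union bound over all starting pairs\<close>

theorem theoremB1:
  fixes p :: "nat \<Rightarrow> real" and G0 :: "nat \<Rightarrow> nat set set"
  assumes p_range: "\<And>n. p n \<in> {0..1/2}"
    and p_lower: "eventually (\<lambda>n. p n \<ge> 100 * ln (ln (real n)) / real n) sequentially"
    and G0: "\<And>n. G0 n \<subseteq> all_edges {1..n}"
  shows "(\<lambda>n. measure_pmf.prob (random_graph {1..n} (p n))
            {Grand. let G = sym_diff (G0 n) Grand in
               \<forall>C \<in> graph_components {1..n}
                      (disparity_graph {1..n} G (stable_refinement {1..n} G trivial_colouring)).
                 real (card C) \<le> ln (real n) / ln (ln (real n))})
         \<longlonglongrightarrow> 1"
proof -
  define good where "good n = {Grand. let G = sym_diff (G0 n) Grand in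
               \<forall>C \<in> graph_components {1..n}
                      (disparity_graph {1..n} G (stable_refinement {1..n} G trivial_colouring)).
                 real (card C) \<le> ln (real n) / ln (ln (real n))}" for n
  define \<beta> where "\<beta> n = ln (ln (real n))" for n :: nat
  define L where "L n = ln (real n) / \<beta> n" for n :: nat
  define \<tau> where "\<tau> n = 1 / real n ^ 9 + (real n + 1) ^ 100 * exp (- ((sqrt (real n) / 4 - 1) / 2))" for n :: nat
  obtain M where "\<forall>\<^sub>F n in sequentially. \<forall>p. p \<in> {0..1/2} \<longrightarrow> 100 * ln (ln (real n)) / real n \<le> p \<longrightarrow>
      2 \<le> L n \<and> exploration {1..n} p (\<beta> n) (L n) (\<tau> n) (M n)"
    using exploration_eventually unfolding \<beta>_def L_def \<tau>_def by blast
  then have lower: "\<forall>\<^sub>F n in sequentially.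
      1 - 1 / real n \<le> measure_pmf.prob (random_graph {1..n} (p n)) (good n)"
    using p_lower eventually_gt_at_top[of 1]
  proof eventually_elim
    case (elim n)
    let ?V = "{1..n}"
    \<comment> \<open>Used twice: an oversized component has at least two vertices, and a starting
      pair is within the guessing phase.\<close>
    have L2: "2 \<le> L n" using elim p_range by blast
    interpret exploration ?V "p n" "\<beta> n" "L n" "\<tau> n" "M n" using elim p_range by blast
    \<comment> \<open>The constant map encodes the guess that \<open>u\<close> and \<open>v\<close>
      have the same colour, with \<open>u\<close> as representative.\<close>
    let ?bad = "\<lambda>R u v. big_hull ?V (sym_diff (G0 n) R) (L n) {u, v} (\<lambda>_. u)"
    have bad: "of_bool (R \<in> - good n) \<le> (\<Sum>u\<in>?V. \<Sum>v\<in>?V - {u}. of_bool (?bad R u v) :: real)"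
      if R: "R \<subseteq> all_edges ?V" for R
    proof (cases "R \<in> good n")
      case False
      define G where "G = sym_diff (G0 n) R"
      define c :: "nat \<Rightarrow> unit colour" where "c = stable_refinement ?V G trivial_colouring"
      have G: "G \<subseteq> all_edges ?V" using G0[of n] R by (auto simp: G_def)
      have c: "equitable ?V G c" unfolding c_def by (rule equitable_stable_refinement[OF finV G])
      obtain T where T: "T \<in> graph_components ?V (disparity_graph ?V G c)" "L n < real (card T)"
        using False by (auto simp: good_def Let_def G_def c_def L_def \<beta>_def not_le)
      have "2 \<le> card T" using T(2) L2 by linarith
      then obtain u v where uv: "u \<in> ?V" "v \<in> ?V" "u \<noteq> v" "c u = c v"
        "T \<subseteq> hull_under (\<lambda>x y. {x, y} \<in> G) ?V c {u, v}"
        using component_subset_hull[OF finV G c T(1)] by blast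
      have "card T \<le> card (hull_under (\<lambda>x y. {x, y} \<in> G) ?V c {u, v})"
      proof (rule card_mono[OF finite_subset[OF hull_under_subset finV] uv(5)])
        show "{u, v} \<subseteq> ?V" using uv by simp
      qed
      then have "?bad R u v"
        unfolding big_hull_def G_def[symmetric] using T(2) uv(4) c by (intro exI[of _ c]) auto
      then have "(1::real) = of_bool (?bad R u v)" by simp
      also have "\<dots> \<le> (\<Sum>v\<in>?V - {u}. of_bool (?bad R u v))"
        by (rule member_le_sum) (use uv in auto)
      also have "\<dots> \<le> (\<Sum>u\<in>?V. \<Sum>v\<in>?V - {u}. of_bool (?bad R u v))"
        by (rule member_le_sum[of u ?V "\<lambda>u. \<Sum>v\<in>?V - {u}. of_bool (?bad R u v) :: real"])
          (use uv in \<open>auto intro: sum_nonneg\<close>)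
      finally show ?thesis using False by simp
    qed (simp add: sum_nonneg)
    have pair: "subset_exp (p n) (all_edges ?V) (\<lambda>R. of_bool (?bad R u v)) \<le> 1 / real n ^ 3"
      if uv: "u \<in> ?V" "v \<in> ?V - {u}" for u v
    proof -
      have "twinned {u, v} (\<lambda>_. u)" using uv by (auto simp: twinned_def)
      then have "subset_exp (p n) (all_edges (?V - ({u, v} - {u, v}))) (\<lambda>R. of_bool (?bad R u v)) \<le>
          exp (- \<beta> n * (3 * (L n - real (card {u, v})) + 5 * real (card {u, v})))"
        using uv L2 by (intro big_hull_unlikely G0) auto
      \<comment> \<open>The bracket is \<open>3 * (L - 2) + 10 \<ge> 3 * L\<close>, and
        \<open>\<beta> * L = ln n\<close>. The resulting \<open>n ^ (-3)\<close> beats the fewer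
        than \<open>n ^ 2\<close> pairs.\<close>
      also have "\<dots> \<le> exp (- (real 3 * ln (real n)))"
      proof -
        have "\<beta> n * L n = ln (real n)" using \<beta> by (simp add: L_def)
        moreover have "card {u, v} = 2" using uv by auto
        ultimately show ?thesis using \<beta> by (simp add: algebra_simps)
      qed
      also have "\<dots> = 1 / exp (ln (real n)) ^ 3"
        unfolding exp_minus exp_of_nat_mult by (simp add: inverse_eq_divide)
      finally show ?thesis using elim(3) by simp
    qed
    have "measure_pmf.prob (random_graph ?V (p n)) (- good n) =
        subset_exp (p n) (all_edges ?V) (\<lambda>R. of_bool (R \<in> - good n))"
      unfolding random_graph_def
      by (rule prob_Pi_pmf_bernoulli) (use p finite_all_edges in auto)
    also have "\<dots> \<le> subset_exp (p n) (all_edges ?V)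
        (\<lambda>R. \<Sum>u\<in>?V. \<Sum>v\<in>?V - {u}. of_bool (?bad R u v))"
      by (rule subset_exp_mono[OF p(1) _ bad]) (use p in auto)
    also have "\<dots> = (\<Sum>u\<in>?V. \<Sum>v\<in>?V - {u}. subset_exp (p n) (all_edges ?V) (\<lambda>R. of_bool (?bad R u v)))"
      unfolding subset_exp_sum ..
    also have "\<dots> \<le> (\<Sum>u\<in>?V. \<Sum>v\<in>?V - {u}. 1 / real n ^ 3)"
      by (intro sum_mono pair)
    also have "\<dots> \<le> 1 / real n"
      using elim(3) by (simp add: field_simps power3_eq_cube)
    finally show ?case
      using measure_pmf.prob_compl[of "good n" "random_graph ?V (p n)"] by (simp add: Compl_eq_Diff_UNIV)
  qed
  have lim: "(\<lambda>n. 1 - 1 / real n) \<longlonglongrightarrow> 1" by real_asymp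
  have "(\<lambda>n. measure_pmf.prob (random_graph {1..n} (p n)) (good n)) \<longlonglongrightarrow> 1"
    by (rule tendsto_sandwich[OF lower _ lim tendsto_const]) (simp add: measure_pmf.prob_le_1)
  then show ?thesis by (simp add: good_def)
qed


end
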